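(* Let $\Gamma$ be a compact Lie group, let $\mathbb{R}^n$ be an orthogonal representation of $\Gamma$, and let $\Omega\subset\mathbb{R}^n$ be an open, $\Gamma$-invariant subset. Let $U:\Omega\to\mathbb{R}$ be a $\Gamma$-invariant potential of class $C^2$ and let $q_0\in\Omega$ satisfy $\nabla U(q_0)=0$. Assume that (1) $\Gamma$ is abelian, or the isotropy group $\Gamma_{q_0}$ is isomorphic to the torus $T^{l_0}$ for some $l_0\in\mathbb{N}\cup\{0\}$; (2) $\dim\ker\nabla^2U(q_0)=\dim\Gamma(q_0)$; (3) $\sigma(\nabla^2U(q_0))\cap(0,+\infty)=\{\beta_1^2,\ldots,\beta_m^2\}$ with $\beta_1>\beta_2>\cdots>\beta_m>0$ and $m\ge1$. Then for any $\beta_{j_0}$ such that $\beta_j/\beta_{j_0}\notin\mathbb{N}$ for all $j\ne j_0$, there exists a sequence $(q_k(t))$ of periodic solutions of the system $\ddot q(t)=-\nabla U(q(t))$ with a sequence $(T_k)$ of minimal periods such that $T_k\to 2\pi/\beta_{j_0}$ and for any $\varepsilon>0$ there exists $k_0\in\mathbb{N}$ such that $q_k([0,T_k])\subset\Gamma(q_0)_\varepsilon$ for all $k\ge k_0$.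
   Context: $\mathbb{N}=\{1,2,\ldots\}$. An orthogonal representation of $\Gamma$ on $\mathbb{R}^n$ is a continuous homomorphism $\Gamma\to O(n)$; $\gamma q$ denotes the resulting linear action. $\Omega$ is $\Gamma$-invariant if $\gamma q\in\Omega$ for all $\gamma\in\Gamma$, $q\in\Omega$; $U$ is $\Gamma$-invariant if $U(\gamma q)=U(q)$ for all $\gamma\in\Gamma$, $q\in\Omega$. $\Gamma_{q_0}=\{\gamma\in\Gamma:\gamma q_0=q_0\}$ is the isotropy group and $\Gamma(q_0)=\{\gamma q_0:\gamma\in\Gamma\}$ is the orbit (a compact submanifold of $\mathbb{R}^n$). $T^0=\{e\}$ is the trivial group and $T^l=S^1\times\cdots\times S^1$ ($l$ factors) for $l\geq 1$. $\nabla^2U(q_0)$ is the Hessian and $\sigma(\cdot)$ the spectrum. $\Gamma(q_0)_\varepsilon=\bigcup_{q\in\Gamma(q_0)}\{x\in\mathbb{R}^n:\|x-q\|<\varepsilon\}$. The minimal period $T_k$ of a (non-stationary) periodic solution $q_k$ is its smallest positive period; in particular the solutions $q_k$ are non-constant. *)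

theory Defs
  imports "HOL-Analysis.Analysis" "HOL-Algebra.Product_Groups"
begin

section \<open>Differentiability classes\<close>

text \<open>\<open>C_k_on k S f\<close>: the function \<open>f\<close> is of class \<open>C\<close> to the power \<open>k\<close> on the open set \<open>S\<close>.\<close>

primrec C_k_on ::
  "nat \<Rightarrow> 'a::real_normed_vector set \<Rightarrow> ('a \<Rightarrow> 'b::real_normed_vector) \<Rightarrow> bool" where
  "C_k_on 0 S f \<longleftrightarrow> continuous_on S f"
| "C_k_on (Suc k) S f \<longleftrightarrow> (\<forall>x\<in>S. f differentiable (at x)) \<and>
     (\<forall>v. C_k_on k S (\<lambda>x. frechet_derivative f (at x) v))"

text \<open>Smoothness on an arbitrary set means local extendability to smooth functions on open sets;
  on an open set, or on a relatively open subset of a linear subspace, this is the usual notion.\<close>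

definition smooth_map_on ::
  "'a::real_normed_vector set \<Rightarrow> ('a \<Rightarrow> 'b::real_normed_vector) \<Rightarrow> bool" where
  "smooth_map_on S f \<longleftrightarrow>
     (\<forall>x\<in>S. \<exists>V g. open V \<and> x \<in> V \<and> (\<forall>k. C_k_on k V g) \<and> (\<forall>y\<in>V \<inter> S. g y = f y))"

section \<open>Lie groups\<close>

text \<open>Charts take values in a linear subspace \<open>E\<close> of a Euclidean space rather than in the
  whole space: a type of class \<open>euclidean_space\<close> has positive dimension, whereas
  zero-dimensional Lie groups (e.g. finite groups) have to be covered. The dimension of the manifold
  is \<open>dim E\<close>. A chart is a pair of its domain and its coordinate map.\<close>

type_synonym ('g, 'e) chart = "'g set \<times> ('g \<Rightarrow> 'e)"

definition is_chart ::
  "'g topology \<Rightarrow> 'e::euclidean_space set \<Rightarrow> ('g, 'e) chart \<Rightarrow> bool" where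
  "is_chart T E = (\<lambda>(W, \<phi>). openin T W \<and> openin (top_of_set E) (\<phi> ` W) \<and>
     homeomorphic_map (subtopology T W) (top_of_set (\<phi> ` W)) \<phi>)"

definition smooth_atlas ::
  "'g topology \<Rightarrow> 'e::euclidean_space set \<Rightarrow> ('g, 'e) chart set \<Rightarrow> bool" where
  "smooth_atlas T E \<A> \<longleftrightarrow>
     (\<forall>c\<in>\<A>. is_chart T E c) \<and> (\<Union>(W, \<phi>)\<in>\<A>. W) = topspace T \<and>
     (\<forall>(W, \<phi>)\<in>\<A>. \<forall>(W', \<phi>')\<in>\<A>. smooth_map_on (\<phi> ` (W \<inter> W')) (\<phi>' \<circ> inv_into W \<phi>))"

text \<open>Continuity of the group operations is listed separately since it makes the domains of their
  coordinate expressions below relatively open.\<close>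

locale lie_group = group G
  for G :: "('g, 'b) monoid_scheme" (structure)
    and T :: "'g topology" and E :: "'e::euclidean_space set" and \<A> :: "('g, 'e) chart set" +
  assumes topspace_eq: "topspace T = carrier G"
    and Hausdorff: "Hausdorff_space T"
    and second_countable: "second_countable T"
    and subspace_model: "subspace E"
    and atlas: "smooth_atlas T E \<A>"
    and continuous_mult: "continuous_map (prod_topology T T) T (\<lambda>(x, y). x \<otimes> y)"
    and continuous_inv: "continuous_map T T (\<lambda>x. inv x)"
    and smooth_mult: "\<And>W1 \<phi>1 W2 \<phi>2 W3 \<phi>3.
      (W1, \<phi>1) \<in> \<A> \<Longrightarrow> (W2, \<phi>2) \<in> \<A> \<Longrightarrow> (W3, \<phi>3) \<in> \<A> \<Longrightarrow>
      smooth_map_on {(\<phi>1 x, \<phi>2 y) |x y. x \<in> W1 \<and> y \<in> W2 \<and> x \<otimes> y \<in> W3}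
        (\<lambda>(u, v). \<phi>3 (inv_into W1 \<phi>1 u \<otimes> inv_into W2 \<phi>2 v))"
    and smooth_inv: "\<And>W1 \<phi>1 W2 \<phi>2. (W1, \<phi>1) \<in> \<A> \<Longrightarrow> (W2, \<phi>2) \<in> \<A> \<Longrightarrow>
      smooth_map_on {\<phi>1 x |x. x \<in> W1 \<and> inv x \<in> W2} (\<lambda>u. \<phi>2 (inv (inv_into W1 \<phi>1 u)))"

locale compact_lie_group = lie_group +
  assumes compact: "compact_space T"

section \<open>Tori\<close>

definition circle_group :: "complex monoid" where
  "circle_group = \<lparr>carrier = sphere 0 1, monoid.mult = (*), one = 1\<rparr>"

definition torus_group :: "nat \<Rightarrow> (nat \<Rightarrow> complex) monoid" where
  "torus_group l = product_group {..<l} (\<lambda>_. circle_group)"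

definition torus_topology :: "nat \<Rightarrow> (nat \<Rightarrow> complex) topology" where
  "torus_topology l = product_topology (\<lambda>_. top_of_set (sphere 0 1)) {..<l}"

text \<open>Isomorphism of the subgroup \<open>H\<close> with a torus as topological groups; continuous isomorphisms
  between Lie groups are automatically smooth.\<close>

definition isomorphic_to_torus ::
  "('g, 'b) monoid_scheme \<Rightarrow> 'g topology \<Rightarrow> 'g set \<Rightarrow> nat \<Rightarrow> bool" where
  "isomorphic_to_torus G T H l \<longleftrightarrow>
     (\<exists>h \<in> iso (G\<lparr>carrier := H\<rparr>) (torus_group l).
        homeomorphic_map (subtopology T H) (torus_topology l) h)"

section \<open>Orthogonal representations\<close>

definition orthogonal_group :: "(real^'n^'n) monoid" where
  "orthogonal_group = \<lparr>carrier = {A. orthogonal_matrix A}, monoid.mult = (**), one = mat 1\<rparr>"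

definition orthogonal_representation ::
  "('g, 'b) monoid_scheme \<Rightarrow> 'g topology \<Rightarrow> ('g \<Rightarrow> real^'n^'n) \<Rightarrow> bool" where
  "orthogonal_representation G T \<rho> \<longleftrightarrow>
     \<rho> \<in> hom G orthogonal_group \<and> continuous_map T euclidean \<rho>"

definition isotropy_group ::
  "('g, 'b) monoid_scheme \<Rightarrow> ('g \<Rightarrow> real^'n^'n) \<Rightarrow> real^'n \<Rightarrow> 'g set" where
  "isotropy_group G \<rho> q = {g \<in> carrier G. \<rho> g *v q = q}"

definition group_orbit ::
  "('g, 'b) monoid_scheme \<Rightarrow> ('g \<Rightarrow> real^'n^'n) \<Rightarrow> real^'n \<Rightarrow> (real^'n) set" where
  "group_orbit G \<rho> q = {\<rho> g *v q |g. g \<in> carrier G}"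

definition invariant_set ::
  "('g, 'b) monoid_scheme \<Rightarrow> ('g \<Rightarrow> real^'n^'n) \<Rightarrow> (real^'n) set \<Rightarrow> bool" where
  "invariant_set G \<rho> \<Omega> \<longleftrightarrow> (\<forall>g\<in>carrier G. \<forall>q\<in>\<Omega>. \<rho> g *v q \<in> \<Omega>)"

definition invariant_on ::
  "('g, 'b) monoid_scheme \<Rightarrow> ('g \<Rightarrow> real^'n^'n) \<Rightarrow> (real^'n) set \<Rightarrow> (real^'n \<Rightarrow> real) \<Rightarrow> bool" where
  "invariant_on G \<rho> \<Omega> U \<longleftrightarrow> (\<forall>g\<in>carrier G. \<forall>q\<in>\<Omega>. U (\<rho> g *v q) = U q)"

section \<open>Submanifolds\<close>

text \<open>\<open>submanifold_of_dim M k\<close>: \<open>M\<close> is a smooth embedded submanifold of dimension \<open>k\<close>, i.e. near each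
  of its points some smooth change of coordinates \<open>\<Phi>\<close> flattens it to a \<open>k\<close>-dimensional subspace.
  For nonempty \<open>M\<close> there is at most one such \<open>k\<close>.\<close>

definition submanifold_of_dim :: "'a::euclidean_space set \<Rightarrow> nat \<Rightarrow> bool" where
  "submanifold_of_dim M k \<longleftrightarrow>
     (\<forall>p\<in>M. \<exists>V (\<Phi> :: 'a \<Rightarrow> 'a) F. open V \<and> p \<in> V \<and> open (\<Phi> ` V) \<and> inj_on \<Phi> V \<and>
        smooth_map_on V \<Phi> \<and> smooth_map_on (\<Phi> ` V) (inv_into V \<Phi>) \<and>
        subspace F \<and> dim F = k \<and> \<Phi> ` (V \<inter> M) = \<Phi> ` V \<inter> F)"

section \<open>Gradient, Hessian, spectrum\<close>

definition gradient :: "('a::real_inner \<Rightarrow> real) \<Rightarrow> 'a \<Rightarrow> 'a" where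
  "gradient U x = (THE D. GDERIV U x :> D)"

definition hessian :: "(real^'n \<Rightarrow> real) \<Rightarrow> real^'n \<Rightarrow> real^'n^'n" where
  "hessian U x = jacobian (gradient U) (at x)"

definition matrix_kernel :: "real^'n^'m \<Rightarrow> (real^'n) set" where
  "matrix_kernel A = {v. A *v v = 0}"

text \<open>Only real spectral values are collected; the matrices considered are symmetric.\<close>

definition spectrum :: "real^'n^'n \<Rightarrow> real set" where
  "spectrum A = {\<mu>. \<not> invertible (A - mat \<mu>)}"

section \<open>Periodic solutions of Newtonian systems\<close>

definition newton_solution ::
  "(real^'n) set \<Rightarrow> (real^'n \<Rightarrow> real) \<Rightarrow> (real \<Rightarrow> real^'n) \<Rightarrow> bool" where
  "newton_solution \<Omega> U q \<longleftrightarrow> (\<forall>t. q t \<in> \<Omega>) \<and>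
     (\<exists>q'. \<forall>t. (q has_vector_derivative q' t) (at t) \<and>
        (q' has_vector_derivative - gradient U (q t)) (at t))"

text \<open>A function with a minimal period is in particular not constant.\<close>

definition minimal_period :: "(real \<Rightarrow> 'a) \<Rightarrow> real \<Rightarrow> bool" where
  "minimal_period q P \<longleftrightarrow> P > 0 \<and> (\<forall>t. q (t + P) = q t) \<and>
     (\<forall>S. 0 < S \<and> S < P \<longrightarrow> \<not> (\<forall>t. q (t + S) = q t))"

definition neighbourhood_of :: "'a::metric_space set \<Rightarrow> real \<Rightarrow> 'a set" where
  "neighbourhood_of M \<epsilon> = (\<Union>q\<in>M. ball q \<epsilon>)"

end

theory Submission
  imports Defs
begin

text \<open>
  Write \<open>q = q0 + u\<close> and diagonalise the Hessian. Solutions starting at rest are even, and a solution at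
  rest at the times \<open>0\<close> and \<open>\<tau>\<close> extends by reflection to a \<open>2\<tau>\<close>-periodic one, so it suffices to find an
  initial position \<open>r v\<close> and a half-period \<open>\<tau>\<close> near \<open>\<pi>/\<beta>\<close> for which the final velocity \<open>F\<close> vanishes.
  Let \<open>V\<close> be the eigenspace of \<open>\<beta>\<^sup>2\<close>. For each unit vector \<open>e\<close> of \<open>V\<close> a contraction argument, uniform in the
  small scale \<open>r\<close>, yields \<open>(v, \<tau>)\<close> near \<open>(e, \<pi>/\<beta>)\<close> with prescribed energy such that \<open>F\<close> is orthogonal to
  \<open>e\<close> and to all eigenvectors outside \<open>V\<close> and the kernel; this is where nonresonance enters. The pair is
  Lipschitz in \<open>e\<close>. At fixed energy the variation of the action is the inner product of \<open>F\<close> with the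
  variation of the end point, so at a maximum of the action over the unit sphere of \<open>V\<close> the component of
  \<open>F\<close> in \<open>V\<close> is controlled by the component in the kernel. The kernel is the tangent space of the
  orbit, which consists of the vectors \<open>A q0\<close> with \<open>A\<close> an infinitesimal generator of the group, and
  conservation of the corresponding momenta makes the kernel component of \<open>F\<close> much smaller than \<open>F\<close>.
  Hence \<open>F = 0\<close>.
\<close>

section \<open>Symmetric linear maps\<close>

text \<open>The potential is only C^2, so the field is only C^1 and the action cannot be expanded
  twice by differentiating the flow. Implicit function arguments are therefore replaced by
  contractions, and derivatives by Lipschitz bounds. Their smallness has one source: near the
  equilibrium the nonlinear part of the field has an arbitrarily small Lipschitz constant. Two
  blocks of the equation \<open>F = 0\<close> are degenerate at first order. In the kernel
  directions a linear motion released at rest never moves, and in \<open>V\<close> orthogonally to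
  \<open>e\<close> it is again at rest after time \<open>pi / \<beta>\<close> whatever its
  amplitude. The initial position is kept free of both kinds of components, and the missing
  equations are recovered from conserved momenta and from the maximum of the action. The action is
  the integral of the squared speed. At equal energy the linear terms of its variation collapse to a
  boundary term, also when the half-period varies; this is why the energy and not the period is
  prescribed. The constants depend on each other in the order \<open>K\<close> (linear flow), \<rho>
  (size of the solutions), \<kappa> (distance to \<open>(e, \<tau>0)\<close>), \<eta> (nonlinear
  error), \<delta> (size of the data), and \<open>r\<close> comes last.\<close>

lemma selfadjoint_maximizer_eigenvector:
  fixes f :: "'a::euclidean_space \<Rightarrow> 'a"
  assumes f: "linear f" "\<And>x y. f x \<bullet> y = x \<bullet> f y"
    and S: "subspace S" "f ` S \<subseteq> S"
    and x: "x \<in> S" "norm x = 1"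
    and max: "\<And>y. y \<in> S \<Longrightarrow> norm y = 1 \<Longrightarrow> f y \<bullet> y \<le> f x \<bullet> x"
  shows "f x = (f x \<bullet> x) *\<^sub>R x"
proof -
  define l where "l = f x \<bullet> x"
  have le: "f y \<bullet> y \<le> l * (y \<bullet> y)" if "y \<in> S" for y
  proof (cases "y = 0")
    case True
    then show ?thesis by (simp add: linear_0[OF f(1)])
  next
    case False
    have "f (y /\<^sub>R norm y) \<bullet> (y /\<^sub>R norm y) \<le> l"
      unfolding l_def using False that S(1) by (intro max) (auto simp: subspace_scale)
    then have "(f y \<bullet> y) / (norm y)\<^sup>2 \<le> l"
      by (simp add: linear_scale[OF f(1)] power2_eq_square field_simps)
    then show ?thesis
      using False by (simp add: divide_le_eq power2_norm_eq_inner)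
  qed
  have orth: "f x \<bullet> y = l * (x \<bullet> y)" if y: "y \<in> S" for y
  proof (rule ccontr)
    assume ne: "f x \<bullet> y \<noteq> l * (x \<bullet> y)"
    define a where "a = f x \<bullet> y - l * (x \<bullet> y)"
    define c where "c = l * (y \<bullet> y) - f y \<bullet> y"
    have quad: "2 * t * a \<le> t\<^sup>2 * c" for t
    proof -
      have "x + t *\<^sub>R y \<in> S" using x y S(1) by (simp add: subspace_add subspace_scale)
      from le[OF this] have "f (x + t *\<^sub>R y) \<bullet> (x + t *\<^sub>R y) \<le> l * ((x + t *\<^sub>R y) \<bullet> (x + t *\<^sub>R y))" .
      moreover have "f y \<bullet> x = f x \<bullet> y" using f(2)[of x y] by (simp add: inner_commute)
      moreover have "x \<bullet> x = 1" using x(2) by (simp add: norm_eq_1)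
      ultimately show ?thesis
        by (simp add: linear_add[OF f(1)] linear_scale[OF f(1)] inner_simps a_def c_def l_def
            power2_eq_square algebra_simps inner_commute)
    qed
    have c0: "c \<ge> 0" using le[OF y] by (simp add: c_def)
    have a0: "a \<noteq> 0" using ne by (simp add: a_def)
    \<comment> \<open>The test value \<open>a / (c + 1)\<close> for \<open>t\<close> makes the left
      side twice the final right side, which forces \<open>a = 0\<close>. The added 1 keeps the
      denominator positive when \<open>c = 0\<close>.\<close>
    have "2 * (a / (c + 1)) * a \<le> (a / (c + 1))\<^sup>2 * c" by (rule quad)
    also have "\<dots> \<le> (a / (c + 1))\<^sup>2 * (c + 1)" by (intro mult_left_mono) auto
    also have "\<dots> = (a / (c+1)) * a" using c0 by (simp add: power2_eq_square)
    finally have "a\<^sup>2 / (c + 1) \<le> 0" by (simp add: power2_eq_square)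
    moreover have "a\<^sup>2 / (c + 1) > 0" using a0 c0 by simp
    ultimately show False by simp
  qed
  define z where "z = f x - l *\<^sub>R x"
  have "z \<in> S" using x S by (auto simp: z_def subspace_diff subspace_scale)
  then have "z \<bullet> z = 0" using orth[of z] by (subst (1) z_def) (simp add: inner_diff_left)
  then show ?thesis by (simp add: z_def l_def)
qed

text \<open>Spectral theorem by induction on the dimension: a maximiser of the Rayleigh quotient on
  the unit sphere of \<open>S\<close> is an eigenvector, and its orthogonal complement in
  \<open>S\<close> is again invariant. Invariant subspaces keep the induction inside one
  type.\<close>

lemma selfadjoint_eigenbasis_subspace:
  fixes f :: "'a::euclidean_space \<Rightarrow> 'a"
  assumes f: "linear f" "\<And>x y. f x \<bullet> y = x \<bullet> f y"
    and S: "subspace S" "f ` S \<subseteq> S"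
  shows "\<exists>B. B \<subseteq> S \<and> finite B \<and> pairwise orthogonal B \<and> (\<forall>b\<in>B. norm b = 1) \<and> span B = S \<and>
    (\<forall>b\<in>B. \<exists>\<mu>. f b = \<mu> *\<^sub>R b)"
  using S
proof (induction "dim S" arbitrary: S)
  case 0
  then have "S \<subseteq> {0}" by (metis dim_eq_0)
  then have "S = {0}" using subspace_0[OF 0(2)] by blast
  then show ?case by (intro exI[of _ "{}"]) auto
next
  case (Suc n)
  let ?K = "S \<inter> sphere 0 1"
  have "compact ?K"
    using closed_subspace[OF Suc.prems(1)] by (simp add: closed_Int_compact)
  moreover have "?K \<noteq> {}"
  proof -
    have "\<not> S \<subseteq> {0}" using Suc.hyps(2) dim_eq_0[of S] by (metis Zero_not_Suc)
    then obtain y where "y \<in> S" "y \<noteq> 0" by blast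
    then have "y /\<^sub>R norm y \<in> ?K" using Suc.prems(1) by (auto simp: subspace_scale)
    then show ?thesis by blast
  qed
  moreover have "continuous_on ?K (\<lambda>x. f x \<bullet> x)"
    using linear_continuous_on[OF linear_conv_bounded_linear[THEN iffD1, OF f(1)]]
    by (intro continuous_intros) auto
  ultimately obtain x where x: "x \<in> ?K" and max: "\<forall>y\<in>?K. f y \<bullet> y \<le> f x \<bullet> x"
    using continuous_attains_sup[of ?K "\<lambda>x. f x \<bullet> x"] by blast
  have xS: "x \<in> S" and nx: "norm x = 1" using x by auto
  have ev: "f x = (f x \<bullet> x) *\<^sub>R x"
    by (rule selfadjoint_maximizer_eigenvector[OF f Suc.prems xS nx]) (use max in simp)
  define S' where "S' = {y \<in> S. x \<bullet> y = 0}"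
  have sub: "subspace S'"
    using Suc.prems(1) by (auto simp: S'_def subspace_def inner_simps)
  have inv: "f ` S' \<subseteq> S'"
  proof -
    have "x \<bullet> f y = 0" if "x \<bullet> y = 0" for y
    proof -
      have "x \<bullet> f y = f x \<bullet> y" by (simp add: f(2))
      also have "\<dots> = (f x \<bullet> x) * (x \<bullet> y)" by (subst ev) simp
      finally show ?thesis using that by simp
    qed
    then show ?thesis using Suc.prems(2) by (auto simp: S'_def)
  qed
  have span: "span (insert x S') = S"
  proof
    show "span (insert x S') \<subseteq> S"
      using xS Suc.prems(1) by (intro span_minimal) (auto simp: S'_def)
    show "S \<subseteq> span (insert x S')"
    proof
      fix y assume y: "y \<in> S"
      have "y - (x \<bullet> y) *\<^sub>R x \<in> S'"
        using y xS Suc.prems(1) nx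
        by (auto simp: S'_def subspace_diff subspace_scale inner_simps norm_eq_1)
      then have "(y - (x \<bullet> y) *\<^sub>R x) + (x \<bullet> y) *\<^sub>R x \<in> span (insert x S')"
        by (intro span_add span_scale) (auto intro: span_base)
      then show "y \<in> span (insert x S')" by simp
    qed
  qed
  have "x \<notin> span S'"
  proof
    assume "x \<in> span S'"
    then have "x \<bullet> x = 0" using sub by (simp only: span_eq_iff[THEN iffD2, OF sub]) (simp add: S'_def)
    then show False using nx by simp
  qed
  then have "dim (insert x S') = Suc (dim S')" by (simp add: dim_insert)
  moreover have "dim (insert x S') = Suc n"
    using dim_span[of "insert x S'"] Suc.hyps(2) unfolding span by simp
  ultimately have "n = dim S'" by simp
  from Suc.hyps(1)[OF this sub inv] obtain B where B: "B \<subseteq> S'" "finite B" "pairwise orthogonal B"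
    "\<forall>b\<in>B. norm b = 1" "span B = S'" "\<forall>b\<in>B. \<exists>\<mu>. f b = \<mu> *\<^sub>R b" by blast
  have "S' \<subseteq> span (insert x B)"
    unfolding B(5)[symmetric] by (rule span_mono) blast
  then have "span (insert x B) = span (insert x S')"
    unfolding span_eq using B(1) by (auto intro: span_base)
  then have "span (insert x B) = S" using span by simp
  have orth: "pairwise orthogonal (insert x B)"
    unfolding pairwise_insert
  proof (intro conjI B(3) allI impI)
    fix y assume "y \<in> B \<and> y \<noteq> x"
    then have "x \<bullet> y = 0" using B(1) by (auto simp: S'_def)
    then show "orthogonal x y" "orthogonal y x" by (simp_all add: orthogonal_def inner_commute)
  qed
  have "insert x B \<subseteq> S" using B(1) xS by (auto simp: S'_def)
  moreover have "\<forall>b\<in>insert x B. norm b = 1" using B(4) nx by simp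
  moreover have "\<forall>b\<in>insert x B. \<exists>\<mu>. f b = \<mu> *\<^sub>R b"
    using B(6) ev by blast
  moreover have "finite (insert x B)" using B(2) by simp
  ultimately show ?case using orth \<open>span (insert x B) = S\<close> by blast
qed

theorem selfadjoint_eigenbasis:
  fixes f :: "'a::euclidean_space \<Rightarrow> 'a"
  assumes "linear f" "\<And>x y. f x \<bullet> y = x \<bullet> f y"
  obtains B \<mu> where "finite B" "pairwise orthogonal B" "\<And>b. b \<in> B \<Longrightarrow> norm b = 1"
    "span B = (UNIV :: 'a set)" "\<And>b. b \<in> B \<Longrightarrow> f b = \<mu> b *\<^sub>R b"
proof -
  obtain B where B: "finite B" "pairwise orthogonal B" "\<forall>b\<in>B. norm b = 1" "span B = (UNIV :: 'a set)"
    "\<forall>b\<in>B. \<exists>\<mu>. f b = \<mu> *\<^sub>R b"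
    using selfadjoint_eigenbasis_subspace[OF assms, of UNIV] by auto
  then obtain \<mu> where "\<forall>b\<in>B. f b = \<mu> b *\<^sub>R b" by metis
  with B show ?thesis by (intro that[of B \<mu>]) auto
qed

section \<open>Diagonal operators\<close>

locale orthonormal_basis =
  fixes B :: "'a::euclidean_space set"
  assumes finite_B: "finite B"
    and orthogonal_B: "pairwise orthogonal B"
    and norm_B: "b \<in> B \<Longrightarrow> norm b = 1"
    and span_B: "span B = UNIV"
begin

lemma inner_B: "b \<in> B \<Longrightarrow> c \<in> B \<Longrightarrow> b \<bullet> c = (if b = c then 1 else 0)"
  using orthogonal_B norm_B by (auto simp: pairwise_def orthogonal_def norm_eq_1)

lemma expand: "x = (\<Sum>b\<in>B. (x \<bullet> b) *\<^sub>R b)"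
proof -
  let ?y = "x - (\<Sum>b\<in>B. (x \<bullet> b) *\<^sub>R b)"
  have "?y \<bullet> c = 0" if "c \<in> B" for c
    using that finite_B by (simp add: inner_simps inner_sum_left inner_B if_distrib cong: if_cong)
  then have "\<forall>c\<in>span B. ?y \<bullet> c = 0"
    using orthogonal_to_span[of _ B ?y] unfolding orthogonal_def by blast
  then have "?y \<bullet> ?y = 0" using span_B by blast
  then show ?thesis by (simp only: inner_eq_zero_iff right_minus_eq)
qed

lemma eqI: "(\<And>b. b \<in> B \<Longrightarrow> x \<bullet> b = y \<bullet> b) \<Longrightarrow> x = y"
  by (metis (no_types, lifting) expand sum.cong)

lemma inner_expand: "x \<bullet> y = (\<Sum>b\<in>B. (x \<bullet> b) * (y \<bullet> b))"
proof -
  have "x \<bullet> y = (\<Sum>b\<in>B. (x \<bullet> b) *\<^sub>R b) \<bullet> y" by (rule arg_cong[OF expand])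
  also have "\<dots> = (\<Sum>b\<in>B. (x \<bullet> b) * (b \<bullet> y))" by (simp add: inner_sum_left)
  finally show ?thesis by (simp only: inner_commute[of y])
qed

lemma norm_expand: "(norm x)\<^sup>2 = (\<Sum>b\<in>B. (x \<bullet> b)\<^sup>2)"
  unfolding power2_norm_eq_inner by (subst inner_expand) (simp add: power2_eq_square)

lemma abs_inner_le: "b \<in> B \<Longrightarrow> \<bar>x \<bullet> b\<bar> \<le> norm x"
  using Cauchy_Schwarz_ineq2[of x b] norm_B[of b] by simp

text \<open>Functional calculus in the eigenbasis. The Hessian, the linear flow, its velocity and
  the spectral projections (with symbols 0 and 1) all have this form, so they commute and are
  bounded by the supremum of their symbols.\<close>

definition diag :: "('a \<Rightarrow> real) \<Rightarrow> 'a \<Rightarrow> 'a" where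
  "diag a x = (\<Sum>b\<in>B. (a b * (x \<bullet> b)) *\<^sub>R b)"

lemma diag_inner [simp]:
  assumes "b \<in> B"
  shows "diag a x \<bullet> b = a b * (x \<bullet> b)"
proof -
  have "diag a x \<bullet> b = (\<Sum>c\<in>B. if c = b then a b * (x \<bullet> b) else 0)"
    unfolding diag_def inner_sum_left using assms by (intro sum.cong) (auto simp: inner_B)
  then show ?thesis using assms finite_B by simp
qed

lemma diag_bound:
  assumes "\<And>b. b \<in> B \<Longrightarrow> \<bar>a b\<bar> \<le> M"
  shows "norm (diag a x) \<le> M * norm x"
\<comment> \<open>A basis vector is needed to see that \<open>M\<close> is nonnegative, so the empty
  case is treated apart.\<close>
proof (cases "B = {}")
  case True
  then have "x = 0" by (intro eqI) simp
  then show ?thesis by (simp add: diag_def)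
next
  case False
  then obtain b where "b \<in> B" by blast
  then have M: "M \<ge> 0" using assms[of b] abs_ge_zero[of "a b"] by linarith
  have "(norm (diag a x))\<^sup>2 = (\<Sum>b\<in>B. (a b * (x \<bullet> b))\<^sup>2)"
    unfolding norm_expand[of "diag a x"] by (intro sum.cong) simp_all
  also have "\<dots> \<le> (\<Sum>b\<in>B. M\<^sup>2 * (x \<bullet> b)\<^sup>2)"
  proof (intro sum_mono)
    fix b assume "b \<in> B"
    then have "(a b)\<^sup>2 \<le> M\<^sup>2" using assms M by (intro abs_le_square_iff[THEN iffD1]) auto
    then show "(a b * (x \<bullet> b))\<^sup>2 \<le> M\<^sup>2 * (x \<bullet> b)\<^sup>2"
      by (simp add: power_mult_distrib mult_right_mono)
  qed
  also have "\<dots> = (M * norm x)\<^sup>2"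
    unfolding power_mult_distrib norm_expand[of x] by (rule sum_distrib_left[symmetric])
  finally show ?thesis by (rule power2_le_imp_le) (use M in simp)
qed

lemma diag_add: "diag a (x + y) = diag a x + diag a y"
  and diag_diff: "diag a (x - y) = diag a x - diag a y"
  and diag_scaleR: "diag a (r *\<^sub>R x) = r *\<^sub>R diag a x"
  and diag_zero [simp]: "diag a 0 = 0"
  by (rule eqI; simp add: inner_simps algebra_simps)+

lemma diag_selfadjoint: "diag a x \<bullet> y = x \<bullet> diag a y"
  unfolding inner_expand[of "diag a x" y] inner_expand[of x "diag a y"] by (simp add: mult_ac)

lemma bounded_linear_diag: "bounded_linear (diag a)"
  by (intro linear_conv_bounded_linear[THEN iffD1] linearI) (simp_all add: diag_add diag_scaleR)

lemma has_vector_derivative_diag: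
  assumes "\<And>b. b \<in> B \<Longrightarrow> ((\<lambda>t. a t b) has_real_derivative a' b) (at t within S)"
    and "(F has_vector_derivative F') (at t within S)"
  shows "((\<lambda>t. diag (a t) (F t)) has_vector_derivative diag a' (F t) + diag (a t) F') (at t within S)"
proof -
  have F: "((\<lambda>t. F t \<bullet> b) has_real_derivative F' \<bullet> b) (at t within S)" for b
    using bounded_linear.has_vector_derivative[OF bounded_linear_inner_left assms(2)]
    by (simp add: has_real_derivative_iff_has_vector_derivative)
  have p: "((\<lambda>t. a t b * (F t \<bullet> b)) has_real_derivative a' b * (F t \<bullet> b) + a t b * (F' \<bullet> b)) (at t within S)"
    if "b \<in> B" for b
    using DERIV_mult[OF assms(1)[OF that] F[of b]] by (simp add: algebra_simps)
  have "((\<lambda>t. \<Sum>b\<in>B. (a t b * (F t \<bullet> b)) *\<^sub>R b) has_vector_derivative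
     (\<Sum>b\<in>B. (a' b * (F t \<bullet> b) + a t b * (F' \<bullet> b)) *\<^sub>R b)) (at t within S)"
    using has_vector_derivative_scaleR[OF p has_vector_derivative_const]
    by (intro has_vector_derivative_sum) simp
  moreover have "(\<Sum>b\<in>B. (a' b * (F t \<bullet> b) + a t b * (F' \<bullet> b)) *\<^sub>R b) = diag a' (F t) + diag (a t) F'"
    by (simp add: diag_def scaleR_add_left sum.distrib)
  ultimately show ?thesis by (simp add: diag_def)
qed

lemma continuous_on_diag:
  assumes "\<And>b. b \<in> B \<Longrightarrow> continuous_on S (\<lambda>t. a t b)" "continuous_on S F"
  shows "continuous_on S (\<lambda>t. diag (a t) (F t))"
  unfolding diag_def by (intro continuous_intros assms)

end

section \<open>The scalar linear oscillator\<close>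

text \<open>\<open>lin_cos \<mu>\<close> and \<open>lin_sin \<mu>\<close> solve \<open>x'' = - \<mu> x\<close> with initial data \<open>(1, 0)\<close> and \<open>(0, 1)\<close>.\<close>

definition lin_cos :: "real \<Rightarrow> real \<Rightarrow> real" where
  "lin_cos \<mu> t = (if \<mu> > 0 then cos (sqrt \<mu> * t) else cosh (sqrt (- \<mu>) * t))"

definition lin_sin :: "real \<Rightarrow> real \<Rightarrow> real" where
  "lin_sin \<mu> t = (if \<mu> > 0 then sin (sqrt \<mu> * t) / sqrt \<mu>
     else if \<mu> = 0 then t else sinh (sqrt (- \<mu>) * t) / sqrt (- \<mu>))"

lemma lin_cos_0 [simp]: "lin_cos \<mu> 0 = 1" and lin_sin_0 [simp]: "lin_sin \<mu> 0 = 0"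
  by (simp_all add: lin_cos_def lin_sin_def)

lemma lin_cos_zero [simp]: "lin_cos 0 t = 1"
  by (simp add: lin_cos_def)

lemma lin_cos_deriv: "(lin_cos \<mu> has_real_derivative - \<mu> * lin_sin \<mu> t) (at t within S)"
proof -
  have [simp]: "sqrt (-\<mu>) * (sqrt (-\<mu>) * x) = -\<mu> * x" if "\<mu> < 0" for x
    using that by (simp flip: mult.assoc)
  show ?thesis
    unfolding lin_cos_def[abs_def] lin_sin_def
    by (cases \<mu> "0::real" rule: linorder_cases)
      (auto intro!: derivative_eq_intros simp: field_simps)
qed

lemma lin_sin_deriv: "(lin_sin \<mu> has_real_derivative lin_cos \<mu> t) (at t within S)"
proof -
  have [simp]: "sqrt (-\<mu>) * (sqrt (-\<mu>) * x) = -\<mu> * x" if "\<mu> < 0" for x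
    using that by (simp flip: mult.assoc)
  show ?thesis
    unfolding lin_cos_def lin_sin_def[abs_def]
    by (cases \<mu> "0::real" rule: linorder_cases) (auto intro!: derivative_eq_intros simp: field_simps)
qed

text \<open>Energy conservation for the scalar oscillator. The left side is also the Wronskian of
  the two fundamental solutions, and its being 1 is what lets variation of constants reproduce the
  forcing term.\<close>

lemma lin_pythagoras: "(lin_cos \<mu> t)\<^sup>2 + \<mu> * (lin_sin \<mu> t)\<^sup>2 = 1"
proof (cases \<mu> "0::real" rule: linorder_cases)
  case less
  then have "\<mu> * (lin_sin \<mu> t)\<^sup>2 = - (sinh (sqrt (- \<mu>) * t))\<^sup>2"
    by (simp add: lin_sin_def power_divide)
  then show ?thesis using less by (simp add: lin_cos_def cosh_square_eq)
next
  case greater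
  then have "\<mu> * (lin_sin \<mu> t)\<^sup>2 = (sin (sqrt \<mu> * t))\<^sup>2"
    by (simp add: lin_sin_def power_divide)
  then show ?thesis using greater by (simp add: lin_cos_def)
qed simp

lemma continuous_on_lin_cos: "continuous_on S (lin_cos \<mu>)"
  and continuous_on_lin_sin: "continuous_on S (lin_sin \<mu>)"
  by (rule DERIV_continuous_on, rule lin_cos_deriv) (rule DERIV_continuous_on, rule lin_sin_deriv)

section \<open>The flow near an equilibrium\<close>

text \<open>\<open>small_Lipschitz\<close> is strict differentiability of \<open>g\<close> at 0 with
  derivative \<open>diag \<mu>\<close>: it compares two arbitrary nearby points, not only a point
  with 0. For the gradient of a C^2 potential it comes from the continuity of the Hessian.\<close>

locale nonlinear_field = orthonormal_basis B
  for B :: "'a::euclidean_space set" +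
  fixes \<mu> :: "'a \<Rightarrow> real" and g :: "'a \<Rightarrow> 'a"
  assumes g_zero: "g 0 = 0"
    and small_Lipschitz: "\<epsilon> > 0 \<Longrightarrow> \<exists>\<delta>>0. \<forall>u\<in>cball 0 \<delta>. \<forall>v\<in>cball 0 \<delta>.
      norm ((g u - diag \<mu> u) - (g v - diag \<mu> v)) \<le> \<epsilon> * norm (u - v)"
begin

definition Cf :: "real \<Rightarrow> 'a \<Rightarrow> 'a" where "Cf t = diag (\<lambda>b. lin_cos (\<mu> b) t)"
definition Sf :: "real \<Rightarrow> 'a \<Rightarrow> 'a" where "Sf t = diag (\<lambda>b. lin_sin (\<mu> b) t)"
definition Cf' :: "real \<Rightarrow> 'a \<Rightarrow> 'a" where "Cf' t = diag (\<lambda>b. - \<mu> b * lin_sin (\<mu> b) t)"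

lemma flow_coefficients_bounded:
  obtains K where "K \<ge> 1"
    "\<And>b t. b \<in> B \<Longrightarrow> t \<in> {0..L} \<Longrightarrow> \<bar>lin_cos (\<mu> b) t\<bar> \<le> K"
    "\<And>b t. b \<in> B \<Longrightarrow> t \<in> {0..L} \<Longrightarrow> \<bar>lin_sin (\<mu> b) t\<bar> \<le> K"
    "\<And>b t. b \<in> B \<Longrightarrow> t \<in> {0..L} \<Longrightarrow> \<bar>\<mu> b * lin_sin (\<mu> b) t\<bar> \<le> K"
    "\<And>b. b \<in> B \<Longrightarrow> \<bar>\<mu> b\<bar> \<le> K"
proof -
  have "\<exists>k\<ge>0. \<forall>t\<in>{0..L}. \<bar>lin_cos (\<mu> b) t\<bar> + \<bar>lin_sin (\<mu> b) t\<bar> + \<bar>\<mu> b * lin_sin (\<mu> b) t\<bar> + \<bar>\<mu> b\<bar> \<le> k" for b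
  proof -
    have "continuous_on {0..L} (\<lambda>t. \<bar>lin_cos (\<mu> b) t\<bar> + \<bar>lin_sin (\<mu> b) t\<bar> + \<bar>\<mu> b * lin_sin (\<mu> b) t\<bar> + \<bar>\<mu> b\<bar>)"
      by (intro continuous_intros continuous_on_lin_cos continuous_on_lin_sin)
    then have "compact ((\<lambda>t. \<bar>lin_cos (\<mu> b) t\<bar> + \<bar>lin_sin (\<mu> b) t\<bar> + \<bar>\<mu> b * lin_sin (\<mu> b) t\<bar> + \<bar>\<mu> b\<bar>) ` {0..L})"
      by (intro compact_continuous_image) auto
    then obtain k where "\<forall>x\<in>(\<lambda>t. \<bar>lin_cos (\<mu> b) t\<bar> + \<bar>lin_sin (\<mu> b) t\<bar> + \<bar>\<mu> b * lin_sin (\<mu> b) t\<bar> + \<bar>\<mu> b\<bar>) ` {0..L}. norm x \<le> k"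
      using compact_imp_bounded bounded_iff by metis
    then have "\<forall>t\<in>{0..L}. \<bar>lin_cos (\<mu> b) t\<bar> + \<bar>lin_sin (\<mu> b) t\<bar> + \<bar>\<mu> b * lin_sin (\<mu> b) t\<bar> + \<bar>\<mu> b\<bar> \<le> max 0 k"
      by (simp add: le_max_iff_disj)
    then show ?thesis by (intro exI[of _ "max 0 k"]) simp
  qed
  then obtain k where k: "\<And>b. k b \<ge> 0" "\<And>b t. t \<in> {0..L} \<Longrightarrow>
      \<bar>lin_cos (\<mu> b) t\<bar> + \<bar>lin_sin (\<mu> b) t\<bar> + \<bar>\<mu> b * lin_sin (\<mu> b) t\<bar> + \<bar>\<mu> b\<bar> \<le> k b" by metis
  define K where "K = 1 + (\<Sum>b\<in>B. k b) + (\<Sum>b\<in>B. \<bar>\<mu> b\<bar>)"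
  have m: "\<bar>\<mu> b\<bar> \<le> (\<Sum>b\<in>B. \<bar>\<mu> b\<bar>)" if "b \<in> B" for b
    using that finite_B by (intro member_le_sum) auto
  have n: "k b \<le> (\<Sum>b\<in>B. k b)" if "b \<in> B" for b
    using that finite_B k(1) by (intro member_le_sum) auto
  have s: "(\<Sum>b\<in>B. k b) \<ge> 0" "(\<Sum>b\<in>B. \<bar>\<mu> b\<bar>) \<ge> 0" using k(1) by (auto intro: sum_nonneg)
  show ?thesis
  proof (rule that[of K])
    show "K \<ge> 1" using s unfolding K_def by linarith
    show "\<bar>\<mu> b\<bar> \<le> K" if "b \<in> B" for b using m[OF that] s unfolding K_def by linarith
    fix b t assume b: "b \<in> B" and t: "t \<in> {0..L}"
    have "k b \<le> K" using n[OF b] s unfolding K_def by linarith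
    with k(2)[OF t, of b]
    show "\<bar>lin_cos (\<mu> b) t\<bar> \<le> K" "\<bar>lin_sin (\<mu> b) t\<bar> \<le> K" "\<bar>\<mu> b * lin_sin (\<mu> b) t\<bar> \<le> K"
      by linarith+
  qed
qed

text \<open>Variation of constants: \<open>duhamel f\<close> solves \<open>x'' + diag \<mu> x = f\<close> with zero initial data.\<close>

definition duhamel :: "(real \<Rightarrow> 'a) \<Rightarrow> real \<Rightarrow> 'a" where
  "duhamel f t = Sf t (integral {0..t} (\<lambda>s. Cf s (f s))) - Cf t (integral {0..t} (\<lambda>s. Sf s (f s)))"

definition duhamel' :: "(real \<Rightarrow> 'a) \<Rightarrow> real \<Rightarrow> 'a" where
  "duhamel' f t = Cf t (integral {0..t} (\<lambda>s. Cf s (f s))) - Cf' t (integral {0..t} (\<lambda>s. Sf s (f s)))"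

lemma continuous_on_Cf: "continuous_on S f \<Longrightarrow> continuous_on S (\<lambda>t. Cf t (f t))"
  and continuous_on_Sf: "continuous_on S f \<Longrightarrow> continuous_on S (\<lambda>t. Sf t (f t))"
  unfolding Cf_def Sf_def
  by (auto intro!: continuous_on_diag continuous_on_lin_cos continuous_on_lin_sin)

lemma Cf_deriv:
  assumes "(F has_vector_derivative F') (at t within S)"
  shows "((\<lambda>t. Cf t (F t)) has_vector_derivative Cf' t (F t) + Cf t F') (at t within S)"
  unfolding Cf_def Cf'_def by (intro has_vector_derivative_diag assms lin_cos_deriv)

lemma Sf_deriv:
  assumes "(F has_vector_derivative F') (at t within S)"
  shows "((\<lambda>t. Sf t (F t)) has_vector_derivative Cf t (F t) + Sf t F') (at t within S)"
  unfolding Cf_def Sf_def by (intro has_vector_derivative_diag assms lin_sin_deriv)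

lemma Cf'_deriv:
  assumes "(F has_vector_derivative F') (at t within S)"
  shows "((\<lambda>t. Cf' t (F t)) has_vector_derivative - diag \<mu> (Cf t (F t)) + Cf' t F') (at t within S)"
proof -
  have "((\<lambda>t. Cf' t (F t)) has_vector_derivative diag (\<lambda>b. - \<mu> b * lin_cos (\<mu> b) t) (F t) + Cf' t F') (at t within S)"
    unfolding Cf'_def by (intro has_vector_derivative_diag assms DERIV_cmult lin_sin_deriv)
  moreover have "diag (\<lambda>b. - \<mu> b * lin_cos (\<mu> b) t) (F t) = - diag \<mu> (Cf t (F t))"
    by (rule eqI) (simp add: Cf_def)
  ultimately show ?thesis by simp
qed

lemma Cf_0 [simp]: "Cf 0 x = x" and Sf_0 [simp]: "Sf 0 x = 0" and Cf'_0 [simp]: "Cf' 0 x = 0"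
  by (rule eqI; simp add: Cf_def Sf_def Cf'_def)+

lemma Cf_diff: "Cf t (x - y) = Cf t x - Cf t y" and Sf_diff: "Sf t (x - y) = Sf t x - Sf t y"
  and Cf'_diff: "Cf' t (x - y) = Cf' t x - Cf' t y"
  by (simp_all add: Cf_def Sf_def Cf'_def diag_diff)

lemma Cf_zero [simp]: "Cf t 0 = 0" and Sf_zero [simp]: "Sf t 0 = 0" and Cf'_zero [simp]: "Cf' t 0 = 0"
  by (simp_all add: Cf_def Sf_def Cf'_def)

lemma duhamel_0 [simp]: "duhamel f 0 = 0" "duhamel' f 0 = 0"
  by (simp_all add: duhamel_def duhamel'_def)

lemma duhamel_deriv:
  assumes f: "continuous_on {0..L} f" and t: "t \<in> {0..L}"
  shows "(duhamel f has_vector_derivative duhamel' f t) (at t within {0..L})"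
    and "(duhamel' f has_vector_derivative f t - diag \<mu> (duhamel f t)) (at t within {0..L})"
proof -
  let ?I = "\<lambda>t. integral {0..t} (\<lambda>s. Cf s (f s))" and ?J = "\<lambda>t. integral {0..t} (\<lambda>s. Sf s (f s))"
  have I: "(?I has_vector_derivative Cf t (f t)) (at t within {0..L})"
    by (intro integral_has_vector_derivative continuous_on_Cf f t)
  have J: "(?J has_vector_derivative Sf t (f t)) (at t within {0..L})"
    by (intro integral_has_vector_derivative continuous_on_Sf f t)
  \<comment> \<open>Diagonal operators commute, so the two terms produced by differentiating the
    integrals cancel in the first derivative.\<close>
  have "Sf t (Cf t (f t)) = Cf t (Sf t (f t))"
    by (rule eqI) (simp add: Cf_def Sf_def)
  then show "(duhamel f has_vector_derivative duhamel' f t) (at t within {0..L})"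
    using has_vector_derivative_diff[OF Sf_deriv[OF I] Cf_deriv[OF J]]
    by (simp add: duhamel_def[abs_def] duhamel'_def)
  have "lin_cos m t * (lin_cos m t * x) - (- m * lin_sin m t) * (lin_sin m t * x) =
      ((lin_cos m t)\<^sup>2 + m * (lin_sin m t)\<^sup>2) * x" for m x :: real
    by (simp add: power2_eq_square algebra_simps)
  then have "Cf t (Cf t (f t)) - Cf' t (Sf t (f t)) = f t"
    by (intro eqI) (simp only: Cf_def Sf_def Cf'_def inner_diff_left diag_inner lin_pythagoras mult_1)
  moreover have "Cf' t (?I t) = - diag \<mu> (Sf t (?I t))"
    by (rule eqI) (simp add: Cf'_def Sf_def)
  ultimately show "(duhamel' f has_vector_derivative f t - diag \<mu> (duhamel f t)) (at t within {0..L})"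
    using has_vector_derivative_diff[OF Cf_deriv[OF I] Cf'_deriv[OF J]]
    by (simp add: duhamel_def duhamel'_def[abs_def] diag_diff algebra_simps)
qed

lemma duhamel_diff:
  assumes "continuous_on {0..L} f" "continuous_on {0..L} h" "t \<in> {0..L}"
  shows "duhamel f t - duhamel h t = duhamel (\<lambda>s. f s - h s) t"
    and "duhamel' f t - duhamel' h t = duhamel' (\<lambda>s. f s - h s) t"
proof -
  have sub: "{0..t} \<subseteq> {0..L}" using assms(3) by auto
  have "(\<lambda>s. Cf s (f s)) integrable_on {0..t}" "(\<lambda>s. Cf s (h s)) integrable_on {0..t}"
    "(\<lambda>s. Sf s (f s)) integrable_on {0..t}" "(\<lambda>s. Sf s (h s)) integrable_on {0..t}"
    by (intro integrable_continuous_real continuous_on_Cf continuous_on_Sf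
        continuous_on_subset[OF assms(1) sub] continuous_on_subset[OF assms(2) sub])+
  then show "duhamel f t - duhamel h t = duhamel (\<lambda>s. f s - h s) t"
    "duhamel' f t - duhamel' h t = duhamel' (\<lambda>s. f s - h s) t"
    by (simp_all add: duhamel_def duhamel'_def integral_diff Cf_diff Sf_diff Cf'_diff)
qed

lemma duhamel_bound:
  assumes f: "continuous_on {0..L} f" and t: "t \<in> {0..L}" and M: "\<And>s. s \<in> {0..L} \<Longrightarrow> norm (f s) \<le> M"
    and K: "K \<ge> 1" "\<And>b t. b \<in> B \<Longrightarrow> t \<in> {0..L} \<Longrightarrow> \<bar>lin_cos (\<mu> b) t\<bar> \<le> K"
    "\<And>b t. b \<in> B \<Longrightarrow> t \<in> {0..L} \<Longrightarrow> \<bar>lin_sin (\<mu> b) t\<bar> \<le> K"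
    "\<And>b t. b \<in> B \<Longrightarrow> t \<in> {0..L} \<Longrightarrow> \<bar>\<mu> b * lin_sin (\<mu> b) t\<bar> \<le> K"
  shows "norm (duhamel f t) \<le> 2 * K\<^sup>2 * L * M" "norm (duhamel' f t) \<le> 2 * K\<^sup>2 * L * M"
proof -
  have bds: "norm (Cf s x) \<le> K * norm x" "norm (Sf s x) \<le> K * norm x" "norm (Cf' s x) \<le> K * norm x"
    if "s \<in> {0..L}" for s x
    unfolding Cf_def Sf_def Cf'_def using K(2-4) that by (auto intro!: diag_bound)
  have sub: "{0..t} \<subseteq> {0..L}" using t by auto
  have M0: "M \<ge> 0" using M[OF t] norm_ge_zero[of "f t"] by linarith
  have KM: "K * norm (f s) \<le> K * M" if "s \<in> {0..L}" for s
    using M[OF that] K(1) by (intro mult_left_mono) auto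
  have CM: "norm (Cf s (f s)) \<le> K * M" and SM: "norm (Sf s (f s)) \<le> K * M" if "s \<in> {0..t}" for s
    using order.trans[OF bds(1) KM] order.trans[OF bds(2) KM] that sub by blast+
  have "norm (integral {0..t} (\<lambda>s. Cf s (f s))) \<le> (K * M) * (t - 0)"
    using t by (intro integral_bound continuous_on_Cf continuous_on_subset[OF f sub] CM) auto
  also have "\<dots> \<le> K * M * L" using K M0 t by (intro mult_left_mono) auto
  finally have I: "norm (integral {0..t} (\<lambda>s. Cf s (f s))) \<le> K * M * L" .
  have "norm (integral {0..t} (\<lambda>s. Sf s (f s))) \<le> (K * M) * (t - 0)"
    using t by (intro integral_bound continuous_on_Sf continuous_on_subset[OF f sub] SM) auto
  also have "\<dots> \<le> K * M * L" using K M0 t by (intro mult_left_mono) auto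
  finally have J: "norm (integral {0..t} (\<lambda>s. Sf s (f s))) \<le> K * M * L" .
  have *: "K * norm x \<le> K * (K * M * L)" if "norm x \<le> K * M * L" for x :: 'a
    using that K(1) by (intro mult_left_mono) auto
  show "norm (duhamel f t) \<le> 2 * K\<^sup>2 * L * M"
    unfolding duhamel_def
    using norm_triangle_ineq4[of "Sf t (integral {0..t} (\<lambda>s. Cf s (f s)))" "Cf t (integral {0..t} (\<lambda>s. Sf s (f s)))"]
      bds(2)[OF t, of "integral {0..t} (\<lambda>s. Cf s (f s))"] *[OF I]
      bds(1)[OF t, of "integral {0..t} (\<lambda>s. Sf s (f s))"] *[OF J]
    by (simp add: power2_eq_square mult_ac)
  show "norm (duhamel' f t) \<le> 2 * K\<^sup>2 * L * M"
    unfolding duhamel'_def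
    using norm_triangle_ineq4[of "Cf t (integral {0..t} (\<lambda>s. Cf s (f s)))" "Cf' t (integral {0..t} (\<lambda>s. Sf s (f s)))"]
      bds(1)[OF t, of "integral {0..t} (\<lambda>s. Cf s (f s))"] *[OF I]
      bds(3)[OF t, of "integral {0..t} (\<lambda>s. Sf s (f s))"] *[OF J]
    by (simp add: power2_eq_square mult_ac)
qed

text \<open>A Picard iteration for the mild formulation \<open>u t = Cf t \<xi> - duhamel (R \<circ> u) t\<close>, which is a
  contraction on the whole interval \<open>{0..L}\<close> because \<open>R\<close> has a small Lipschitz constant.\<close>

lemma flow_fixed_point:
  fixes R :: "'a \<Rightarrow> 'a"
  assumes L: "L > 0" and K: "K \<ge> 1" "\<And>b t. b \<in> B \<Longrightarrow> t \<in> {0..L} \<Longrightarrow> \<bar>lin_cos (\<mu> b) t\<bar> \<le> K"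
    "\<And>b t. b \<in> B \<Longrightarrow> t \<in> {0..L} \<Longrightarrow> \<bar>lin_sin (\<mu> b) t\<bar> \<le> K"
    "\<And>b t. b \<in> B \<Longrightarrow> t \<in> {0..L} \<Longrightarrow> \<bar>\<mu> b * lin_sin (\<mu> b) t\<bar> \<le> K"
    and R: "R 0 = 0" "\<And>u v. u \<in> cball 0 \<rho> \<Longrightarrow> v \<in> cball 0 \<rho> \<Longrightarrow> norm (R u - R v) \<le> \<epsilon> * norm (u - v)"
    and \<epsilon>: "\<epsilon> \<ge> 0" "2 * K\<^sup>2 * L * \<epsilon> \<le> 1 / 2" and \<xi>: "2 * K * norm \<xi> \<le> \<rho>"
  obtains u where "continuous_on {0..L} u" "\<And>t. t \<in> {0..L} \<Longrightarrow> norm (u t) \<le> \<rho>"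
    "\<And>t. t \<in> {0..L} \<Longrightarrow> u t = Cf t \<xi> - duhamel (R \<circ> u) t"
proof -
  have \<rho>0: "\<rho> \<ge> 0" using \<xi> K(1) by (smt (verit) mult_nonneg_nonneg norm_ge_zero)
  \<comment> \<open>Bounded continuous functions are defined on the whole line. Clamping the time to
    \<open>{0..L}\<close> extends paths on the interval to such functions, and Banach's theorem can
    be applied in their complete space.\<close>
  define cl where "cl = (\<lambda>t. max 0 (min L t))"
  have cl: "cl t \<in> {0..L}" for t using L by (auto simp: cl_def)
  have cl_id: "cl t = t" if "t \<in> {0..L}" for t using that by (auto simp: cl_def)
  have cl_cont: "continuous_on S cl" for S unfolding cl_def by (intro continuous_intros)
  have R_cont: "continuous_on (cball 0 \<rho>) R"
    using \<epsilon>(1) R(2) by (intro lipschitz_on_continuous_on[of \<epsilon>] lipschitz_onI) (auto simp: dist_norm)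
  define X :: "(real \<Rightarrow>\<^sub>C 'a) set" where "X = cball 0 \<rho>"
  define F where "F = (\<lambda>u :: real \<Rightarrow>\<^sub>C 'a. Bcontfun (\<lambda>t. Cf (cl t) \<xi> - duhamel (R \<circ> apply_bcontfun u) (cl t)))"
  have bnd: "norm (apply_bcontfun u t) \<le> \<rho>" if "u \<in> X" for u t
    using that norm_bounded[of u t] by (auto simp: X_def)
  have Rc: "continuous_on {0..L} (R \<circ> apply_bcontfun u)" if "u \<in> X" for u
    using bnd[OF that] by (intro continuous_on_compose continuous_on_apply_bcontfun
        continuous_on_subset[OF R_cont]) auto
  have F_app: "apply_bcontfun (F u) t = Cf (cl t) \<xi> - duhamel (R \<circ> apply_bcontfun u) (cl t)" if "u \<in> X" for u t
  proof -
    have c: "continuous_on {0..L} (\<lambda>t. Cf t \<xi> - duhamel (R \<circ> apply_bcontfun u) t)"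
    proof (intro continuous_intros continuous_on_Cf)
      show "continuous_on {0..L} (duhamel (R \<circ> apply_bcontfun u))"
        using duhamel_deriv(1)[OF Rc[OF that]]
        by (intro continuous_on_vector_derivative) auto
    qed
    have c': "continuous_on UNIV (\<lambda>t. Cf (cl t) \<xi> - duhamel (R \<circ> apply_bcontfun u) (cl t))"
      using continuous_on_compose2[OF c cl_cont] cl by blast
    have "bounded ((\<lambda>t. Cf t \<xi> - duhamel (R \<circ> apply_bcontfun u) t) ` {0..L})"
      by (intro compact_imp_bounded compact_continuous_image c) auto
    then have "bounded (range (\<lambda>t. Cf (cl t) \<xi> - duhamel (R \<circ> apply_bcontfun u) (cl t)))"
      by (rule bounded_subset) (use cl in blast)
    then show ?thesis unfolding F_def using c' by (subst Bcontfun_inverse) (auto simp: bcontfun_def)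
  qed
  have contr: "dist (F u) (F v) \<le> 1/2 * dist u v" if u: "u \<in> X" and v: "v \<in> X" for u v
  proof (rule dist_bound)
    fix t
    have "norm (duhamel (\<lambda>s. (R \<circ> apply_bcontfun u) s - (R \<circ> apply_bcontfun v) s) (cl t)) \<le> 2 * K\<^sup>2 * L * (\<epsilon> * dist u v)"
    proof (intro duhamel_bound(1)[OF _ cl _ K] continuous_on_diff Rc u v)
      fix s
      have "norm (R (apply_bcontfun u s) - R (apply_bcontfun v s)) \<le> \<epsilon> * norm (apply_bcontfun u s - apply_bcontfun v s)"
        using bnd[OF u] bnd[OF v] by (intro R) auto
      also have "\<dots> \<le> \<epsilon> * dist u v"
        using dist_bounded[of u s v] \<epsilon>(1) by (intro mult_left_mono) (auto simp: dist_norm)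
      finally show "norm ((R \<circ> apply_bcontfun u) s - (R \<circ> apply_bcontfun v) s) \<le> \<epsilon> * dist u v" by simp
    qed
    also have "\<dots> = (2 * K\<^sup>2 * L * \<epsilon>) * dist u v" by simp
    also have "\<dots> \<le> 1/2 * dist u v" by (intro mult_right_mono \<epsilon>) auto
    finally show "dist (apply_bcontfun (F u) t) (apply_bcontfun (F v) t) \<le> 1/2 * dist u v"
      using duhamel_diff(1)[OF Rc[OF u] Rc[OF v] cl[of t]]
      by (simp add: F_app[OF u] F_app[OF v] dist_norm norm_minus_commute)
  qed
  have maps: "F ` X \<subseteq> X"
  proof safe
    fix u assume u: "u \<in> X"
    have "norm (apply_bcontfun (F u) t) \<le> \<rho>" for t
    proof -
      have "norm (duhamel (R \<circ> apply_bcontfun u) (cl t)) \<le> 2 * K\<^sup>2 * L * (\<epsilon> * \<rho>)"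
      proof (intro duhamel_bound(1)[OF _ cl _ K] Rc u)
        fix s
        have "norm (R (apply_bcontfun u s) - R 0) \<le> \<epsilon> * norm (apply_bcontfun u s - 0)"
          using bnd[OF u] \<rho>0 by (intro R) auto
        also have "\<dots> \<le> \<epsilon> * \<rho>" using bnd[OF u] \<epsilon>(1) by (intro mult_left_mono) auto
        finally show "norm ((R \<circ> apply_bcontfun u) s) \<le> \<epsilon> * \<rho>" by (simp add: R(1))
      qed
      also have "\<dots> = (2 * K\<^sup>2 * L * \<epsilon>) * \<rho>" by simp
      also have "\<dots> \<le> 1/2 * \<rho>" by (intro mult_right_mono \<epsilon> \<rho>0)
      finally have "norm (duhamel (R \<circ> apply_bcontfun u) (cl t)) \<le> 1/2 * \<rho>" .
      moreover have "norm (Cf (cl t) \<xi>) \<le> K * norm \<xi>"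
        unfolding Cf_def using K(2) cl by (intro diag_bound) auto
      ultimately show ?thesis
        using norm_triangle_ineq4[of "Cf (cl t) \<xi>" "duhamel (R \<circ> apply_bcontfun u) (cl t)"] \<xi>
        unfolding F_app[OF u] by linarith
    qed
    then have "norm (F u) \<le> \<rho>" by (intro norm_bound)
    then show "F u \<in> X" by (simp add: X_def)
  qed
  have "\<exists>!u\<in>X. F u = u"
    using contr maps \<rho>0
    by (intro Banach_fix[where c="1/2"]) (auto simp: X_def complete_eq_closed)
  then obtain u where u: "u \<in> X" "F u = u" by blast
  have eq: "apply_bcontfun u t = Cf t \<xi> - duhamel (R \<circ> apply_bcontfun u) t" if "t \<in> {0..L}" for t
    using F_app[OF u(1), of t] unfolding u(2) cl_id[OF that] .
  show ?thesis
    by (rule that[of "apply_bcontfun u"]) (use bnd[OF u(1)] in simp, use bnd[OF u(1)] in simp, rule eq)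
qed

text \<open>The deviation from the linear flow is compared for two initial positions, not just
  bounded: a Lipschitz constant \<eta> in the initial position is what the later contraction needs.
  The bound on the acceleration will supply the same control in time.\<close>

lemma flow_exists:
  assumes L: "L > 0" and \<eta>: "\<eta> > 0" and \<rho>: "\<rho> > 0"
  obtains \<delta> u p where "\<delta> > 0"
    "\<And>\<xi>. \<xi> \<in> cball 0 \<delta> \<Longrightarrow> u \<xi> 0 = \<xi>" "\<And>\<xi>. \<xi> \<in> cball 0 \<delta> \<Longrightarrow> p \<xi> 0 = 0"
    "\<And>\<xi> t. \<xi> \<in> cball 0 \<delta> \<Longrightarrow> t \<in> {0..L} \<Longrightarrow> norm (u \<xi> t) \<le> \<rho>"
    "\<And>\<xi> t. \<xi> \<in> cball 0 \<delta> \<Longrightarrow> t \<in> {0..L} \<Longrightarrow> (u \<xi> has_vector_derivative p \<xi> t) (at t within {0..L})"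
    "\<And>\<xi> t. \<xi> \<in> cball 0 \<delta> \<Longrightarrow> t \<in> {0..L} \<Longrightarrow> (p \<xi> has_vector_derivative - g (u \<xi> t)) (at t within {0..L})"
    "\<And>\<xi> \<xi>' t. \<xi> \<in> cball 0 \<delta> \<Longrightarrow> \<xi>' \<in> cball 0 \<delta> \<Longrightarrow> t \<in> {0..L} \<Longrightarrow>
      norm ((u \<xi> t - Cf t \<xi>) - (u \<xi>' t - Cf t \<xi>')) \<le> \<eta> * norm (\<xi> - \<xi>')"
    "\<And>\<xi> \<xi>' t. \<xi> \<in> cball 0 \<delta> \<Longrightarrow> \<xi>' \<in> cball 0 \<delta> \<Longrightarrow> t \<in> {0..L} \<Longrightarrow>
      norm ((p \<xi> t - Cf' t \<xi>) - (p \<xi>' t - Cf' t \<xi>')) \<le> \<eta> * norm (\<xi> - \<xi>')"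
    "\<And>\<xi> t. \<xi> \<in> cball 0 \<delta> \<Longrightarrow> t \<in> {0..L} \<Longrightarrow> norm (g (u \<xi> t) - diag \<mu> (Cf t \<xi>)) \<le> \<eta> * norm \<xi>"
    "\<And>t. t \<in> {0..L} \<Longrightarrow> u 0 t = 0" "\<And>t. t \<in> {0..L} \<Longrightarrow> p 0 t = 0"
proof -
  obtain K where K: "K \<ge> 1"
    "\<And>b t. b \<in> B \<Longrightarrow> t \<in> {0..L} \<Longrightarrow> \<bar>lin_cos (\<mu> b) t\<bar> \<le> K"
    "\<And>b t. b \<in> B \<Longrightarrow> t \<in> {0..L} \<Longrightarrow> \<bar>lin_sin (\<mu> b) t\<bar> \<le> K"
    "\<And>b t. b \<in> B \<Longrightarrow> t \<in> {0..L} \<Longrightarrow> \<bar>\<mu> b * lin_sin (\<mu> b) t\<bar> \<le> K"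
    "\<And>b. b \<in> B \<Longrightarrow> \<bar>\<mu> b\<bar> \<le> K"
    using flow_coefficients_bounded[where L=L] by metis
  \<comment> \<open>\<open>K^4 * (L + 1)\<close> dominates every product of powers of
    \<open>K\<close> with \<open>L\<close> in the three bounds below, 8 absorbs their numerical
    factors, and the minimum with 1 makes the Picard map a contraction however large \<eta>
    is.\<close>
  define \<epsilon> where "\<epsilon> = min 1 \<eta> / (8 * K^4 * (L + 1))"
  have \<epsilon>0: "\<epsilon> > 0" using \<eta> L K(1) by (simp add: \<epsilon>_def)
  have \<epsilon>_eq: "8 * K^4 * (L + 1) * \<epsilon> = min 1 \<eta>" using L K(1) by (simp add: \<epsilon>_def)
  have pw: "1 \<le> K" "K^2 \<le> K^4" "K^3 \<le> K^4" "K \<le> K^4"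
    using K(1) power_increasing[of 2 4 K] power_increasing[of 3 4 K] power_increasing[of 1 4 K] by auto
  have comp: "a * c * \<epsilon> \<le> K^4 * (L + 1) * \<epsilon>" if "a \<le> K^4" "0 \<le> a" "c \<le> L + 1" "0 \<le> c" for a c
    using that \<epsilon>0 by (intro mult_right_mono mult_mono) auto
  have e1: "2 * K\<^sup>2 * L * \<epsilon> \<le> 1/2" using comp[of "K^2" L] pw L \<epsilon>_eq by simp
  have e2: "2 * K\<^sup>2 * L * \<epsilon> * (2 * K) \<le> \<eta>"
    using comp[of "K^3" L] pw L \<epsilon>_eq K(1) \<eta> by (simp add: power2_eq_square power3_eq_cube mult_ac)
  have e3: "\<epsilon> * (2 * K) + K * (2 * K\<^sup>2 * L * \<epsilon> * (2 * K)) \<le> \<eta>"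
  proof -
    have "\<epsilon> * (2 * K) + K * (2 * K\<^sup>2 * L * \<epsilon> * (2 * K)) = 2 * (K * 1 * \<epsilon>) + 4 * (K^4 * L * \<epsilon>)"
      by (simp add: power2_eq_square power4_eq_xxxx)
    moreover have "K * 1 * \<epsilon> \<le> K^4 * (L + 1) * \<epsilon>" "K^4 * L * \<epsilon> \<le> K^4 * (L + 1) * \<epsilon>"
      using pw L K(1) by (intro comp; simp)+
    moreover have "8 * (K^4 * (L + 1) * \<epsilon>) \<le> \<eta>" using \<epsilon>_eq by simp
    moreover have "K^4 * (L + 1) * \<epsilon> \<ge> 0" using L K(1) \<epsilon>0 by simp
    ultimately show ?thesis by linarith
  qed
  define R where "R = (\<lambda>u. g u - diag \<mu> u)"
  have R0: "R 0 = 0" by (simp add: R_def g_zero)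
  obtain \<delta>1 where \<delta>1: "\<delta>1 > 0" "\<And>u v. u \<in> cball 0 \<delta>1 \<Longrightarrow> v \<in> cball 0 \<delta>1 \<Longrightarrow> norm (R u - R v) \<le> \<epsilon> * norm (u - v)"
    using small_Lipschitz[OF \<epsilon>0] unfolding R_def by blast
  define r where "r = min \<delta>1 \<rho>"
  have r: "r > 0" "r \<le> \<rho>" using \<delta>1 \<rho> by (auto simp: r_def)
  have RL: "norm (R u - R v) \<le> \<epsilon> * norm (u - v)" if "u \<in> cball 0 r" "v \<in> cball 0 r" for u v
    using that by (intro \<delta>1) (auto simp: r_def)
  define \<delta> where "\<delta> = r / (2 * K)"
  have \<delta>0: "\<delta> > 0" using r K(1) by (simp add: \<delta>_def)
  have "\<exists>u. continuous_on {0..L} u \<and> (\<forall>t\<in>{0..L}. norm (u t) \<le> r) \<and>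
      (\<forall>t\<in>{0..L}. u t = Cf t \<xi> - duhamel (R \<circ> u) t)" if "\<xi> \<in> cball 0 \<delta>" for \<xi>
  proof -
    have "2 * K * norm \<xi> \<le> r" using that K(1) by (simp add: \<delta>_def field_simps)
    from flow_fixed_point[OF L K(1-4) R0 RL less_imp_le[OF \<epsilon>0] e1 this] show ?thesis by metis
  qed
  then obtain u where uc: "\<And>\<xi>. \<xi> \<in> cball 0 \<delta> \<Longrightarrow> continuous_on {0..L} (u \<xi>)"
    and ub: "\<And>\<xi> t. \<xi> \<in> cball 0 \<delta> \<Longrightarrow> t \<in> {0..L} \<Longrightarrow> norm (u \<xi> t) \<le> r"
    and ueq: "\<And>\<xi> t. \<xi> \<in> cball 0 \<delta> \<Longrightarrow> t \<in> {0..L} \<Longrightarrow> u \<xi> t = Cf t \<xi> - duhamel (R \<circ> u \<xi>) t"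
    by metis
  define p where "p = (\<lambda>\<xi> t. Cf' t \<xi> - duhamel' (R \<circ> u \<xi>) t)"
  have R_cont: "continuous_on (cball 0 r) R"
    using \<epsilon>0 RL by (intro lipschitz_on_continuous_on[of \<epsilon>] lipschitz_onI) (auto simp: dist_norm)
  have Rc: "continuous_on {0..L} (R \<circ> u \<xi>)" if "\<xi> \<in> cball 0 \<delta>" for \<xi>
    using ub[OF that] by (intro continuous_on_compose uc that continuous_on_subset[OF R_cont]) auto
  have C_bd: "norm (Cf t x) \<le> K * norm x" if "t \<in> {0..L}" for t x
    unfolding Cf_def using K(2) that by (intro diag_bound) auto
  have lip: "norm (u \<xi> t - u \<xi>' t) \<le> 2 * K * norm (\<xi> - \<xi>')"
    if "\<xi> \<in> cball 0 \<delta>" "\<xi>' \<in> cball 0 \<delta>" "t \<in> {0..L}" for \<xi> \<xi>' t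
  proof -
    have "compact ((\<lambda>t. norm (u \<xi> t - u \<xi>' t)) ` {0..L})"
      by (intro compact_continuous_image continuous_intros uc that) auto
    then obtain s where s: "s \<in> {0..L}" "\<And>t. t \<in> {0..L} \<Longrightarrow> norm (u \<xi> t - u \<xi>' t) \<le> norm (u \<xi> s - u \<xi>' s)"
      using compact_attains_sup[of "(\<lambda>t. norm (u \<xi> t - u \<xi>' t)) ` {0..L}"] \<open>t \<in> {0..L}\<close> by auto
    \<comment> \<open>\<open>M\<close> is the maximum over the interval. The mild equation bounds it
      by \<open>K * norm (\<xi> - \<xi>')\<close> plus half of itself; absorbing that half plays the
      role of a Gronwall estimate.\<close>
    define M where "M = norm (u \<xi> s - u \<xi>' s)"
    have "norm (duhamel (\<lambda>s. (R \<circ> u \<xi>) s - (R \<circ> u \<xi>') s) s) \<le> 2 * K\<^sup>2 * L * (\<epsilon> * M)"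
    proof (intro duhamel_bound(1)[OF _ s(1) _ K(1-4)] continuous_on_diff Rc that)
      fix t assume t: "t \<in> {0..L}"
      have "norm (R (u \<xi> t) - R (u \<xi>' t)) \<le> \<epsilon> * norm (u \<xi> t - u \<xi>' t)"
        using ub that t by (intro RL) auto
      also have "\<dots> \<le> \<epsilon> * M" unfolding M_def using \<epsilon>0 s(2)[OF t] by (intro mult_left_mono) auto
      finally show "norm ((R \<circ> u \<xi>) t - (R \<circ> u \<xi>') t) \<le> \<epsilon> * M" by simp
    qed
    also have "\<dots> = (2 * K\<^sup>2 * L * \<epsilon>) * M" by simp
    also have "\<dots> \<le> 1/2 * M" by (intro mult_right_mono e1) (simp add: M_def)
    finally have D: "norm (duhamel (\<lambda>s. (R \<circ> u \<xi>) s - (R \<circ> u \<xi>') s) s) \<le> 1/2 * M" .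
    have "u \<xi> s - u \<xi>' s = Cf s (\<xi> - \<xi>') - duhamel (\<lambda>s. (R \<circ> u \<xi>) s - (R \<circ> u \<xi>') s) s"
      unfolding ueq[OF that(1) s(1)] ueq[OF that(2) s(1)] Cf_diff
        duhamel_diff(1)[OF Rc[OF that(1)] Rc[OF that(2)] s(1), symmetric] by simp
    then have "M \<le> K * norm (\<xi> - \<xi>') + 1/2 * M"
      unfolding M_def using D C_bd[OF s(1), of "\<xi> - \<xi>'"]
        norm_triangle_ineq4[of "Cf s (\<xi> - \<xi>')" "duhamel (\<lambda>s. (R \<circ> u \<xi>) s - (R \<circ> u \<xi>') s) s"]
      by (simp add: M_def)
    then show ?thesis using s(2)[OF that(3)] by (simp add: M_def)
  qed
  have Rbd: "norm (R (u \<xi> t) - R (u \<xi>' t)) \<le> \<epsilon> * (2 * K * norm (\<xi> - \<xi>'))"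
    if "\<xi> \<in> cball 0 \<delta>" "\<xi>' \<in> cball 0 \<delta>" "t \<in> {0..L}" for \<xi> \<xi>' t
    using RL[of "u \<xi> t" "u \<xi>' t"] mult_left_mono[OF lip[OF that], of \<epsilon>] ub that \<epsilon>0 by (simp add: order.trans)
  have err: "norm ((u \<xi> t - Cf t \<xi>) - (u \<xi>' t - Cf t \<xi>')) \<le> 2 * K\<^sup>2 * L * \<epsilon> * (2 * K) * norm (\<xi> - \<xi>')"
    "norm ((p \<xi> t - Cf' t \<xi>) - (p \<xi>' t - Cf' t \<xi>')) \<le> 2 * K\<^sup>2 * L * \<epsilon> * (2 * K) * norm (\<xi> - \<xi>')"
    if "\<xi> \<in> cball 0 \<delta>" "\<xi>' \<in> cball 0 \<delta>" "t \<in> {0..L}" for \<xi> \<xi>' t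
  proof -
    let ?f = "\<lambda>s. (R \<circ> u \<xi>) s - (R \<circ> u \<xi>') s"
    have c: "continuous_on {0..L} ?f" by (intro continuous_on_diff Rc that)
    have b: "norm (?f s) \<le> \<epsilon> * (2 * K * norm (\<xi> - \<xi>'))" if "s \<in> {0..L}" for s
      using Rbd[OF \<open>\<xi> \<in> cball 0 \<delta>\<close> \<open>\<xi>' \<in> cball 0 \<delta>\<close> that] by simp
    have "(u \<xi> t - Cf t \<xi>) - (u \<xi>' t - Cf t \<xi>') = - duhamel ?f t"
      unfolding ueq[OF that(1,3)] ueq[OF that(2,3)]
        duhamel_diff(1)[OF Rc[OF that(1)] Rc[OF that(2)] that(3), symmetric] by simp
    then show "norm ((u \<xi> t - Cf t \<xi>) - (u \<xi>' t - Cf t \<xi>')) \<le> 2 * K\<^sup>2 * L * \<epsilon> * (2 * K) * norm (\<xi> - \<xi>')"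
      using duhamel_bound(1)[OF c \<open>t \<in> {0..L}\<close> b K(1-4)] by (simp only: norm_minus_cancel mult.assoc)
    have "(p \<xi> t - Cf' t \<xi>) - (p \<xi>' t - Cf' t \<xi>') = - duhamel' ?f t"
      unfolding p_def duhamel_diff(2)[OF Rc[OF that(1)] Rc[OF that(2)] that(3), symmetric] by simp
    then show "norm ((p \<xi> t - Cf' t \<xi>) - (p \<xi>' t - Cf' t \<xi>')) \<le> 2 * K\<^sup>2 * L * \<epsilon> * (2 * K) * norm (\<xi> - \<xi>')"
      using duhamel_bound(2)[OF c \<open>t \<in> {0..L}\<close> b K(1-4)] by (simp only: norm_minus_cancel mult.assoc)
  qed
  have z: "(0::'a) \<in> cball 0 \<delta>" using \<delta>0 by simp
  have u0: "u 0 t = 0" if "t \<in> {0..L}" for t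
  proof -
    have "compact ((\<lambda>t. norm (u 0 t)) ` {0..L})"
      by (intro compact_continuous_image continuous_intros uc z) auto
    then obtain s where s: "s \<in> {0..L}" "\<And>t. t \<in> {0..L} \<Longrightarrow> norm (u 0 t) \<le> norm (u 0 s)"
      using compact_attains_sup[of "(\<lambda>t. norm (u 0 t)) ` {0..L}"] \<open>t \<in> {0..L}\<close> by auto
    have "norm (duhamel (R \<circ> u 0) s) \<le> 2 * K\<^sup>2 * L * (\<epsilon> * norm (u 0 s))"
    proof (intro duhamel_bound(1)[OF _ s(1) _ K(1-4)] Rc z)
      fix t assume t: "t \<in> {0..L}"
      have "norm (R (u 0 t) - R 0) \<le> \<epsilon> * norm (u 0 t - 0)"
        using ub[OF z t] r by (intro RL) auto
      also have "\<dots> \<le> \<epsilon> * norm (u 0 s)" using \<epsilon>0 s(2)[OF t] by (intro mult_left_mono) auto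
      finally show "norm ((R \<circ> u 0) t) \<le> \<epsilon> * norm (u 0 s)" by (simp add: R0)
    qed
    also have "\<dots> = (2 * K\<^sup>2 * L * \<epsilon>) * norm (u 0 s)" by simp
    also have "\<dots> \<le> 1/2 * norm (u 0 s)" by (intro mult_right_mono e1) simp
    finally have "norm (u 0 s) \<le> 1/2 * norm (u 0 s)"
      using ueq[OF z s(1)] by (metis Cf_zero diff_0 norm_minus_cancel)
    then show ?thesis using s(2)[OF that] by simp
  qed
  have p0: "p 0 t = 0" if "t \<in> {0..L}" for t
  proof -
    have "integral {0..t} (\<lambda>s. Cf s ((R \<circ> u 0) s)) = integral {0..t} (\<lambda>s. 0)"
      using that u0 by (intro integral_cong) (simp add: R0)
    moreover have "integral {0..t} (\<lambda>s. Sf s ((R \<circ> u 0) s)) = integral {0..t} (\<lambda>s. 0)"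
      using that u0 by (intro integral_cong) (simp add: R0)
    ultimately show ?thesis by (simp add: p_def duhamel'_def)
  qed
  have ud: "(u \<xi> has_vector_derivative p \<xi> t) (at t within {0..L})" if "\<xi> \<in> cball 0 \<delta>" "t \<in> {0..L}" for \<xi> t
  proof -
    have "((\<lambda>t. Cf t \<xi> - duhamel (R \<circ> u \<xi>) t) has_vector_derivative p \<xi> t) (at t within {0..L})"
      using has_vector_derivative_diff[OF Cf_deriv[OF has_vector_derivative_const] duhamel_deriv(1)[OF Rc[OF that(1)] that(2)]]
      by (simp add: p_def)
    then show ?thesis
      by (rule has_vector_derivative_transform[rotated 2]) (use that ueq in auto)
  qed
  have pd: "(p \<xi> has_vector_derivative - g (u \<xi> t)) (at t within {0..L})" if "\<xi> \<in> cball 0 \<delta>" "t \<in> {0..L}" for \<xi> t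
  proof -
    have d: "diag \<mu> (u \<xi> t) = diag \<mu> (Cf t \<xi>) - diag \<mu> (duhamel (R \<circ> u \<xi>) t)"
      by (subst ueq[OF that]) (simp add: diag_diff)
    have "(p \<xi> has_vector_derivative - diag \<mu> (Cf t \<xi>) - ((R \<circ> u \<xi>) t - diag \<mu> (duhamel (R \<circ> u \<xi>) t))) (at t within {0..L})"
      using has_vector_derivative_diff[OF Cf'_deriv[OF has_vector_derivative_const] duhamel_deriv(2)[OF Rc[OF that(1)] that(2)]]
      unfolding p_def by simp
    then show ?thesis by (simp add: R_def d)
  qed
  have acc: "norm (g (u \<xi> t) - diag \<mu> (Cf t \<xi>)) \<le> \<eta> * norm \<xi>" if "\<xi> \<in> cball 0 \<delta>" "t \<in> {0..L}" for \<xi> t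
  proof -
    have "g (u \<xi> t) - diag \<mu> (Cf t \<xi>) = R (u \<xi> t) + diag \<mu> (u \<xi> t - Cf t \<xi>)"
      by (simp add: R_def diag_diff)
    then have "norm (g (u \<xi> t) - diag \<mu> (Cf t \<xi>)) \<le> norm (R (u \<xi> t)) + norm (diag \<mu> (u \<xi> t - Cf t \<xi>))"
      using norm_triangle_ineq by metis
    also have "norm (R (u \<xi> t)) \<le> \<epsilon> * (2 * K * norm \<xi>)"
      using Rbd[OF that(1) z that(2)] by (simp add: u0[OF that(2)] R0)
    also have "norm (diag \<mu> (u \<xi> t - Cf t \<xi>)) \<le> K * norm (u \<xi> t - Cf t \<xi>)"
      by (intro diag_bound K(5))
    also have "\<dots> \<le> K * (2 * K\<^sup>2 * L * \<epsilon> * (2 * K) * norm \<xi>)"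
      using err(1)[OF that(1) z that(2)] K(1) by (intro mult_left_mono) (auto simp: u0[OF that(2)])
    also have "\<epsilon> * (2 * K * norm \<xi>) + K * (2 * K\<^sup>2 * L * \<epsilon> * (2 * K) * norm \<xi>)
        = (\<epsilon> * (2 * K) + K * (2 * K\<^sup>2 * L * \<epsilon> * (2 * K))) * norm \<xi>" by (simp add: algebra_simps)
    also have "\<dots> \<le> \<eta> * norm \<xi>" by (intro mult_right_mono e3) auto
    finally show ?thesis by simp
  qed
  show ?thesis
  proof (rule that[of \<delta> u p])
    show "u \<xi> 0 = \<xi>" if "\<xi> \<in> cball 0 \<delta>" for \<xi> using ueq[OF that, of 0] L by simp
    show "p \<xi> 0 = 0" for \<xi> by (simp add: p_def)
    show "norm (u \<xi> t) \<le> \<rho>" if "\<xi> \<in> cball 0 \<delta>" "t \<in> {0..L}" for \<xi> t using ub[OF that] r by simp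
    show "norm ((u \<xi> t - Cf t \<xi>) - (u \<xi>' t - Cf t \<xi>')) \<le> \<eta> * norm (\<xi> - \<xi>')"
      "norm ((p \<xi> t - Cf' t \<xi>) - (p \<xi>' t - Cf' t \<xi>')) \<le> \<eta> * norm (\<xi> - \<xi>')"
      if "\<xi> \<in> cball 0 \<delta>" "\<xi>' \<in> cball 0 \<delta>" "t \<in> {0..L}" for \<xi> \<xi>' t
      using err[OF that] mult_right_mono[OF e2 norm_ge_zero[of "\<xi> - \<xi>'"]] by linarith+
  qed (use \<delta>0 ud pd acc u0 p0 in auto)
qed

end

section \<open>Solving for the position and the half-period\<close>

lemma vector_differentiable_bound_real:
  fixes f :: "real \<Rightarrow> 'a::real_normed_vector"
  assumes "\<And>s. s \<in> {a..b} \<Longrightarrow> (f has_vector_derivative f' s) (at s within {a..b})"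
    and "\<And>s. s \<in> {a..b} \<Longrightarrow> norm (f' s) \<le> M" and "t \<in> {a..b}" "t' \<in> {a..b}"
  shows "norm (f t - f t') \<le> M * norm (t - t')"
proof (rule differentiable_bound[of "{a..b}" f "\<lambda>s h. h *\<^sub>R f' s"])
  show "onorm (\<lambda>h. h *\<^sub>R f' s) \<le> M" if "s \<in> {a..b}" for s
  proof (rule onorm_le)
    fix x :: real
    show "norm (x *\<^sub>R f' s) \<le> M * norm x"
      using mult_left_mono[OF assms(2)[OF that] abs_ge_zero[of x]] by (simp add: mult.commute)
  qed
qed (use assms in \<open>auto simp: has_vector_derivative_def\<close>)

lemma onorm_inner_le:
  fixes x :: "'a::euclidean_space"
  assumes "norm x \<le> c"
  shows "onorm (\<lambda>h. x \<bullet> h) \<le> c"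
proof (rule onorm_le)
  fix h :: 'a
  show "norm (x \<bullet> h) \<le> c * norm h"
    using Cauchy_Schwarz_ineq2[of x h] mult_right_mono[OF assms norm_ge_zero[of h]] by simp
qed

text \<open>The critical point is translated to 0. \<open>nonresonant\<close> says that a mode with
  nonzero eigenvalue other than \<open>\<beta>\<^sup>2\<close>, released at rest away from 0, is not
  at rest at time \<open>pi / \<beta>\<close>. In \<open>symmetry\<close> the affine field
  \<open>A u + b\<close> is an infinitesimal rigid motion tangent to the level sets of
  \<open>U\<close>; it moves the equilibrium in the kernel direction \<open>b\<close>.\<close>

locale center = nonlinear_field B \<mu> g
  for B :: "'a::euclidean_space set" and \<mu> g +
  fixes U :: "'a \<Rightarrow> real" and \<beta> :: real and \<rho>0 :: real
  assumes \<beta>_pos: "\<beta> > 0" and \<rho>0_pos: "\<rho>0 > 0"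
    and U_deriv: "u \<in> ball 0 \<rho>0 \<Longrightarrow> (U has_derivative (\<lambda>h. g u \<bullet> h)) (at u)"
    and resonant: "\<exists>b\<in>B. \<mu> b = \<beta>\<^sup>2"
    and nonresonant: "b \<in> B \<Longrightarrow> \<mu> b \<noteq> 0 \<Longrightarrow> \<mu> b \<noteq> \<beta>\<^sup>2 \<Longrightarrow> lin_sin (\<mu> b) (pi / \<beta>) \<noteq> 0"
    and symmetry: "b \<in> B \<Longrightarrow> \<mu> b = 0 \<Longrightarrow>
      \<exists>A. linear A \<and> (\<forall>x. A x \<bullet> x = 0) \<and> (\<forall>u\<in>ball 0 \<rho>0. g u \<bullet> (A u + b) = 0)"
begin

text \<open>Half of the linear period. The flow is built up to twice this time, so every half-period
  at distance at most \<kappa> from it is covered once \<kappa> is at most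
  \<open>\<tau>0\<close>.\<close>

definition "\<tau>0 = pi / \<beta>"
definition "L = 2 * pi / \<beta>"
definition "BW = {b \<in> B. \<mu> b \<noteq> 0 \<and> \<mu> b \<noteq> \<beta>\<^sup>2}"
definition "VV = {e. \<forall>b\<in>B. \<mu> b \<noteq> \<beta>\<^sup>2 \<longrightarrow> e \<bullet> b = 0}"

lemma L_pos: "L > 0" and \<tau>0_pos: "\<tau>0 > 0" and \<tau>0_L: "2 * \<tau>0 = L"
  using \<beta>_pos by (simp_all add: L_def \<tau>0_def)

lemma VV_orth: "e \<in> VV \<Longrightarrow> b \<in> BW \<Longrightarrow> e \<bullet> b = 0"
  by (simp add: VV_def BW_def)

lemma diag_VV:
  assumes "e \<in> VV" "\<And>b. b \<in> B \<Longrightarrow> \<mu> b = \<beta>\<^sup>2 \<Longrightarrow> a b = c"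
  shows "diag a e = c *\<^sub>R e"
  using assms by (intro eqI) (auto simp: VV_def)

definition flow_data :: "real \<Rightarrow> real \<Rightarrow> real \<Rightarrow> ('a \<Rightarrow> real \<Rightarrow> 'a) \<Rightarrow> ('a \<Rightarrow> real \<Rightarrow> 'a) \<Rightarrow> bool" where
  "flow_data \<eta> \<rho> \<delta> u p \<longleftrightarrow> \<eta> > 0 \<and> \<delta> > 0 \<and> (\<forall>\<xi>\<in>cball 0 \<delta>. u \<xi> 0 = \<xi> \<and> p \<xi> 0 = 0 \<and>
    (\<forall>t\<in>{0..L}. norm (u \<xi> t) \<le> \<rho> \<and> (u \<xi> has_vector_derivative p \<xi> t) (at t within {0..L}) \<and>
      (p \<xi> has_vector_derivative - g (u \<xi> t)) (at t within {0..L}) \<and>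
      norm (g (u \<xi> t) - diag \<mu> (Cf t \<xi>)) \<le> \<eta> * norm \<xi> \<and>
      (\<forall>\<xi>'\<in>cball 0 \<delta>. norm ((u \<xi> t - Cf t \<xi>) - (u \<xi>' t - Cf t \<xi>')) \<le> \<eta> * norm (\<xi> - \<xi>') \<and>
        norm ((p \<xi> t - Cf' t \<xi>) - (p \<xi>' t - Cf' t \<xi>')) \<le> \<eta> * norm (\<xi> - \<xi>')))) \<and>
    (\<forall>t\<in>{0..L}. u 0 t = 0 \<and> p 0 t = 0)"

lemma flow_data_exists:
  assumes "\<eta> > 0" "\<rho> > 0"
  obtains \<delta> u p where "flow_data \<eta> \<rho> \<delta> u p"
  using flow_exists[OF L_pos assms] unfolding flow_data_def using assms(1) by (smt (verit))

lemma flow_dataD: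
  assumes "flow_data \<eta> \<rho> \<delta> u p"
  shows "\<eta> > 0" "\<delta> > 0"
    "\<xi> \<in> cball 0 \<delta> \<Longrightarrow> u \<xi> 0 = \<xi>" "\<xi> \<in> cball 0 \<delta> \<Longrightarrow> p \<xi> 0 = 0"
    "\<xi> \<in> cball 0 \<delta> \<Longrightarrow> t \<in> {0..L} \<Longrightarrow> norm (u \<xi> t) \<le> \<rho>"
    "\<xi> \<in> cball 0 \<delta> \<Longrightarrow> t \<in> {0..L} \<Longrightarrow> (u \<xi> has_vector_derivative p \<xi> t) (at t within {0..L})"
    "\<xi> \<in> cball 0 \<delta> \<Longrightarrow> t \<in> {0..L} \<Longrightarrow> (p \<xi> has_vector_derivative - g (u \<xi> t)) (at t within {0..L})"
    "\<xi> \<in> cball 0 \<delta> \<Longrightarrow> t \<in> {0..L} \<Longrightarrow> norm (g (u \<xi> t) - diag \<mu> (Cf t \<xi>)) \<le> \<eta> * norm \<xi>"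
    "\<xi> \<in> cball 0 \<delta> \<Longrightarrow> \<xi>' \<in> cball 0 \<delta> \<Longrightarrow> t \<in> {0..L} \<Longrightarrow>
      norm ((u \<xi> t - Cf t \<xi>) - (u \<xi>' t - Cf t \<xi>')) \<le> \<eta> * norm (\<xi> - \<xi>')"
    "\<xi> \<in> cball 0 \<delta> \<Longrightarrow> \<xi>' \<in> cball 0 \<delta> \<Longrightarrow> t \<in> {0..L} \<Longrightarrow>
      norm ((p \<xi> t - Cf' t \<xi>) - (p \<xi>' t - Cf' t \<xi>')) \<le> \<eta> * norm (\<xi> - \<xi>')"
    "t \<in> {0..L} \<Longrightarrow> u 0 t = 0" "t \<in> {0..L} \<Longrightarrow> p 0 t = 0"
  using assms unfolding flow_data_def by blast+

lemma flow_error: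
  assumes fd: "flow_data \<eta> \<rho> \<delta> u p" and \<xi>: "\<xi> \<in> cball 0 \<delta>" and t: "t \<in> {0..L}"
  shows "norm (u \<xi> t - Cf t \<xi>) \<le> \<eta> * norm \<xi>" "norm (p \<xi> t - Cf' t \<xi>) \<le> \<eta> * norm \<xi>"
  using flow_dataD(9)[OF fd \<xi> _ t, of 0] flow_dataD(10)[OF fd \<xi> _ t, of 0]
    flow_dataD(2,11,12)[OF fd] t by auto

text \<open>In time, the deviation of the position has the deviation of the velocity as derivative,
  and the deviation of the velocity has that of the acceleration; both are at most \<eta> times the
  initial size. Joint control is needed because the half-period is an unknown.\<close>

lemma flow_joint_Lipschitz:
  assumes fd: "flow_data \<eta> \<rho> \<delta> u p" and \<xi>: "\<xi> \<in> cball 0 \<delta>" "\<xi>' \<in> cball 0 \<delta>"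
    and t: "t \<in> {0..L}" "t' \<in> {0..L}"
  shows "norm ((u \<xi> t - Cf t \<xi>) - (u \<xi>' t' - Cf t' \<xi>')) \<le> \<eta> * norm (\<xi> - \<xi>') + \<eta> * norm \<xi>' * \<bar>t - t'\<bar>"
    "norm ((p \<xi> t - Cf' t \<xi>) - (p \<xi>' t' - Cf' t' \<xi>')) \<le> \<eta> * norm (\<xi> - \<xi>') + \<eta> * norm \<xi>' * \<bar>t - t'\<bar>"
proof -
  have du: "((\<lambda>t. u \<xi>' t - Cf t \<xi>') has_vector_derivative p \<xi>' s - Cf' s \<xi>') (at s within {0..L})" if "s \<in> {0..L}" for s
    using has_vector_derivative_diff[OF flow_dataD(6)[OF fd \<xi>(2) that] Cf_deriv[OF has_vector_derivative_const]] by simp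
  have dp: "((\<lambda>t. p \<xi>' t - Cf' t \<xi>') has_vector_derivative - (g (u \<xi>' s) - diag \<mu> (Cf s \<xi>'))) (at s within {0..L})" if "s \<in> {0..L}" for s
    using has_vector_derivative_diff[OF flow_dataD(7)[OF fd \<xi>(2) that] Cf'_deriv[OF has_vector_derivative_const]] by simp
  have "norm ((u \<xi>' t - Cf t \<xi>') - (u \<xi>' t' - Cf t' \<xi>')) \<le> \<eta> * norm \<xi>' * norm (t - t')"
    by (rule vector_differentiable_bound_real[OF du flow_error(2)[OF fd \<xi>(2)] t])
  moreover have "norm ((p \<xi>' t - Cf' t \<xi>') - (p \<xi>' t' - Cf' t' \<xi>')) \<le> \<eta> * norm \<xi>' * norm (t - t')"
    by (rule vector_differentiable_bound_real[OF dp _ t], assumption) (simp only: norm_minus_cancel, rule flow_dataD(8)[OF fd \<xi>(2)])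
  ultimately show "norm ((u \<xi> t - Cf t \<xi>) - (u \<xi>' t' - Cf t' \<xi>')) \<le> \<eta> * norm (\<xi> - \<xi>') + \<eta> * norm \<xi>' * \<bar>t - t'\<bar>"
    "norm ((p \<xi> t - Cf' t \<xi>) - (p \<xi>' t' - Cf' t' \<xi>')) \<le> \<eta> * norm (\<xi> - \<xi>') + \<eta> * norm \<xi>' * \<bar>t - t'\<bar>"
    using norm_diff_triangle_le[OF flow_dataD(9)[OF fd \<xi> t(1)]] norm_diff_triangle_le[OF flow_dataD(10)[OF fd \<xi> t(1)]]
    by (metis real_norm_def)+
qed

end

lemma lin_cos_square: "\<beta> > 0 \<Longrightarrow> lin_cos (\<beta>\<^sup>2) t = cos (\<beta> * t)"
  and lin_sin_square: "\<beta> > 0 \<Longrightarrow> lin_sin (\<beta>\<^sup>2) t = sin (\<beta> * t) / \<beta>"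
  by (auto simp: lin_cos_def lin_sin_def)

lemma product_Lipschitz:
  fixes x x' y y' :: real
  assumes "\<bar>x - x'\<bar> \<le> a" "\<bar>y\<bar> \<le> b" "\<bar>x'\<bar> \<le> c" "\<bar>y - y'\<bar> \<le> d" "0 \<le> a" "0 \<le> c"
  shows "\<bar>x * y - x' * y'\<bar> \<le> a * b + c * d"
proof -
  have "x * y - x' * y' = (x - x') * y + x' * (y - y')" by (simp add: algebra_simps)
  then have "\<bar>x * y - x' * y'\<bar> \<le> \<bar>x - x'\<bar> * \<bar>y\<bar> + \<bar>x'\<bar> * \<bar>y - y'\<bar>"
    by (metis abs_mult abs_triangle_ineq)
  also have "\<dots> \<le> a * b + c * d" using assms by (intro add_mono mult_mono) auto
  finally show ?thesis .
qed

lemma abs_diff_triangle3: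
  fixes a b c :: real
  shows "\<bar>a - a'\<bar> \<le> x \<Longrightarrow> \<bar>b - b'\<bar> \<le> y \<Longrightarrow> \<bar>c - c'\<bar> \<le> z \<Longrightarrow> \<bar>(a + b - c) - (a' + b' - c')\<bar> \<le> x + y + z"
  by linarith

lemma abs_sin_diff_le: "\<bar>sin x - sin y\<bar> \<le> \<bar>x - y :: real\<bar>"
  using abs_sin_x_le_abs_x[of "(x - y) / 2"] abs_cos_le_one[of "(x + y) / 2"]
    mult_mono[of "\<bar>sin ((x - y) / 2)\<bar>" "\<bar>(x - y) / 2\<bar>" "\<bar>cos ((x + y) / 2)\<bar>" 1]
  by (simp add: sin_diff_sin abs_mult)

lemma abs_cos_diff_le: "\<bar>cos x - cos y\<bar> \<le> \<bar>x - y :: real\<bar>"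
  using abs_sin_diff_le[of "pi/2 - x" "pi/2 - y"] by (simp add: sin_diff)

section \<open>The Newton map with frozen derivative and its Lipschitz estimates\<close>

context center begin

lemma inner_Cf_VV: "e \<in> VV \<Longrightarrow> Cf t x \<bullet> e = cos (\<beta> * t) * (x \<bullet> e)"
  unfolding Cf_def diag_selfadjoint using \<beta>_pos
  by (subst diag_VV[where c="cos (\<beta> * t)"]) (auto simp: lin_cos_square)

lemma inner_Cf'_VV: "e \<in> VV \<Longrightarrow> Cf' t x \<bullet> e = - \<beta> * sin (\<beta> * t) * (x \<bullet> e)"
  unfolding Cf'_def diag_selfadjoint using \<beta>_pos
  by (subst diag_VV[where c="- \<beta> * sin (\<beta> * t)"]) (auto simp: lin_sin_square, simp add: power2_eq_square)

text \<open>Rescaled energy minus that of the linear motion of unit amplitude in \<open>V\<close>.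
  At rest all energy is potential, so \<open>En r v = 0\<close> fixes the energy of the whole
  solution. In the limit of small \<open>r\<close> its derivative at \<open>e\<close> in direction
  \<open>e\<close> is \<open>\<beta>\<^sup>2\<close>, the divisor in the Newton step.\<close>

definition En :: "real \<Rightarrow> 'a \<Rightarrow> real" where
  "En r v = (U (r *\<^sub>R v) - U 0) / r\<^sup>2 - \<beta>\<^sup>2 / 2"

text \<open>The Newton update of the coordinate along \<open>b\<close>. To first order the rescaled
  final velocity is \<open>- \<mu> b * lin_sin (\<mu> b) \<tau>0\<close> times
  \<open>v \<bullet> b\<close>; the negative slope explains the plus sign.\<close>

definition wcoef :: "('a \<Rightarrow> real \<Rightarrow> 'a) \<Rightarrow> real \<Rightarrow> 'a \<Rightarrow> 'a \<times> real \<Rightarrow> real" where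
  "wcoef p r b z = fst z \<bullet> b + (p (r *\<^sub>R fst z) (snd z) \<bullet> b) / (r * (\<mu> b * lin_sin (\<mu> b) \<tau>0))"

text \<open>A Newton step with the derivative frozen at \<open>r = 0\<close>, where it is diagonal. The unknown \<open>v\<close> is the
  rescaled initial position and \<open>\<tau>\<close> the half-period.\<close>

definition newton_step :: "('a \<Rightarrow> real \<Rightarrow> 'a) \<Rightarrow> real \<Rightarrow> 'a \<Rightarrow> 'a \<times> real \<Rightarrow> 'a \<times> real" where
  "newton_step p r e z =
    ((fst z \<bullet> e - En r (fst z) / \<beta>\<^sup>2) *\<^sub>R e + (\<Sum>b\<in>BW. wcoef p r b z *\<^sub>R b),
     snd z - (p (r *\<^sub>R fst z) (snd z) \<bullet> e) / (r * \<beta>\<^sup>2))"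

text \<open>The factor \<open>max (norm u) (norm v)\<close> compensates one of the two powers of
  \<open>r\<close> lost in rescaling: for points of size at most \<open>2 * r\<close> the remainder
  of the rescaled energy keeps a Lipschitz constant of order \<eta>, uniformly in
  \<open>r\<close>.\<close>

definition energy_data :: "real \<Rightarrow> real \<Rightarrow> bool" where
  "energy_data \<eta> \<delta> \<longleftrightarrow> (\<forall>u\<in>cball 0 \<delta>. \<forall>v\<in>cball 0 \<delta>.
    \<bar>(U u - 1/2 * (diag \<mu> u \<bullet> u)) - (U v - 1/2 * (diag \<mu> v \<bullet> v))\<bar> \<le> \<eta> * max (norm u) (norm v) * norm (u - v))"

lemma energy_data_exists:
  assumes "\<eta> > 0"
  obtains \<delta> where "\<delta> > 0" "energy_data \<eta> \<delta>"
proof -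
  obtain \<delta>1 where \<delta>1: "\<delta>1 > 0" "\<forall>u\<in>cball 0 \<delta>1. \<forall>v\<in>cball 0 \<delta>1.
      norm ((g u - diag \<mu> u) - (g v - diag \<mu> v)) \<le> \<eta> * norm (u - v)"
    using small_Lipschitz[OF assms] by blast
  define \<delta> where "\<delta> = min \<delta>1 (\<rho>0 / 2)"
  have \<delta>: "\<delta> > 0" using \<delta>1 \<rho>0_pos by (simp add: \<delta>_def)
  have "\<bar>(U u - 1/2 * (diag \<mu> u \<bullet> u)) - (U v - 1/2 * (diag \<mu> v \<bullet> v))\<bar> \<le> \<eta> * max (norm u) (norm v) * norm (u - v)"
    if u: "u \<in> cball 0 \<delta>" and v: "v \<in> cball 0 \<delta>" for u v
  proof -
    define m where "m = max (norm u) (norm v)"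
    have m: "u \<in> cball 0 m" "v \<in> cball 0 m" "m \<le> \<delta>1" "m < \<rho>0" using u v \<rho>0_pos by (auto simp: m_def \<delta>_def)
    let ?f = "\<lambda>u. U u - 1/2 * (diag \<mu> u \<bullet> u)"
    have D: "(?f has_derivative (\<lambda>h. (g x - diag \<mu> x) \<bullet> h)) (at x within cball 0 m)" if "x \<in> cball 0 m" for x
    proof -
      have "(diag \<mu> has_derivative diag \<mu>) (at x)"
        by (rule bounded_linear_imp_has_derivative[OF bounded_linear_diag])
      then have "((\<lambda>x. 1/2 * (diag \<mu> x \<bullet> x)) has_derivative (\<lambda>h. 1/2 * (diag \<mu> x \<bullet> h + diag \<mu> h \<bullet> x))) (at x)"
        by (auto intro!: derivative_eq_intros)
      moreover have "(\<lambda>h. 1/2 * (diag \<mu> x \<bullet> h + diag \<mu> h \<bullet> x)) = (\<lambda>h. diag \<mu> x \<bullet> h)"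
        by (simp add: diag_selfadjoint inner_commute[of "diag \<mu> x"]) (simp add: inner_commute[of x] diag_selfadjoint)
      moreover have "(U has_derivative (\<lambda>h. g x \<bullet> h)) (at x)" using that m by (intro U_deriv) auto
      ultimately have "(?f has_derivative (\<lambda>h. g x \<bullet> h - diag \<mu> x \<bullet> h)) (at x)"
        using has_derivative_diff by metis
      then show ?thesis by (simp add: inner_diff_left has_derivative_at_withinI)
    qed
    have "norm (?f u - ?f v) \<le> (\<eta> * m) * norm (u - v)"
    proof (rule differentiable_bound[OF _ D _ m(1,2)])
      fix x :: 'a assume x: "x \<in> cball 0 m"
      have "norm ((g x - diag \<mu> x) - (g 0 - diag \<mu> 0)) \<le> \<eta> * norm (x - 0)"
        using x m \<delta>1 by (intro \<delta>1(2)[rule_format]) auto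
      also have "\<dots> \<le> \<eta> * m" using x assms by (intro mult_left_mono) auto
      finally have "norm (g x - diag \<mu> x) \<le> \<eta> * m" by (simp add: g_zero)
      then show "onorm (\<lambda>h. (g x - diag \<mu> x) \<bullet> h) \<le> \<eta> * m"
        by (rule onorm_inner_le)
    qed auto
    then show ?thesis by (simp add: m_def)
  qed
  then show ?thesis using that[OF \<delta>] by (auto simp: energy_data_def)
qed

lemma newton_constants:
  obtains K where "K \<ge> 1"
    "\<And>b t. b \<in> B \<Longrightarrow> t \<in> {0..L} \<Longrightarrow> \<bar>lin_cos (\<mu> b) t\<bar> \<le> K"
    "\<And>b t. b \<in> B \<Longrightarrow> t \<in> {0..L} \<Longrightarrow> \<bar>\<mu> b * lin_sin (\<mu> b) t\<bar> \<le> K"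
    "\<And>b. b \<in> B \<Longrightarrow> \<bar>\<mu> b\<bar> \<le> K"
    "\<And>b. b \<in> BW \<Longrightarrow> 1 / \<bar>\<mu> b * lin_sin (\<mu> b) \<tau>0\<bar> \<le> K"
    "\<And>b. b \<in> BW \<Longrightarrow> 1 / \<bar>lin_sin (\<mu> b) \<tau>0\<bar> \<le> K" "1 / \<beta>\<^sup>2 \<le> K" "\<beta> \<le> K"
proof -
  obtain K where K: "K \<ge> 1"
    "\<And>b t. b \<in> B \<Longrightarrow> t \<in> {0..L} \<Longrightarrow> \<bar>lin_cos (\<mu> b) t\<bar> \<le> K"
    "\<And>b t. b \<in> B \<Longrightarrow> t \<in> {0..L} \<Longrightarrow> \<bar>lin_sin (\<mu> b) t\<bar> \<le> K"
    "\<And>b t. b \<in> B \<Longrightarrow> t \<in> {0..L} \<Longrightarrow> \<bar>\<mu> b * lin_sin (\<mu> b) t\<bar> \<le> K"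
    "\<And>b. b \<in> B \<Longrightarrow> \<bar>\<mu> b\<bar> \<le> K"
    using flow_coefficients_bounded[where L=L] by metis
  define s1 where "s1 = (\<Sum>b\<in>BW. 1 / \<bar>\<mu> b * lin_sin (\<mu> b) \<tau>0\<bar>)"
  define s2 where "s2 = (\<Sum>b\<in>BW. 1 / \<bar>lin_sin (\<mu> b) \<tau>0\<bar>)"
  have fin: "finite BW" using finite_B by (simp add: BW_def)
  have s: "s1 \<ge> 0" "s2 \<ge> 0" by (auto simp: s1_def s2_def intro!: sum_nonneg)
  have m1: "1 / \<bar>\<mu> b * lin_sin (\<mu> b) \<tau>0\<bar> \<le> s1" if "b \<in> BW" for b
    unfolding s1_def by (rule member_le_sum[OF that _ fin]) simp
  have m2: "1 / \<bar>lin_sin (\<mu> b) \<tau>0\<bar> \<le> s2" if "b \<in> BW" for b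
    unfolding s2_def by (rule member_le_sum[OF that _ fin]) simp
  have p: "1 / \<beta>\<^sup>2 \<ge> 0" by simp
  show ?thesis
  proof (rule that[of "K + s1 + s2 + 1 / \<beta>\<^sup>2 + \<beta>"])
    show "\<bar>lin_cos (\<mu> b) t\<bar> \<le> K + s1 + s2 + 1 / \<beta>\<^sup>2 + \<beta>" if "b \<in> B" "t \<in> {0..L}" for b t
      using K(2)[OF that] s p \<beta>_pos by linarith
    show "\<bar>\<mu> b * lin_sin (\<mu> b) t\<bar> \<le> K + s1 + s2 + 1 / \<beta>\<^sup>2 + \<beta>" if "b \<in> B" "t \<in> {0..L}" for b t
      using K(4)[OF that] s p \<beta>_pos by linarith
    show "\<bar>\<mu> b\<bar> \<le> K + s1 + s2 + 1 / \<beta>\<^sup>2 + \<beta>" if "b \<in> B" for b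
      using K(5)[OF that] s p \<beta>_pos by linarith
    show "1 / \<bar>\<mu> b * lin_sin (\<mu> b) \<tau>0\<bar> \<le> K + s1 + s2 + 1 / \<beta>\<^sup>2 + \<beta>"
      "1 / \<bar>lin_sin (\<mu> b) \<tau>0\<bar> \<le> K + s1 + s2 + 1 / \<beta>\<^sup>2 + \<beta>" if "b \<in> BW" for b
      using m1[OF that] m2[OF that] s p \<beta>_pos K(1) by linarith+
  qed (use s p \<beta>_pos K(1) in linarith)+
qed

text \<open>Each component is a coordinate minus its normalised equation, so the linear part at
  \<open>(e, \<tau>0)\<close> cancels. What remains carries a factor \<kappa> from the distance to
  that point, or is nonlinear error: \<eta> for the change of \<open>v\<close> and
  \<open>2 * \<eta>\<close> for the change of the time, since \<open>norm v'\<close> is at most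
  2.\<close>

lemma newton_components_Lipschitz:
  assumes K: "K \<ge> 1" "\<And>b t. b \<in> B \<Longrightarrow> t \<in> {0..L} \<Longrightarrow> \<bar>lin_cos (\<mu> b) t\<bar> \<le> K"
    "\<And>b. b \<in> B \<Longrightarrow> \<bar>\<mu> b\<bar> \<le> K"
    "\<And>b. b \<in> BW \<Longrightarrow> 1 / \<bar>\<mu> b * lin_sin (\<mu> b) \<tau>0\<bar> \<le> K"
    "\<And>b. b \<in> BW \<Longrightarrow> 1 / \<bar>lin_sin (\<mu> b) \<tau>0\<bar> \<le> K" "1 / \<beta>\<^sup>2 \<le> K" "\<beta> \<le> K"
    and fd: "flow_data \<eta> \<rho> \<delta> u p" and ed: "energy_data \<eta> \<delta>"
    and r: "r > 0" "2 * r \<le> \<delta>" and \<kappa>: "0 < \<kappa>" "\<kappa> \<le> 1" "\<kappa> \<le> \<tau>0"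
    and e: "e \<in> VV" "norm e = 1"
    and z: "norm (v - e) \<le> \<kappa>" "\<bar>\<tau> - \<tau>0\<bar> \<le> \<kappa>" "norm (v' - e) \<le> \<kappa>" "\<bar>\<tau>' - \<tau>0\<bar> \<le> \<kappa>"
    and d: "norm (v - v') \<le> d" "\<bar>\<tau> - \<tau>'\<bar> \<le> d"
  shows "\<bar>(v \<bullet> e - En r v / \<beta>\<^sup>2) - (v' \<bullet> e - En r v' / \<beta>\<^sup>2)\<bar> \<le> K\<^sup>2 * (3 * \<kappa> + 3 * \<eta>) * d"
    and "b \<in> BW \<Longrightarrow> \<bar>wcoef p r b (v, \<tau>) - wcoef p r b (v', \<tau>')\<bar> \<le> K\<^sup>2 * (3 * \<kappa> + 3 * \<eta>) * d"
    and "\<bar>(\<tau> - (p (r *\<^sub>R v) \<tau> \<bullet> e) / (r * \<beta>\<^sup>2)) - (\<tau>' - (p (r *\<^sub>R v') \<tau>' \<bullet> e) / (r * \<beta>\<^sup>2))\<bar>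
      \<le> K\<^sup>2 * (3 * \<kappa> + 3 * \<eta>) * d"
proof -
  have \<eta>: "\<eta> > 0" using fd by (rule flow_dataD)
  have d0: "d \<ge> 0" using d(2) by linarith
  have K2: "K \<le> K\<^sup>2" "1 \<le> K\<^sup>2" using K(1) by (auto simp: power2_eq_square mult_le_cancel_left1 intro: order.trans)
  have nv: "norm v \<le> 2" "norm v' \<le> 2"
    using norm_triangle_sub[of v e] norm_triangle_sub[of v' e] z e \<kappa> by auto
  have in_ball: "r *\<^sub>R v \<in> cball 0 \<delta>" "r *\<^sub>R v' \<in> cball 0 \<delta>"
  proof -
    have "r * norm v \<le> r * 2" "r * norm v' \<le> r * 2" using nv r by (auto intro!: mult_left_mono)
    then have "r * norm v \<le> \<delta>" "r * norm v' \<le> \<delta>" using r by linarith+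
    then show "r *\<^sub>R v \<in> cball 0 \<delta>" "r *\<^sub>R v' \<in> cball 0 \<delta>" using r by simp_all
  qed
  have \<tau>: "\<tau> \<in> {0..L}" "\<tau>' \<in> {0..L}" using z \<kappa> \<tau>0_L by auto
  have \<tau>0: "\<tau>0 \<in> {0..L}" using \<tau>0_pos \<tau>0_L by auto
  define E where "E = (p (r *\<^sub>R v) \<tau> - Cf' \<tau> (r *\<^sub>R v))"
  define E' where "E' = (p (r *\<^sub>R v') \<tau>' - Cf' \<tau>' (r *\<^sub>R v'))"
  have "norm (E - E') \<le> \<eta> * norm (r *\<^sub>R v - r *\<^sub>R v') + \<eta> * norm (r *\<^sub>R v') * \<bar>\<tau> - \<tau>'\<bar>"
    unfolding E_def E'_def by (rule flow_joint_Lipschitz(2)[OF fd in_ball \<tau>])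
  also have "\<dots> = \<eta> * r * (norm (v - v') + norm v' * \<bar>\<tau> - \<tau>'\<bar>)"
    using r by (simp add: algebra_simps flip: scaleR_diff_right)
  also have "\<dots> \<le> \<eta> * r * (d + 2 * d)"
    using \<eta> r nv d d0 by (intro mult_left_mono add_mono mult_mono) auto
  finally have E: "norm (E - E') \<le> r * (3 * \<eta> * d)" by (simp add: mult_ac)
  have E_inner: "\<bar>(E \<bullet> x - E' \<bullet> x) / (r * y)\<bar> \<le> 3 * \<eta> * d * (1 / \<bar>y\<bar>)" if "norm x = 1" for x y
  proof -
    have "\<bar>(E \<bullet> x - E' \<bullet> x) / (r * y)\<bar> = \<bar>(E - E') \<bullet> x\<bar> / (r * \<bar>y\<bar>)"
      using r by (simp add: inner_diff_left abs_mult)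
    also have "\<dots> \<le> (r * (3 * \<eta> * d)) / (r * \<bar>y\<bar>)"
      using E Cauchy_Schwarz_ineq2[of "E - E'" x] that r by (intro divide_right_mono) auto
    also have "\<dots> = 3 * \<eta> * d * (1 / \<bar>y\<bar>)" using r by simp
    finally show ?thesis .
  qed
  have Kup: "a * x \<le> K\<^sup>2 * a" if "x \<le> K\<^sup>2" "a \<ge> 0" for a x
    using mult_left_mono[OF that] by (simp add: mult.commute)
  show "\<bar>(v \<bullet> e - En r v / \<beta>\<^sup>2) - (v' \<bullet> e - En r v' / \<beta>\<^sup>2)\<bar> \<le> K\<^sup>2 * (3 * \<kappa> + 3 * \<eta>) * d"
  proof -
    define X where "X = (U (r *\<^sub>R v) - 1/2 * (diag \<mu> (r *\<^sub>R v) \<bullet> (r *\<^sub>R v))) - (U (r *\<^sub>R v') - 1/2 * (diag \<mu> (r *\<^sub>R v') \<bullet> (r *\<^sub>R v')))"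
    have mx: "max (norm (r *\<^sub>R v)) (norm (r *\<^sub>R v')) \<le> 2 * r" using nv r by simp
    have "\<bar>X\<bar> \<le> \<eta> * max (norm (r *\<^sub>R v)) (norm (r *\<^sub>R v')) * norm (r *\<^sub>R v - r *\<^sub>R v')"
      unfolding X_def by (rule ed[unfolded energy_data_def, rule_format, OF in_ball])
    also have "\<dots> = \<eta> * max (norm (r *\<^sub>R v)) (norm (r *\<^sub>R v')) * (r * norm (v - v'))"
      using r by (simp flip: scaleR_diff_right)
    also have "\<dots> \<le> \<eta> * (2 * r) * (r * d)"
      using \<eta> r d d0 mx by (intro mult_mono) (auto simp: max_def intro!: mult_nonneg_nonneg)
    finally have X: "\<bar>X / r\<^sup>2\<bar> \<le> 2 * \<eta> * d" using r by (simp add: power2_eq_square field_simps)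
    have He: "diag \<mu> e = \<beta>\<^sup>2 *\<^sub>R e" by (rule diag_VV[OF e(1)])
    \<comment> \<open>Expansion of the quadratic form around the eigenvector \<open>e\<close>. The
      first-order term equals \<open>\<beta>\<^sup>2\<close> times the change of
      \<open>v \<bullet> e\<close> and cancels against it; the rest contains a vector of norm at
      most \<open>2 * \<kappa>\<close>.\<close>
    have q: "1/2 * (diag \<mu> v \<bullet> v) - 1/2 * (diag \<mu> v' \<bullet> v') = \<beta>\<^sup>2 * (e \<bullet> (v - v')) + 1/2 * (diag \<mu> ((v - e) + (v' - e)) \<bullet> (v - v'))"
    proof -
      have "diag \<mu> v \<bullet> v' = diag \<mu> v' \<bullet> v" by (metis diag_selfadjoint inner_commute)
      moreover have "diag \<mu> e \<bullet> v = \<beta>\<^sup>2 * (e \<bullet> v)" "diag \<mu> e \<bullet> v' = \<beta>\<^sup>2 * (e \<bullet> v')"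
        by (simp_all add: He)
      ultimately show ?thesis by (simp add: diag_add diag_diff inner_simps algebra_simps)
    qed
    have "En r v - En r v' = (1/2 * (diag \<mu> v \<bullet> v) - 1/2 * (diag \<mu> v' \<bullet> v')) + X / r\<^sup>2"
    proof -
      have alg: "(a / r\<^sup>2 - c) - (a' / r\<^sup>2 - c) = (x - x') + ((a + k - r\<^sup>2 * x) - (a' + k - r\<^sup>2 * x')) / r\<^sup>2" for a a' c x x' k
        using r by (simp add: field_simps)
      have "X = (U (r *\<^sub>R v) - U 0 + U 0 - r\<^sup>2 * (1/2 * (diag \<mu> v \<bullet> v))) - (U (r *\<^sub>R v') - U 0 + U 0 - r\<^sup>2 * (1/2 * (diag \<mu> v' \<bullet> v')))"
        by (simp add: X_def diag_scaleR power2_eq_square)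
      then show ?thesis unfolding En_def by (simp only: alg[where k="U 0"])
    qed
    then have DE: "En r v - En r v' = \<beta>\<^sup>2 * (e \<bullet> (v - v')) + (1/2 * (diag \<mu> ((v - e) + (v' - e)) \<bullet> (v - v')) + X / r\<^sup>2)"
      unfolding q by simp
    have "(v \<bullet> e - En r v / \<beta>\<^sup>2) - (v' \<bullet> e - En r v' / \<beta>\<^sup>2) = e \<bullet> (v - v') - (En r v - En r v') / \<beta>\<^sup>2"
      by (simp add: diff_divide_distrib inner_diff_right inner_commute)
    also have "\<dots> = - (1/2 * (diag \<mu> ((v - e) + (v' - e)) \<bullet> (v - v')) + X / r\<^sup>2) * (1/ \<beta>\<^sup>2)"
    proof -
      have "a - (\<beta>\<^sup>2 * a + c) / \<beta>\<^sup>2 = - c * (1 / \<beta>\<^sup>2)" for a c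
        using \<beta>_pos by (simp add: add_divide_distrib)
      then show ?thesis unfolding DE .
    qed
    finally have *: "(v \<bullet> e - En r v / \<beta>\<^sup>2) - (v' \<bullet> e - En r v' / \<beta>\<^sup>2) = - (1/2 * (diag \<mu> ((v - e) + (v' - e)) \<bullet> (v - v')) + X / r\<^sup>2) * (1/ \<beta>\<^sup>2)" .
    have "\<bar>(v \<bullet> e - En r v / \<beta>\<^sup>2) - (v' \<bullet> e - En r v' / \<beta>\<^sup>2)\<bar> = \<bar>1/2 * (diag \<mu> ((v - e) + (v' - e)) \<bullet> (v - v')) + X / r\<^sup>2\<bar> * (1 / \<beta>\<^sup>2)"
      unfolding * by (simp only: abs_mult abs_minus_cancel) simp
    also have "\<dots> \<le> (K * \<kappa> * d + 2 * \<eta> * d) * K"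
    proof (intro mult_mono order.trans[OF abs_triangle_ineq] add_mono X K(6))
      have "\<bar>diag \<mu> ((v - e) + (v' - e)) \<bullet> (v - v')\<bar> \<le> norm (diag \<mu> ((v - e) + (v' - e))) * norm (v - v')"
        by (rule Cauchy_Schwarz_ineq2)
      also have "\<dots> \<le> (K * norm ((v - e) + (v' - e))) * d" using d d0 K(1) by (intro mult_mono diag_bound K(3)) auto
      also have "\<dots> \<le> (K * (\<kappa> + \<kappa>)) * d"
        using d0 K(1) z by (intro mult_right_mono mult_left_mono norm_triangle_mono) auto
      finally show "\<bar>1/2 * (diag \<mu> ((v - e) + (v' - e)) \<bullet> (v - v'))\<bar> \<le> K * \<kappa> * d" by (simp add: abs_mult)
    qed (use K(1) \<kappa> \<eta> d0 in auto)
    also have "\<dots> = K\<^sup>2 * (\<kappa> * d) + K * (2 * \<eta> * d)" by (simp add: power2_eq_square algebra_simps)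
    also have "\<dots> \<le> K\<^sup>2 * (\<kappa> * d) + K\<^sup>2 * (2 * \<eta> * d)"
      using K2 \<eta> d0 by (intro add_left_mono mult_right_mono) auto
    also have "\<dots> \<le> K\<^sup>2 * (3 * \<kappa> + 3 * \<eta>) * d"
      using \<kappa> \<eta> d0 by (simp add: algebra_simps mult_left_mono)
    finally show ?thesis .
  qed
  show "\<bar>wcoef p r b (v, \<tau>) - wcoef p r b (v', \<tau>')\<bar> \<le> K\<^sup>2 * (3 * \<kappa> + 3 * \<eta>) * d" if b: "b \<in> BW"
  proof -
    have bB: "b \<in> B" "\<mu> b \<noteq> 0" using b by (auto simp: BW_def)
    define s0 where "s0 = lin_sin (\<mu> b) \<tau>0"
    have s0: "s0 \<noteq> 0" using nonresonant[of b] b unfolding BW_def s0_def \<tau>0_def by blast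
    \<comment> \<open>\<open>\<phi>\<close> vanishes at \<open>\<tau>0\<close> and
      \<open>v \<bullet> b\<close> vanishes at \<open>v = e\<close>, so the linear part of the
      coordinate is a product of two factors that are both small near the centre.\<close>
    define \<phi> where "\<phi> = (\<lambda>t. 1 - lin_sin (\<mu> b) t / s0)"
    have \<phi>_lip: "\<bar>\<phi> s - \<phi> t\<bar> \<le> K\<^sup>2 * \<bar>s - t\<bar>" if "s \<in> {0..L}" "t \<in> {0..L}" for s t
    proof -
      have "norm (\<phi> s - \<phi> t) \<le> K\<^sup>2 * norm (s - t)"
      proof (rule vector_differentiable_bound_real[OF _ _ that])
        fix x assume x: "x \<in> {0..L}"
        show "(\<phi> has_vector_derivative - (lin_cos (\<mu> b) x / s0)) (at x within {0..L})"
          unfolding \<phi>_def has_real_derivative_iff_has_vector_derivative[symmetric]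
          using s0 by (auto intro!: derivative_eq_intros lin_sin_deriv)
        have "\<bar>lin_cos (\<mu> b) x\<bar> * (1 / \<bar>s0\<bar>) \<le> K * K"
          using K(2)[OF bB(1) x] K(5)[OF b] K(1) by (intro mult_mono) (auto simp: s0_def)
        then show "norm (- (lin_cos (\<mu> b) x / s0)) \<le> K\<^sup>2" by (simp add: power2_eq_square)
      qed
      then show ?thesis by simp
    qed
    have w: "wcoef p r b (v, \<tau>) = (v \<bullet> b) * \<phi> \<tau> + E \<bullet> b / (r * (\<mu> b * s0))"
      "wcoef p r b (v', \<tau>') = (v' \<bullet> b) * \<phi> \<tau>' + E' \<bullet> b / (r * (\<mu> b * s0))"
    proof -
      have alg: "x + (y - m * s * (r * x)) / (r * (m * s0)) = x * (1 - s / s0) + y / (r * (m * s0))"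
        if "m \<noteq> 0" for x y m s
        using r s0 that by (simp add: field_simps)
      have "p (r *\<^sub>R v) \<tau> \<bullet> b = E \<bullet> b - \<mu> b * lin_sin (\<mu> b) \<tau> * (r * (v \<bullet> b))"
        "p (r *\<^sub>R v') \<tau>' \<bullet> b = E' \<bullet> b - \<mu> b * lin_sin (\<mu> b) \<tau>' * (r * (v' \<bullet> b))"
        using bB by (simp_all add: E_def E'_def Cf'_def inner_diff_left)
      then show "wcoef p r b (v, \<tau>) = (v \<bullet> b) * \<phi> \<tau> + E \<bullet> b / (r * (\<mu> b * s0))"
        "wcoef p r b (v', \<tau>') = (v' \<bullet> b) * \<phi> \<tau>' + E' \<bullet> b / (r * (\<mu> b * s0))"
        unfolding wcoef_def \<phi>_def s0_def[symmetric] by (simp_all only: fst_conv snd_conv alg[OF bB(2)])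
    qed
    have "\<phi> \<tau>0 = 0" using s0 by (simp add: \<phi>_def s0_def)
    then have \<phi>\<tau>: "\<bar>\<phi> \<tau>\<bar> \<le> K\<^sup>2 * \<kappa>"
      using \<phi>_lip[OF \<tau>(1) \<tau>0] z(2) K2 mult_left_mono[of "\<bar>\<tau> - \<tau>0\<bar>" \<kappa> "K\<^sup>2"] by simp
    have "\<bar>(v \<bullet> b) * \<phi> \<tau> - (v' \<bullet> b) * \<phi> \<tau>'\<bar> \<le> d * (K\<^sup>2 * \<kappa>) + \<kappa> * (K\<^sup>2 * d)"
    proof (rule product_Lipschitz[OF _ \<phi>\<tau>])
      show "\<bar>v \<bullet> b - v' \<bullet> b\<bar> \<le> d" using abs_inner_le[OF bB(1), of "v - v'"] d by (simp add: inner_diff_left)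
      show "\<bar>v' \<bullet> b\<bar> \<le> \<kappa>"
        using abs_inner_le[OF bB(1), of "v' - e"] z VV_orth[OF e(1) b] by (simp add: inner_diff_left)
      show "\<bar>\<phi> \<tau> - \<phi> \<tau>'\<bar> \<le> K\<^sup>2 * d"
        using \<phi>_lip[OF \<tau>] mult_left_mono[OF d(2), of "K\<^sup>2"] by simp
    qed (use d0 \<kappa> in auto)
    moreover have "\<bar>(E \<bullet> b - E' \<bullet> b) / (r * (\<mu> b * s0))\<bar> \<le> K\<^sup>2 * (3 * \<eta> * d)"
      using E_inner[of b "\<mu> b * s0"] norm_B[OF bB(1)] Kup[of "1 / \<bar>\<mu> b * s0\<bar>" "3 * \<eta> * d"] K(4)[OF b] K2 \<eta> d0
      by (force simp: s0_def)
    ultimately have "\<bar>wcoef p r b (v, \<tau>) - wcoef p r b (v', \<tau>')\<bar> \<le> (d * (K\<^sup>2 * \<kappa>) + \<kappa> * (K\<^sup>2 * d)) + K\<^sup>2 * (3 * \<eta> * d)"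
      unfolding w by (simp add: diff_divide_distrib abs_le_iff)
    also have "\<dots> \<le> K\<^sup>2 * (3 * \<kappa> + 3 * \<eta>) * d"
      using \<kappa> d0 by (simp add: algebra_simps)
    finally show ?thesis .
  qed
  show "\<bar>(\<tau> - (p (r *\<^sub>R v) \<tau> \<bullet> e) / (r * \<beta>\<^sup>2)) - (\<tau>' - (p (r *\<^sub>R v') \<tau>' \<bullet> e) / (r * \<beta>\<^sup>2))\<bar>
      \<le> K\<^sup>2 * (3 * \<kappa> + 3 * \<eta>) * d"
  proof -
    \<comment> \<open>The linear part of the time component splits into
      \<open>\<tau> + \<psi> \<tau>\<close>, whose derivative
      \<open>1 + cos (\<beta> * \<tau>)\<close> vanishes at \<open>\<tau>0\<close>, and the product
      of \<open>v \<bullet> e - 1\<close> with \<open>\<psi> \<tau>\<close>, both factors being at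
      most \<kappa>.\<close>
    define \<psi> where "\<psi> = (\<lambda>t. sin (\<beta> * t) / \<beta>)"
    have \<psi>_lip: "\<bar>\<psi> s - \<psi> t\<bar> \<le> \<bar>s - t\<bar>" for s t
    proof -
      have "\<bar>sin (\<beta> * s) - sin (\<beta> * t)\<bar> \<le> \<bar>\<beta> * s - \<beta> * t\<bar>" by (rule abs_sin_diff_le)
      also have "\<dots> = \<beta> * \<bar>s - t\<bar>" using \<beta>_pos by (simp add: abs_mult flip: right_diff_distrib)
      finally show ?thesis using \<beta>_pos by (simp add: \<psi>_def field_simps flip: diff_divide_distrib)
    qed
    have \<psi>0: "\<psi> \<tau>0 = 0" using \<beta>_pos by (simp add: \<psi>_def \<tau>0_def)
    have t: "\<tau> - (p (r *\<^sub>R v) \<tau> \<bullet> e) / (r * \<beta>\<^sup>2) = (\<tau> + \<psi> \<tau>) + (v \<bullet> e - 1) * \<psi> \<tau> - E \<bullet> e / (r * \<beta>\<^sup>2)"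
      "\<tau>' - (p (r *\<^sub>R v') \<tau>' \<bullet> e) / (r * \<beta>\<^sup>2) = (\<tau>' + \<psi> \<tau>') + (v' \<bullet> e - 1) * \<psi> \<tau>' - E' \<bullet> e / (r * \<beta>\<^sup>2)"
    proof -
      have alg: "\<tau> - (y - \<beta> * s * (r * x)) / (r * \<beta>\<^sup>2) = (\<tau> + s / \<beta>) + (x - 1) * (s / \<beta>) - y / (r * \<beta>\<^sup>2)"
        for x y s \<tau>
        using r \<beta>_pos by (simp add: field_simps power2_eq_square)
      have "p (r *\<^sub>R v) \<tau> \<bullet> e = E \<bullet> e - \<beta> * sin (\<beta> * \<tau>) * (r * (v \<bullet> e))"
        "p (r *\<^sub>R v') \<tau>' \<bullet> e = E' \<bullet> e - \<beta> * sin (\<beta> * \<tau>') * (r * (v' \<bullet> e))"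
        by (simp_all add: E_def E'_def inner_diff_left inner_Cf'_VV[OF e(1)])
      then show "\<tau> - (p (r *\<^sub>R v) \<tau> \<bullet> e) / (r * \<beta>\<^sup>2) = (\<tau> + \<psi> \<tau>) + (v \<bullet> e - 1) * \<psi> \<tau> - E \<bullet> e / (r * \<beta>\<^sup>2)"
        "\<tau>' - (p (r *\<^sub>R v') \<tau>' \<bullet> e) / (r * \<beta>\<^sup>2) = (\<tau>' + \<psi> \<tau>') + (v' \<bullet> e - 1) * \<psi> \<tau>' - E' \<bullet> e / (r * \<beta>\<^sup>2)"
        unfolding \<psi>_def by (simp_all only: alg)
    qed
    have ee: "e \<bullet> e = 1" using e(2) by (simp add: norm_eq_1)
    have "\<bar>(v \<bullet> e - 1) * \<psi> \<tau> - (v' \<bullet> e - 1) * \<psi> \<tau>'\<bar> \<le> d * \<kappa> + \<kappa> * d"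
    proof (rule product_Lipschitz)
      show "\<bar>(v \<bullet> e - 1) - (v' \<bullet> e - 1)\<bar> \<le> d"
        using Cauchy_Schwarz_ineq2[of "v - v'" e] d e by (simp add: inner_diff_left)
      show "\<bar>v' \<bullet> e - 1\<bar> \<le> \<kappa>"
        using Cauchy_Schwarz_ineq2[of "v' - e" e] z e ee by (simp add: inner_diff_left)
      show "\<bar>\<psi> \<tau>\<bar> \<le> \<kappa>" using \<psi>_lip[of \<tau> \<tau>0] \<psi>0 z by simp
      show "\<bar>\<psi> \<tau> - \<psi> \<tau>'\<bar> \<le> d" using \<psi>_lip[of \<tau> \<tau>'] d by simp
    qed (use d0 \<kappa> in auto)
    moreover have "norm ((\<tau> + \<psi> \<tau>) - (\<tau>' + \<psi> \<tau>')) \<le> (K * \<kappa>) * norm (\<tau> - \<tau>')"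
    proof (rule vector_differentiable_bound_real[of "\<tau>0 - \<kappa>" "\<tau>0 + \<kappa>"])
      fix s assume s: "s \<in> {\<tau>0 - \<kappa>..\<tau>0 + \<kappa>}"
      show "((\<lambda>t. t + \<psi> t) has_vector_derivative (1 + cos (\<beta> * s))) (at s within {\<tau>0 - \<kappa>..\<tau>0 + \<kappa>})"
        unfolding \<psi>_def has_real_derivative_iff_has_vector_derivative[symmetric]
        using \<beta>_pos by (auto intro!: derivative_eq_intros)
      have "\<bar>cos (\<beta> * s) - cos (\<beta> * \<tau>0)\<bar> \<le> \<bar>\<beta> * s - \<beta> * \<tau>0\<bar>" by (rule abs_cos_diff_le)
      also have "\<dots> = \<beta> * \<bar>s - \<tau>0\<bar>" using \<beta>_pos by (simp add: abs_mult flip: right_diff_distrib)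
      also have "\<dots> \<le> K * \<kappa>" using s K(1,7) \<beta>_pos by (intro mult_mono) auto
      finally show "norm (1 + cos (\<beta> * s)) \<le> K * \<kappa>" using \<beta>_pos by (simp add: \<tau>0_def)
    qed (use z in auto)
    moreover have "(K * \<kappa>) * norm (\<tau> - \<tau>') \<le> (K\<^sup>2 * \<kappa>) * d"
      using d K K2 \<kappa> by (intro mult_mono) auto
    moreover have "\<bar>(E \<bullet> e - E' \<bullet> e) / (r * \<beta>\<^sup>2)\<bar> \<le> K\<^sup>2 * (3 * \<eta> * d)"
      using E_inner[of e "\<beta>\<^sup>2"] e Kup[of "1 / \<beta>\<^sup>2" "3 * \<eta> * d"] K(6) K2 \<eta> d0 by force
    moreover have "d * \<kappa> + \<kappa> * d \<le> K\<^sup>2 * (2 * \<kappa> * d)"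
      using K2 mult_right_mono[of 1 "K\<^sup>2" "2 * \<kappa> * d"] \<kappa> d0 by (simp add: mult_ac)
    ultimately have "\<bar>(\<tau> - (p (r *\<^sub>R v) \<tau> \<bullet> e) / (r * \<beta>\<^sup>2)) - (\<tau>' - (p (r *\<^sub>R v') \<tau>' \<bullet> e) / (r * \<beta>\<^sup>2))\<bar>
      \<le> (K\<^sup>2 * \<kappa>) * d + K\<^sup>2 * (2 * \<kappa> * d) + K\<^sup>2 * (3 * \<eta> * d)"
      unfolding t diff_divide_distrib real_norm_def by (intro abs_diff_triangle3) linarith+
    also have "\<dots> = K\<^sup>2 * (3 * \<kappa> + 3 * \<eta>) * d" by (simp add: algebra_simps)
    finally show ?thesis .
  qed
qed

end

text \<open>\<open>small_contraction\<close> makes the Newton map contract by 1/8 on the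
  \<kappa>-neighbourhood of \<open>(e, \<tau>0)\<close>; \<open>small_center\<close> bounds the
  displacement of that centre by a quarter of \<kappa>. Neither condition involves \<open>r\<close>,
  which only has to satisfy \<open>2 * r \<le> \<delta>\<close> so that all rescaled positions are
  admissible data.\<close>

locale scaled_center = center B \<mu> g U \<beta> \<rho>0
  for B :: "'a::euclidean_space set" and \<mu> g U \<beta> \<rho>0 +
  fixes K \<eta> \<rho> \<delta> r \<kappa> :: real and u p :: "'a \<Rightarrow> real \<Rightarrow> 'a"
  assumes K1: "K \<ge> 1"
    and K_cos: "\<And>b t. b \<in> B \<Longrightarrow> t \<in> {0..L} \<Longrightarrow> \<bar>lin_cos (\<mu> b) t\<bar> \<le> K"
    and K_sin: "\<And>b t. b \<in> B \<Longrightarrow> t \<in> {0..L} \<Longrightarrow> \<bar>\<mu> b * lin_sin (\<mu> b) t\<bar> \<le> K"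
    and K_\<mu>: "\<And>b. b \<in> B \<Longrightarrow> \<bar>\<mu> b\<bar> \<le> K"
    and K_W: "\<And>b. b \<in> BW \<Longrightarrow> 1 / \<bar>\<mu> b * lin_sin (\<mu> b) \<tau>0\<bar> \<le> K"
    and K_W': "\<And>b. b \<in> BW \<Longrightarrow> 1 / \<bar>lin_sin (\<mu> b) \<tau>0\<bar> \<le> K"
    and K_\<beta>: "1 / \<beta>\<^sup>2 \<le> K" "\<beta> \<le> K"
    and flow: "flow_data \<eta> \<rho> \<delta> u p" and energy: "energy_data \<eta> \<delta>"
    and r_pos: "r > 0" and r_le: "2 * r \<le> \<delta>" and \<rho>_less: "\<rho> < \<rho>0"
    and \<kappa>_pos: "0 < \<kappa>" and \<kappa>_le: "\<kappa> \<le> 1" "\<kappa> \<le> \<tau>0"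
    and small_contraction: "(2 + real (card B)) * (K\<^sup>2 * (3 * \<kappa> + 3 * \<eta>)) \<le> 1 / 8"
    and small_center: "(2 + real (card B)) * (\<eta> * K) \<le> \<kappa> / 4"
begin

lemma \<eta>_pos: "\<eta> > 0" using flow by (rule flow_dataD)

definition near :: "'a \<Rightarrow> 'a \<times> real \<Rightarrow> bool" where
  "near e z \<longleftrightarrow> norm (fst z - e) \<le> \<kappa> \<and> \<bar>snd z - \<tau>0\<bar> \<le> \<kappa>"

lemma near_props:
  assumes "near e z" "norm e = 1"
  shows "norm (fst z) \<le> 2" "r *\<^sub>R fst z \<in> cball 0 \<delta>" "snd z \<in> {0..L}"
proof -
  show n: "norm (fst z) \<le> 2"
    using norm_triangle_sub[of "fst z" e] assms \<kappa>_le by (auto simp: near_def)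
  have "r * norm (fst z) \<le> r * 2" using n r_pos by (intro mult_left_mono) auto
  then have "r * norm (fst z) \<le> \<delta>" using r_le by linarith
  then show "r *\<^sub>R fst z \<in> cball 0 \<delta>" using r_pos by simp
  show "snd z \<in> {0..L}" using assms(1) \<kappa>_le \<tau>0_L by (auto simp: near_def)
qed

lemma finite_BW: "finite BW" and card_BW: "card BW \<le> card B"
  using finite_B by (auto simp: BW_def intro: card_mono)

text \<open>Origin of the factor \<open>2 + card B\<close>: one summand for the coordinate along
  \<open>e\<close>, one for the half-period, and at most \<open>card B\<close> for the coordinates
  in \<open>BW\<close>.\<close>

lemma norm_newton_diff:
  assumes e: "norm e = 1" and a: "\<bar>a - a'\<bar> \<le> c" and w: "\<And>b. b \<in> BW \<Longrightarrow> \<bar>w b - w' b\<bar> \<le> c"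
    and t: "\<bar>t - t'\<bar> \<le> c"
  shows "norm ((a *\<^sub>R e + (\<Sum>b\<in>BW. w b *\<^sub>R b), t) - (a' *\<^sub>R e + (\<Sum>b\<in>BW. w' b *\<^sub>R b), t')) \<le> (2 + real (card B)) * c"
proof -
  have c0: "c \<ge> 0" using a by linarith
  have "norm ((a *\<^sub>R e + (\<Sum>b\<in>BW. w b *\<^sub>R b)) - (a' *\<^sub>R e + (\<Sum>b\<in>BW. w' b *\<^sub>R b)))
      = norm ((a - a') *\<^sub>R e + (\<Sum>b\<in>BW. (w b - w' b) *\<^sub>R b))"
    by (simp add: scaleR_diff_left sum_subtractf algebra_simps)
  also have "\<dots> \<le> norm ((a - a') *\<^sub>R e) + norm (\<Sum>b\<in>BW. (w b - w' b) *\<^sub>R b)"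
    by (rule norm_triangle_ineq)
  also have "\<dots> \<le> c + (\<Sum>b\<in>BW. c)"
  proof (intro add_mono sum_norm_le)
    show "norm ((w b - w' b) *\<^sub>R b) \<le> c" if "b \<in> BW" for b
      using w[OF that] norm_B[of b] that by (simp add: BW_def)
  qed (use a e in simp)
  also have "\<dots> \<le> c + card B * c" using card_BW c0 by (simp add: mult_right_mono)
  finally have "norm ((a *\<^sub>R e + (\<Sum>b\<in>BW. w b *\<^sub>R b)) - (a' *\<^sub>R e + (\<Sum>b\<in>BW. w' b *\<^sub>R b))) \<le> c + card B * c" .
  then show ?thesis
    using t norm_Pair_le[of "(a *\<^sub>R e + (\<Sum>b\<in>BW. w b *\<^sub>R b)) - (a' *\<^sub>R e + (\<Sum>b\<in>BW. w' b *\<^sub>R b))" "t - t'"]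
    by (simp add: algebra_simps)
qed

lemma newton_contraction:
  assumes e: "e \<in> VV" "norm e = 1" and z: "near e z" "near e z'"
  shows "norm (newton_step p r e z - newton_step p r e z') \<le> 1/8 * norm (z - z')"
proof -
  define d where "d = norm (z - z')"
  obtain v \<tau> v' \<tau>' where zz: "z = (v, \<tau>)" "z' = (v', \<tau>')" by (metis prod.collapse)
  have d: "norm (v - v') \<le> d" "\<bar>\<tau> - \<tau>'\<bar> \<le> d"
    using norm_fst_le[of "v - v'" "\<tau> - \<tau>'"] norm_snd_le[of "\<tau> - \<tau>'" "v - v'"] by (simp_all add: zz d_def)
  have n: "norm (v - e) \<le> \<kappa>" "\<bar>\<tau> - \<tau>0\<bar> \<le> \<kappa>" "norm (v' - e) \<le> \<kappa>" "\<bar>\<tau>' - \<tau>0\<bar> \<le> \<kappa>"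
    using z by (auto simp: near_def zz)
  note lip = newton_components_Lipschitz[OF K1 K_cos K_\<mu> K_W K_W' K_\<beta> flow energy r_pos r_le \<kappa>_pos \<kappa>_le e n d]
  have "norm (newton_step p r e z - newton_step p r e z') \<le> (2 + real (card B)) * (K\<^sup>2 * (3 * \<kappa> + 3 * \<eta>) * d)"
    unfolding newton_step_def zz fst_conv snd_conv by (rule norm_newton_diff[OF e(2) lip(1,2,3)])
  also have "\<dots> = ((2 + real (card B)) * (K\<^sup>2 * (3 * \<kappa> + 3 * \<eta>))) * d" by simp
  also have "\<dots> \<le> 1/8 * d" by (intro mult_right_mono small_contraction) (simp add: d_def)
  finally show ?thesis by (simp add: d_def)
qed

text \<open>The linear motion starting at \<open>e\<close> satisfies all equations exactly at time
  \<open>\<tau>0\<close>, so the centre is displaced by nonlinear error only.\<close>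

lemma newton_center:
  assumes e: "e \<in> VV" "norm e = 1"
  shows "norm (newton_step p r e (e, \<tau>0) - (e, \<tau>0)) \<le> \<kappa> / 4"
proof -
  have near: "near e (e, \<tau>0)" using \<kappa>_pos by (simp add: near_def)
  have re: "r *\<^sub>R e \<in> cball 0 \<delta>" using near_props(2)[OF near e(2)] by simp
  have z: "(0::'a) \<in> cball 0 \<delta>" using flow_dataD(2)[OF flow] by simp
  have t: "\<tau>0 \<in> {0..L}" using near_props(3)[OF near e(2)] by simp
  define E where "E = p (r *\<^sub>R e) \<tau>0 - Cf' \<tau>0 (r *\<^sub>R e)"
  have E: "norm E \<le> \<eta> * r" using flow_error(2)[OF flow re t] e r_pos by (simp add: E_def)
  have sin0: "sin (\<beta> * \<tau>0) = 0" using \<beta>_pos by (simp add: \<tau>0_def)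
  have bound: "\<bar>E \<bullet> x / (r * y)\<bar> \<le> \<eta> * K" if "norm x = 1" "1 / \<bar>y\<bar> \<le> K" for x y
  proof -
    have "\<bar>E \<bullet> x / (r * y)\<bar> = \<bar>E \<bullet> x\<bar> / (r * \<bar>y\<bar>)" using r_pos by (simp add: abs_mult)
    also have "\<dots> \<le> (\<eta> * r) / (r * \<bar>y\<bar>)"
      using E Cauchy_Schwarz_ineq2[of E x] that r_pos by (intro divide_right_mono) auto
    also have "\<dots> = \<eta> * (1 / \<bar>y\<bar>)" using r_pos by simp
    also have "\<dots> \<le> \<eta> * K" using that \<eta>_pos by (intro mult_left_mono) auto
    finally show ?thesis .
  qed
  have "(diag \<mu> (r *\<^sub>R e) \<bullet> (r *\<^sub>R e)) = r\<^sup>2 * \<beta>\<^sup>2"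
    using e diag_VV[OF e(1), of \<mu> "\<beta>\<^sup>2"] by (simp add: diag_scaleR norm_eq_1 power2_eq_square)
  then have "\<bar>U (r *\<^sub>R e) - 1/2 * (r\<^sup>2 * \<beta>\<^sup>2) - U 0\<bar> \<le> \<eta> * r * r"
    using energy[unfolded energy_data_def, rule_format, OF re z] e r_pos by (simp add: max_def)
  then have "\<bar>(U (r *\<^sub>R e) - 1/2 * (r\<^sup>2 * \<beta>\<^sup>2) - U 0) / r\<^sup>2\<bar> \<le> \<eta>"
    using r_pos by (simp add: power2_eq_square divide_le_eq)
  moreover have "En r e = (U (r *\<^sub>R e) - 1/2 * (r\<^sup>2 * \<beta>\<^sup>2) - U 0) / r\<^sup>2"
    using r_pos by (simp add: En_def field_simps)
  ultimately have En: "\<bar>En r e\<bar> \<le> \<eta>" by simp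
  have a: "\<bar>(e \<bullet> e - En r e / \<beta>\<^sup>2) - 1\<bar> \<le> \<eta> * K"
  proof -
    have "\<bar>(e \<bullet> e - En r e / \<beta>\<^sup>2) - 1\<bar> = \<bar>En r e\<bar> * (1 / \<beta>\<^sup>2)" using e by (simp add: norm_eq_1)
    also have "\<dots> \<le> \<eta> * K" using En K_\<beta> \<eta>_pos by (intro mult_mono) auto
    finally show ?thesis .
  qed
  have w: "\<bar>wcoef p r b (e, \<tau>0) - 0\<bar> \<le> \<eta> * K" if b: "b \<in> BW" for b
  proof -
    have "p (r *\<^sub>R e) \<tau>0 \<bullet> b = E \<bullet> b"
      using b VV_orth[OF e(1) b] by (simp add: E_def Cf'_def inner_diff_left BW_def)
    then have "wcoef p r b (e, \<tau>0) = E \<bullet> b / (r * (\<mu> b * lin_sin (\<mu> b) \<tau>0))"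
      using VV_orth[OF e(1) b] by (simp add: wcoef_def)
    then show ?thesis using bound[of b "\<mu> b * lin_sin (\<mu> b) \<tau>0"] K_W[OF b] norm_B b by (simp add: BW_def)
  qed
  have "p (r *\<^sub>R e) \<tau>0 \<bullet> e = E \<bullet> e"
    by (simp add: E_def inner_diff_left inner_Cf'_VV[OF e(1)] sin0)
  then have t: "\<bar>(\<tau>0 - (p (r *\<^sub>R e) \<tau>0 \<bullet> e) / (r * \<beta>\<^sup>2)) - \<tau>0\<bar> \<le> \<eta> * K"
    using bound[of e "\<beta>\<^sup>2"] e K_\<beta> by simp
  have "norm (newton_step p r e (e, \<tau>0) - (1 *\<^sub>R e + (\<Sum>b\<in>BW. 0 *\<^sub>R b), \<tau>0)) \<le> (2 + real (card B)) * (\<eta> * K)"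
    unfolding newton_step_def fst_conv snd_conv by (rule norm_newton_diff[OF e(2) a w t])
  then show ?thesis using small_center by simp
qed

text \<open>The radius is half of the one in \<open>near\<close>, so that a solution for
  \<open>e'\<close> still lies in the contraction region of every \<open>e\<close> at distance at
  most \<open>\<kappa> / 2\<close>.\<close>

definition solves :: "'a \<Rightarrow> 'a \<times> real \<Rightarrow> bool" where
  "solves e z \<longleftrightarrow> norm (fst z - e) \<le> \<kappa> / 2 \<and> \<bar>snd z - \<tau>0\<bar> \<le> \<kappa> / 2 \<and> newton_step p r e z = z"

lemma solves_exists:
  assumes e: "e \<in> VV" "norm e = 1"
  shows "\<exists>z. solves e z"
proof -
  define D where "D = cball e (\<kappa>/2) \<times> cball \<tau>0 (\<kappa>/2)"
  have D: "z \<in> D \<longleftrightarrow> norm (fst z - e) \<le> \<kappa> / 2 \<and> \<bar>snd z - \<tau>0\<bar> \<le> \<kappa> / 2" for z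
    by (cases z) (auto simp: D_def dist_norm norm_minus_commute abs_minus_commute)
  have near: "near e z" if "z \<in> D" for z using that \<kappa>_pos by (auto simp: D near_def)
  have "\<exists>!z\<in>D. newton_step p r e z = z"
  proof (rule Banach_fix[where c="1/8"])
    show "complete D" unfolding D_def complete_eq_closed by (intro closed_Times closed_cball)
    show "D \<noteq> {}" using \<kappa>_pos by (auto simp: D_def)
    show "newton_step p r e ` D \<subseteq> D"
    proof (rule image_subsetI)
      fix z assume z: "z \<in> D"
      have "norm (z - (e, \<tau>0)) \<le> norm (fst z - e) + norm (snd z - \<tau>0)"
        using norm_Pair_le[of "fst z - e" "snd z - \<tau>0"] by (cases z) simp
      also have "\<dots> \<le> \<kappa>" using z by (simp add: D)
      finally have "norm (newton_step p r e z - newton_step p r e (e, \<tau>0)) \<le> 1/8 * \<kappa>"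
        using newton_contraction[OF e near[OF z], of "(e, \<tau>0)"] \<kappa>_pos by (simp add: near_def)
      \<comment> \<open>An eighth of \<kappa> from the contraction and a quarter from the displaced
        centre stay below one half.\<close>
      then have "norm (newton_step p r e z - (e, \<tau>0)) \<le> \<kappa> / 2"
        using norm_diff_triangle_le[OF _ newton_center[OF e]] \<kappa>_pos by fastforce
      then have "norm (fst (newton_step p r e z - (e, \<tau>0))) \<le> \<kappa>/2" "norm (snd (newton_step p r e z - (e, \<tau>0))) \<le> \<kappa>/2"
        using norm_fst_le[of "fst (newton_step p r e z - (e, \<tau>0))" "snd (newton_step p r e z - (e, \<tau>0))"]
          norm_snd_le[of "snd (newton_step p r e z - (e, \<tau>0))" "fst (newton_step p r e z - (e, \<tau>0))"]
        unfolding prod.collapse by linarith+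
      then show "newton_step p r e z \<in> D" by (simp add: D)
    qed
    show "dist (newton_step p r e z) (newton_step p r e z') \<le> 1/8 * dist z z'" if "z \<in> D" "z' \<in> D" for z z'
      using newton_contraction[OF e near near] that by (simp add: dist_norm)
  qed auto
  then show ?thesis unfolding solves_def D by blast
qed

lemma solves_near: "solves e z \<Longrightarrow> near e z"
  using \<kappa>_pos by (auto simp: solves_def near_def)

text \<open>At a fixed point every coordinate equals itself plus a nonzero multiple of its equation,
  so the equations hold. The coordinates that the Newton step never produces, along the kernel and
  along \<open>V\<close> orthogonally to \<open>e\<close>, are zero.\<close>

lemma solves_equations:
  assumes e: "e \<in> VV" "norm e = 1" and s: "solves e (v, \<tau>)"
  shows "U (r *\<^sub>R v) - U 0 = r\<^sup>2 * \<beta>\<^sup>2 / 2" "En r v = 0"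
    "b \<in> BW \<Longrightarrow> p (r *\<^sub>R v) \<tau> \<bullet> b = 0" "p (r *\<^sub>R v) \<tau> \<bullet> e = 0"
    "b \<in> B \<Longrightarrow> \<mu> b = 0 \<Longrightarrow> v \<bullet> b = 0" "f \<in> VV \<Longrightarrow> f \<bullet> e = 0 \<Longrightarrow> v \<bullet> f = 0"
proof -
  define a where "a = v \<bullet> e - En r v / \<beta>\<^sup>2"
  define w where "w = (\<lambda>b. wcoef p r b (v, \<tau>))"
  have v: "v = a *\<^sub>R e + (\<Sum>b\<in>BW. w b *\<^sub>R b)"
    and t: "(p (r *\<^sub>R v) \<tau> \<bullet> e) / (r * \<beta>\<^sup>2) = 0"
    using s by (auto simp: solves_def newton_step_def a_def w_def)
  show "p (r *\<^sub>R v) \<tau> \<bullet> e = 0" using t r_pos \<beta>_pos by simp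
  have inner: "v \<bullet> x = a * (e \<bullet> x) + (\<Sum>b\<in>BW. w b * (b \<bullet> x))" for x
    by (subst v) (simp add: inner_add_left inner_sum_left)
  have "v \<bullet> e = a"
  proof -
    have "b \<bullet> e = 0" if "b \<in> BW" for b using VV_orth[OF e(1) that] by (simp add: inner_commute)
    then show ?thesis using e(2) inner[of e] by (simp add: norm_eq_1)
  qed
  then show En: "En r v = 0" using \<beta>_pos by (simp add: a_def)
  then show "U (r *\<^sub>R v) - U 0 = r\<^sup>2 * \<beta>\<^sup>2 / 2" using r_pos by (simp add: En_def field_simps)
  show "v \<bullet> b = 0" if "b \<in> B" "\<mu> b = 0"
  proof -
    have "e \<bullet> b = 0" using e that \<beta>_pos by (auto simp: VV_def)
    moreover have "c \<bullet> b = 0" if "c \<in> BW" for c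
      using that \<open>b \<in> B\<close> \<open>\<mu> b = 0\<close> inner_B[of c b] by (auto simp: BW_def)
    ultimately show ?thesis by (simp add: inner)
  qed
  show "v \<bullet> f = 0" if "f \<in> VV" "f \<bullet> e = 0"
  proof -
    have "b \<bullet> f = 0" if "b \<in> BW" for b using VV_orth[OF \<open>f \<in> VV\<close> that] by (simp add: inner_commute)
    then show ?thesis using that inner[of f] by (simp add: inner_commute[of e f])
  qed
  show "p (r *\<^sub>R v) \<tau> \<bullet> b = 0" if b: "b \<in> BW"
  proof -
    have bB: "b \<in> B" using b by (simp add: BW_def)
    have "v \<bullet> b = (\<Sum>c\<in>BW. if c = b then w b else 0)"
      unfolding inner VV_orth[OF e(1) b] using bB by (auto intro!: sum.cong simp: inner_B BW_def)
    then have "v \<bullet> b = w b" using b finite_BW by simp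
    then have "(p (r *\<^sub>R v) \<tau> \<bullet> b) / (r * (\<mu> b * lin_sin (\<mu> b) \<tau>0)) = 0" by (simp add: w_def wcoef_def)
    moreover have "\<mu> b \<noteq> 0" "lin_sin (\<mu> b) \<tau>0 \<noteq> 0"
      using b nonresonant[of b] by (auto simp: BW_def \<tau>0_def)
    ultimately show ?thesis using r_pos by simp
  qed
qed

definition "Ke = 16 + 8 * K\<^sup>2"

text \<open>Fixed points of a uniform contraction inherit the Lipschitz dependence of the map on its
  parameter. The two maps are compared at the same point \<open>z'\<close>; the contraction factor
  1/8 then costs a factor below 2.\<close>

lemma solves_Lipschitz:
  assumes e: "e \<in> VV" "norm e = 1" "e' \<in> VV" "norm e' = 1" and s: "solves e z" "solves e' z'"
    and d: "norm (e - e') \<le> \<kappa> / 2"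
  shows "norm (z - z') \<le> Ke * norm (e - e')"
proof -
  obtain v \<tau> where z': "z' = (v, \<tau>)" by (metis prod.collapse)
  have ne: "near e z'"
    using s(2) d norm_diff_triangle_le[of v e' "\<kappa>/2" e "\<kappa>/2"] \<kappa>_pos
    by (auto simp: solves_def near_def z' norm_minus_commute)
  note nb = near_props[OF solves_near[OF s(2)] e(4), unfolded z' fst_conv snd_conv]
  have "norm (p (r *\<^sub>R v) \<tau> - Cf' \<tau> (r *\<^sub>R v)) \<le> \<eta> * (r * norm v)"
    using flow_error(2)[OF flow nb(2,3)] r_pos by simp
  moreover have "norm (Cf' \<tau> (r *\<^sub>R v)) \<le> K * norm (r *\<^sub>R v)"
    unfolding Cf'_def using K_sin nb(3) by (intro diag_bound) auto
  moreover have "norm (p (r *\<^sub>R v) \<tau>) \<le> norm (p (r *\<^sub>R v) \<tau> - Cf' \<tau> (r *\<^sub>R v)) + norm (Cf' \<tau> (r *\<^sub>R v))"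
    using norm_triangle_ineq[of "p (r *\<^sub>R v) \<tau> - Cf' \<tau> (r *\<^sub>R v)" "Cf' \<tau> (r *\<^sub>R v)"] by simp
  ultimately have "norm (p (r *\<^sub>R v) \<tau>) \<le> (\<eta> + K) * (r * norm v)" using r_pos by (simp add: algebra_simps)
  also have "\<dots> \<le> (K + K) * (r * 2)"
  proof (intro mult_mono add_mono)
    have "\<eta> * 1 \<le> \<eta> * K" using \<eta>_pos K1 by (intro mult_left_mono) auto
    also have "\<dots> \<le> (2 + real (card B)) * (\<eta> * K)"
      using mult_right_mono[of 1 "2 + real (card B)" "\<eta> * K"] \<eta>_pos K1 by simp
    finally show "\<eta> \<le> K" using small_center \<kappa>_le K1 by linarith
  qed (use nb r_pos K1 in auto)
  finally have p: "norm (p (r *\<^sub>R v) \<tau>) \<le> 4 * K * r" by simp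
  \<comment> \<open>As \<open>z'\<close> solves the problem for \<open>e'\<close>, the energy term
    drops out of both maps. The coefficients along \<open>BW\<close> do not involve
    \<open>e\<close>, so only the projection onto \<open>e\<close> and the velocity along
    \<open>e\<close> remain.\<close>
  have En: "En r v = 0" using solves_equations(2)[OF e(3,4)] s(2) z' by blast
  have "norm (newton_step p r e z' - newton_step p r e' z') =
      norm ((v \<bullet> e) *\<^sub>R e - (v \<bullet> e') *\<^sub>R e', (p (r *\<^sub>R v) \<tau> \<bullet> (e' - e)) / (r * \<beta>\<^sup>2))"
    by (simp add: newton_step_def z' En inner_diff_right diff_divide_distrib)
  also have "\<dots> \<le> norm ((v \<bullet> e) *\<^sub>R e - (v \<bullet> e') *\<^sub>R e') + norm ((p (r *\<^sub>R v) \<tau> \<bullet> (e' - e)) / (r * \<beta>\<^sup>2))"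
    by (rule norm_Pair_le)
  also have "\<dots> \<le> 4 * norm (e - e') + 4 * K\<^sup>2 * norm (e - e')"
  proof (rule add_mono)
    have "(v \<bullet> e) *\<^sub>R e - (v \<bullet> e') *\<^sub>R e' = (v \<bullet> e) *\<^sub>R (e - e') + (v \<bullet> (e - e')) *\<^sub>R e'"
      by (simp add: inner_diff_right algebra_simps)
    then have "norm ((v \<bullet> e) *\<^sub>R e - (v \<bullet> e') *\<^sub>R e') \<le> \<bar>v \<bullet> e\<bar> * norm (e - e') + \<bar>v \<bullet> (e - e')\<bar>"
      using norm_triangle_ineq[of "(v \<bullet> e) *\<^sub>R (e - e')" "(v \<bullet> (e - e')) *\<^sub>R e'"] e by simp
    also have "\<dots> \<le> 2 * norm (e - e') + 2 * norm (e - e')"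
    proof (intro add_mono mult_right_mono)
      show "\<bar>v \<bullet> e\<bar> \<le> 2" using Cauchy_Schwarz_ineq2[of v e] nb(1) e by simp
      show "\<bar>v \<bullet> (e - e')\<bar> \<le> 2 * norm (e - e')"
        using Cauchy_Schwarz_ineq2[of v "e - e'"] mult_right_mono[OF nb(1) norm_ge_zero[of "e - e'"]] by linarith
    qed auto
    finally show "norm ((v \<bullet> e) *\<^sub>R e - (v \<bullet> e') *\<^sub>R e') \<le> 4 * norm (e - e')" by simp
    have "norm ((p (r *\<^sub>R v) \<tau> \<bullet> (e' - e)) / (r * \<beta>\<^sup>2)) = \<bar>p (r *\<^sub>R v) \<tau> \<bullet> (e' - e)\<bar> / (r * \<beta>\<^sup>2)"
      using r_pos by simp
    also have "\<dots> \<le> (4 * K * r * norm (e - e')) / (r * \<beta>\<^sup>2)"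
      using Cauchy_Schwarz_ineq2[of "p (r *\<^sub>R v) \<tau>" "e' - e"] mult_right_mono[OF p norm_ge_zero[of "e - e'"]] r_pos
      by (intro divide_right_mono) (auto simp: norm_minus_commute)
    also have "\<dots> = 4 * K * norm (e - e') * (1 / \<beta>\<^sup>2)" using r_pos by simp
    also have "\<dots> \<le> 4 * K * norm (e - e') * K" using K1 K_\<beta> by (intro mult_left_mono) auto
    finally show "norm ((p (r *\<^sub>R v) \<tau> \<bullet> (e' - e)) / (r * \<beta>\<^sup>2)) \<le> 4 * K\<^sup>2 * norm (e - e')"
      by (simp add: power2_eq_square mult_ac)
  qed
  finally have 1: "norm (newton_step p r e z' - newton_step p r e' z') \<le> (4 + 4 * K\<^sup>2) * norm (e - e')"
    by (simp add: algebra_simps)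
  have "norm (z - z') = norm (newton_step p r e z - newton_step p r e' z')" using s by (simp add: solves_def)
  also have "\<dots> \<le> norm (newton_step p r e z - newton_step p r e z') + norm (newton_step p r e z' - newton_step p r e' z')"
    using norm_triangle_ineq[of "newton_step p r e z - newton_step p r e z'" "newton_step p r e z' - newton_step p r e' z'"] by simp
  also have "\<dots> \<le> 1/8 * norm (z - z') + (4 + 4 * K\<^sup>2) * norm (e - e')"
    by (intro add_mono 1 newton_contraction[OF e(1,2) solves_near[OF s(1)] ne])
  finally have "norm (z - z') \<le> 2 * ((4 + 4 * K\<^sup>2) * norm (e - e'))" using norm_ge_zero[of "z - z'"] by linarith
  also have "\<dots> \<le> Ke * norm (e - e')"
    unfolding mult.assoc[symmetric] Ke_def by (intro mult_right_mono) (auto simp: algebra_simps)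
  finally show ?thesis .
qed

end

section \<open>The action functional\<close>

context center begin

lemma energy_conservation:
  assumes fd: "flow_data \<eta> \<rho> \<delta> u p" and \<rho>: "\<rho> < \<rho>0" and \<xi>: "\<xi> \<in> cball 0 \<delta>" and t: "t \<in> {0..L}"
  shows "1/2 * (p \<xi> t \<bullet> p \<xi> t) + U (u \<xi> t) = U \<xi>"
proof -
  let ?h = "\<lambda>t. 1/2 * (p \<xi> t \<bullet> p \<xi> t) + U (u \<xi> t)"
  have 0: "0 \<in> {0..L}" using L_pos by simp
  have D: "(?h has_vector_derivative 0) (at s within {0..L})" if s: "s \<in> {0..L}" for s
  proof -
    have "u \<xi> s \<in> ball 0 \<rho>0" using flow_dataD(5)[OF fd \<xi> s] \<rho> by simp
    from has_derivative_at_withinI[OF U_deriv[OF this]]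
    have "((U \<circ> u \<xi>) has_derivative (\<lambda>h. g (u \<xi> s) \<bullet> h) \<circ> (\<lambda>h. h *\<^sub>R p \<xi> s)) (at s within {0..L})"
      using flow_dataD(6)[OF fd \<xi> s] unfolding has_vector_derivative_def
      by (intro diff_chain_within)
    then have U: "((\<lambda>t. U (u \<xi> t)) has_vector_derivative g (u \<xi> s) \<bullet> p \<xi> s) (at s within {0..L})"
      by (simp add: has_vector_derivative_def o_def)
    have "(p \<xi> has_derivative (\<lambda>h. h *\<^sub>R (- g (u \<xi> s)))) (at s within {0..L})"
      using flow_dataD(7)[OF fd \<xi> s] unfolding has_vector_derivative_def .
    from has_derivative_mult_right[OF has_derivative_inner[OF this this], of "1/2"]
    have "((\<lambda>t. 1/2 * (p \<xi> t \<bullet> p \<xi> t)) has_vector_derivative - (g (u \<xi> s) \<bullet> p \<xi> s)) (at s within {0..L})"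
      by (simp add: has_vector_derivative_def inner_commute algebra_simps)
    from has_vector_derivative_add[OF this U] show ?thesis by simp
  qed
  have "norm (?h t - ?h 0) \<le> 0 * norm (t - 0)"
    by (rule vector_differentiable_bound_real[OF D _ t 0]) auto
  then show ?thesis using flow_dataD(3,4)[OF fd \<xi>] by simp
qed

lemma potential_quadratic_bound:
  assumes M: "\<And>x y. x \<in> cball 0 \<rho> \<Longrightarrow> y \<in> cball 0 \<rho> \<Longrightarrow> norm (g x - g y) \<le> M * norm (x - y)" "M \<ge> 0"
    and \<rho>: "\<rho> < \<rho>0" and x: "x \<in> cball 0 \<rho>" "y \<in> cball 0 \<rho>"
  shows "\<bar>U y - U x - g x \<bullet> (y - x)\<bar> \<le> M * (norm (y - x))\<^sup>2"
proof -
  have seg: "closed_segment x y \<subseteq> cball 0 \<rho>" by (rule closed_segment_subset[OF x convex_cball])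
  have D: "((\<lambda>w. U w - g x \<bullet> w) has_derivative (\<lambda>h. (g w - g x) \<bullet> h)) (at w within closed_segment x y)"
    if "w \<in> closed_segment x y" for w
  proof -
    have "(U has_derivative (\<lambda>h. g w \<bullet> h)) (at w within closed_segment x y)"
    proof (rule has_derivative_at_withinI[OF U_deriv])
      show "w \<in> ball 0 \<rho>0" using subsetD[OF seg that] \<rho> by simp
    qed
    from has_derivative_diff[OF this has_derivative_inner_right[OF has_derivative_ident], of "g x"]
    show ?thesis by (simp add: inner_diff_left)
  qed
  have "norm ((U y - g x \<bullet> y) - (U x - g x \<bullet> x)) \<le> (M * norm (y - x)) * norm (y - x)"
  proof (rule differentiable_bound[OF _ D])
    fix w assume w: "w \<in> closed_segment x y"
    have "norm (g w - g x) \<le> M * norm (w - x)" using w seg x by (intro M) auto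
    also have "\<dots> \<le> M * norm (y - x)"
      using segment_bound(1)[OF w] M(2) by (intro mult_left_mono) auto
    finally have "norm (g w - g x) \<le> M * norm (y - x)" .
    then show "onorm (\<lambda>h. (g w - g x) \<bullet> h) \<le> M * norm (y - x)"
      by (rule onorm_inner_le)
  qed auto
  then show ?thesis by (simp add: inner_diff_right power2_eq_square algebra_simps)
qed

definition action :: "('a \<Rightarrow> real \<Rightarrow> 'a) \<Rightarrow> 'a \<Rightarrow> real \<Rightarrow> real" where
  "action p \<xi> t = integral {0..t} (\<lambda>s. p \<xi> s \<bullet> p \<xi> s)"

text \<open>At fixed energy the action has first variation \<open>p \<xi> \<tau> \<bullet> \<delta>y\<close>, with \<open>y\<close> the end point.\<close>

lemma action_variation:
  assumes fd: "flow_data \<eta> \<rho> \<delta> u p" and \<rho>: "\<rho> < \<rho>0" "\<rho> \<ge> 0"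
    and M: "\<And>x y. x \<in> cball 0 \<rho> \<Longrightarrow> y \<in> cball 0 \<rho> \<Longrightarrow> norm (g x - g y) \<le> M * norm (x - y)" "M \<ge> 0"
    and \<xi>: "\<xi> \<in> cball 0 \<delta>" "\<xi>' \<in> cball 0 \<delta>" "U \<xi> = U \<xi>'" and \<tau>: "\<tau> \<in> {0..L}" "\<tau>' \<in> {0..L}"
    and a: "\<And>t. t \<in> {0..L} \<Longrightarrow> norm (u \<xi>' t - u \<xi> t) \<le> a" "\<And>t. t \<in> {0..L} \<Longrightarrow> norm (p \<xi>' t - p \<xi> t) \<le> a" "\<bar>\<tau>' - \<tau>\<bar> \<le> a"
  shows "\<bar>action p \<xi>' \<tau>' - action p \<xi> \<tau> - p \<xi> \<tau> \<bullet> (u \<xi>' \<tau>' - u \<xi> \<tau>)\<bar>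
      \<le> (L * (1/2 + M) + (M * \<rho> + 1) * (M * \<rho> * L)) * a\<^sup>2"
    and "norm (u \<xi>' \<tau>' - u \<xi> \<tau>) \<le> (M * \<rho> * L + 1) * a"
proof -
  have 0: "0 \<in> {0..L}" using L_pos by simp
  have a0: "a \<ge> 0" using a(3) by linarith
  have pc: "continuous_on {0..L} (p \<zeta>)" if "\<zeta> \<in> cball 0 \<delta>" for \<zeta>
    using flow_dataD(7)[OF fd that] by (rule continuous_on_vector_derivative)
  have dw: "(action p \<zeta> has_vector_derivative p \<zeta> t \<bullet> p \<zeta> t) (at t within {0..L})"
    if "\<zeta> \<in> cball 0 \<delta>" "t \<in> {0..L}" for \<zeta> t
    unfolding action_def by (intro integral_has_vector_derivative continuous_intros pc that)
  have in_ball: "u \<zeta> t \<in> cball 0 \<rho>" if "\<zeta> \<in> cball 0 \<delta>" "t \<in> {0..L}" for \<zeta> t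
    using flow_dataD(5)[OF fd that] by simp
  have gb: "norm (g x) \<le> M * \<rho>" if "x \<in> cball 0 \<rho>" for x
  proof -
    have "norm (g x - g 0) \<le> M * norm (x - 0)" using that \<rho> by (intro M) auto
    also have "\<dots> \<le> M * \<rho>" using that M(2) by (intro mult_left_mono) auto
    finally show ?thesis by (simp add: g_zero)
  qed
  have p_lip: "norm (p \<zeta> s - p \<zeta> t) \<le> M * \<rho> * norm (s - t)" if "\<zeta> \<in> cball 0 \<delta>" "s \<in> {0..L}" "t \<in> {0..L}" for \<zeta> s t
    by (rule vector_differentiable_bound_real[OF flow_dataD(7)[OF fd that(1)] _ that(2,3)], assumption)
      (simp only: norm_minus_cancel, rule gb[OF in_ball[OF that(1)]])
  have p_bd: "norm (p \<zeta> t) \<le> M * \<rho> * L" if "\<zeta> \<in> cball 0 \<delta>" "t \<in> {0..L}" for \<zeta> t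
  proof -
    have "norm (p \<zeta> t - p \<zeta> 0) \<le> M * \<rho> * norm (t - 0)" by (rule p_lip[OF that 0])
    also have "\<dots> \<le> M * \<rho> * L" using that M(2) \<rho> by (intro mult_left_mono) auto
    finally show ?thesis by (simp add: flow_dataD(4)[OF fd that(1)])
  qed
  have u_lip: "norm (u \<zeta> s - u \<zeta> t) \<le> M * \<rho> * L * norm (s - t)" if "\<zeta> \<in> cball 0 \<delta>" "s \<in> {0..L}" "t \<in> {0..L}" for \<zeta> s t
    by (rule vector_differentiable_bound_real[OF flow_dataD(6)[OF fd that(1)] p_bd[OF that(1)] that(2,3)])
  show "norm (u \<xi>' \<tau>' - u \<xi> \<tau>) \<le> (M * \<rho> * L + 1) * a"
  proof -
    have "norm (u \<xi>' \<tau>' - u \<xi>' \<tau>) \<le> M * \<rho> * L * norm (\<tau>' - \<tau>)" by (rule u_lip[OF \<xi>(2) \<tau>(2,1)])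
    also have "\<dots> \<le> M * \<rho> * L * a" using a(3) M(2) \<rho> L_pos by (intro mult_left_mono) auto
    finally have "norm (u \<xi>' \<tau>' - u \<xi> \<tau>) \<le> M * \<rho> * L * a + a"
      by (rule norm_diff_triangle_le) (rule a(1)[OF \<tau>(1)])
    then show ?thesis by (simp add: algebra_simps)
  qed
  \<comment> \<open>The defect of the variation formula at a common time. Equality of the energies
    turns its derivative into half the squared velocity difference minus the first-order Taylor
    remainder of \<open>U\<close>, both quadratic in \<open>a\<close>.\<close>
  define D where "D = (\<lambda>t. action p \<xi>' t - action p \<xi> t - p \<xi> t \<bullet> (u \<xi>' t - u \<xi> t))"
  define D' where "D' = (\<lambda>t. 1/2 * (norm (p \<xi>' t - p \<xi> t))\<^sup>2 - (U (u \<xi>' t) - U (u \<xi> t) - g (u \<xi> t) \<bullet> (u \<xi>' t - u \<xi> t)))"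
  have DD: "(D has_vector_derivative D' t) (at t within {0..L})" if t: "t \<in> {0..L}" for t
  proof -
    have "((\<lambda>t. p \<xi> t \<bullet> (u \<xi>' t - u \<xi> t)) has_derivative
        (\<lambda>h. p \<xi> t \<bullet> (h *\<^sub>R p \<xi>' t - h *\<^sub>R p \<xi> t) + (h *\<^sub>R (- g (u \<xi> t))) \<bullet> (u \<xi>' t - u \<xi> t))) (at t within {0..L})"
      using flow_dataD(6)[OF fd \<xi>(1) t] flow_dataD(6)[OF fd \<xi>(2) t] flow_dataD(7)[OF fd \<xi>(1) t]
      unfolding has_vector_derivative_def by (intro has_derivative_inner has_derivative_diff)
    then have "((\<lambda>t. p \<xi> t \<bullet> (u \<xi>' t - u \<xi> t)) has_vector_derivative
        p \<xi> t \<bullet> (p \<xi>' t - p \<xi> t) - g (u \<xi> t) \<bullet> (u \<xi>' t - u \<xi> t)) (at t within {0..L})"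
      by (simp add: has_vector_derivative_def algebra_simps)
    from has_vector_derivative_diff[OF has_vector_derivative_diff[OF dw[OF \<xi>(2) t] dw[OF \<xi>(1) t]] this]
    have "(D has_vector_derivative (p \<xi>' t \<bullet> p \<xi>' t - p \<xi> t \<bullet> p \<xi> t -
        (p \<xi> t \<bullet> (p \<xi>' t - p \<xi> t) - g (u \<xi> t) \<bullet> (u \<xi>' t - u \<xi> t)))) (at t within {0..L})"
      unfolding D_def .
    moreover have exp: "(norm (p \<xi>' t - p \<xi> t))\<^sup>2 = p \<xi>' t \<bullet> p \<xi>' t - 2 * (p \<xi> t \<bullet> p \<xi>' t) + p \<xi> t \<bullet> p \<xi> t"
      by (simp add: power2_norm_eq_inner inner_diff_left inner_diff_right inner_commute)
    have alg: "a - c - (b - c - k) = 1/2 * (a - 2 * b + c) - (U2 - U1 - k)"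
      if "1/2 * c + U1 = E" "1/2 * a + U2 = E" for a b c k U1 U2 E :: real
      using that by (simp add: field_simps)
    have "p \<xi>' t \<bullet> p \<xi>' t - p \<xi> t \<bullet> p \<xi> t - (p \<xi> t \<bullet> (p \<xi>' t - p \<xi> t) - g (u \<xi> t) \<bullet> (u \<xi>' t - u \<xi> t)) = D' t"
      using energy_conservation[OF fd \<rho>(1) \<xi>(1) t] energy_conservation[OF fd \<rho>(1) \<xi>(2) t]
      unfolding D'_def exp inner_diff_right \<xi>(3) by (rule alg)
    ultimately show ?thesis by simp
  qed
  have D'b: "norm (D' t) \<le> (1/2 + M) * a\<^sup>2" if t: "t \<in> {0..L}" for t
  proof -
    have "\<bar>U (u \<xi>' t) - U (u \<xi> t) - g (u \<xi> t) \<bullet> (u \<xi>' t - u \<xi> t)\<bar> \<le> M * (norm (u \<xi>' t - u \<xi> t))\<^sup>2"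
      by (rule potential_quadratic_bound[OF M \<rho>(1) in_ball[OF \<xi>(1) t] in_ball[OF \<xi>(2) t]])
    also have "\<dots> \<le> M * a\<^sup>2" using a(1)[OF t] M(2) by (intro mult_left_mono power_mono) auto
    finally have 1: "\<bar>U (u \<xi>' t) - U (u \<xi> t) - g (u \<xi> t) \<bullet> (u \<xi>' t - u \<xi> t)\<bar> \<le> M * a\<^sup>2" .
    have 2: "(norm (p \<xi>' t - p \<xi> t))\<^sup>2 \<le> a\<^sup>2" using a(2)[OF t] by (intro power_mono) auto
    have "norm (D' t) \<le> 1/2 * a\<^sup>2 + M * a\<^sup>2"
      unfolding D'_def real_norm_def using 1 2 zero_le_power2[of "norm (p \<xi>' t - p \<xi> t)"] by linarith
    then show ?thesis by (simp add: algebra_simps)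
  qed
  have "norm (D \<tau> - D 0) \<le> (1/2 + M) * a\<^sup>2 * norm (\<tau> - 0)"
    by (rule vector_differentiable_bound_real[OF DD D'b \<tau>(1) 0])
  also have "\<dots> \<le> (1/2 + M) * a\<^sup>2 * L" using \<tau> M(2) by (intro mult_left_mono) auto
  finally have D\<tau>: "\<bar>D \<tau>\<bar> \<le> L * (1/2 + M) * a\<^sup>2"
    using flow_dataD(4)[OF fd \<xi>(1)] by (simp add: D_def action_def mult_ac)
  \<comment> \<open>The change of the end time is separated off: along the second solution the
    derivative of \<open>G\<close> is the velocity paired with a velocity difference of order
    \<open>a\<close>, and the time interval has length at most \<open>a\<close>.\<close>
  define G where "G = (\<lambda>t. action p \<xi>' t - p \<xi> \<tau> \<bullet> u \<xi>' t)"
  define J where "J = {min \<tau> \<tau>'..max \<tau> \<tau>'}"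
  have J: "J \<subseteq> {0..L}" "\<tau> \<in> J" "\<tau>' \<in> J" using \<tau> by (auto simp: J_def)
  have DG: "(G has_vector_derivative (p \<xi>' t - p \<xi> \<tau>) \<bullet> p \<xi>' t) (at t within J)" if t: "t \<in> J" for t
  proof -
    have t': "t \<in> {0..L}" using t J by auto
    have "((\<lambda>t. p \<xi> \<tau> \<bullet> u \<xi>' t) has_vector_derivative p \<xi> \<tau> \<bullet> p \<xi>' t) (at t within {0..L})"
      using bounded_linear.has_vector_derivative[OF bounded_linear_inner_right flow_dataD(6)[OF fd \<xi>(2) t']] .
    from has_vector_derivative_diff[OF dw[OF \<xi>(2) t'] this]
    have "(G has_vector_derivative (p \<xi>' t - p \<xi> \<tau>) \<bullet> p \<xi>' t) (at t within {0..L})"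
      by (simp add: G_def inner_diff_left)
    then show ?thesis using J(1) by (rule has_vector_derivative_within_subset)
  qed
  have Gb: "norm ((p \<xi>' t - p \<xi> \<tau>) \<bullet> p \<xi>' t) \<le> ((M * \<rho> + 1) * a) * (M * \<rho> * L)" if t: "t \<in> J" for t
  proof -
    have t': "t \<in> {0..L}" using t J by auto
    have "norm (p \<xi>' t - p \<xi>' \<tau>) \<le> M * \<rho> * norm (t - \<tau>)" by (rule p_lip[OF \<xi>(2) t' \<tau>(1)])
    also have "\<dots> \<le> M * \<rho> * a" using t a(3) M(2) \<rho> by (intro mult_left_mono) (auto simp: J_def)
    finally have "norm (p \<xi>' t - p \<xi> \<tau>) \<le> M * \<rho> * a + a"
      by (rule norm_diff_triangle_le) (rule a(2)[OF \<tau>(1)])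
    then have 1: "norm (p \<xi>' t - p \<xi> \<tau>) \<le> (M * \<rho> + 1) * a" by (simp add: algebra_simps)
    have "norm ((p \<xi>' t - p \<xi> \<tau>) \<bullet> p \<xi>' t) \<le> norm (p \<xi>' t - p \<xi> \<tau>) * norm (p \<xi>' t)"
      using Cauchy_Schwarz_ineq2 by simp
    also have "\<dots> \<le> ((M * \<rho> + 1) * a) * (M * \<rho> * L)"
      using 1 p_bd[OF \<xi>(2) t'] M(2) \<rho> a0 by (intro mult_mono) auto
    finally show ?thesis .
  qed
  have "norm (G \<tau>' - G \<tau>) \<le> ((M * \<rho> + 1) * a) * (M * \<rho> * L) * norm (\<tau>' - \<tau>)"
    using DG Gb J(2,3) unfolding J_def by (intro vector_differentiable_bound_real[where a="min \<tau> \<tau>'" and b="max \<tau> \<tau>'"])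
  also have "\<dots> \<le> ((M * \<rho> + 1) * a) * (M * \<rho> * L) * a"
    using a(3) M(2) \<rho> L_pos a0 by (intro mult_left_mono) auto
  finally have G\<tau>: "\<bar>G \<tau>' - G \<tau>\<bar> \<le> (M * \<rho> + 1) * (M * \<rho> * L) * a\<^sup>2" by (simp add: power2_eq_square mult_ac)
  have "action p \<xi>' \<tau>' - action p \<xi> \<tau> - p \<xi> \<tau> \<bullet> (u \<xi>' \<tau>' - u \<xi> \<tau>) = D \<tau> + (G \<tau>' - G \<tau>)"
    by (simp add: D_def G_def inner_diff_right)
  then show "\<bar>action p \<xi>' \<tau>' - action p \<xi> \<tau> - p \<xi> \<tau> \<bullet> (u \<xi>' \<tau>' - u \<xi> \<tau>)\<bar>
      \<le> (L * (1/2 + M) + (M * \<rho> + 1) * (M * \<rho> * L)) * a\<^sup>2"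
    using D\<tau> G\<tau> abs_triangle_ineq[of "D \<tau>" "G \<tau>' - G \<tau>"] unfolding distrib_right by linarith
qed

end

text \<open>In \<open>symmetry_small\<close> the factor \<open>2 * card B + 1\<close> makes all
  kernel components of \<open>F\<close> together at most half of \<open>F\<close>. In
  \<open>small_variation\<close> the constant 192 is 6 times 32: it brings the nonlinear error in
  the displacement of the end point down to half of the main term in
  \<open>maximizer_stationary\<close>.\<close>

locale scaled_center_symmetric = scaled_center B \<mu> g U \<beta> \<rho>0 K \<eta> \<rho> \<delta> r \<kappa> u p
  for B :: "'a::euclidean_space set" and \<mu> g U \<beta> \<rho>0 K \<eta> \<rho> \<delta> r \<kappa> u p +
  fixes M :: real
  assumes M_nonneg: "M \<ge> 0"
    and g_Lipschitz: "\<And>x y. x \<in> cball 0 \<rho> \<Longrightarrow> y \<in> cball 0 \<rho> \<Longrightarrow> norm (g x - g y) \<le> M * norm (x - y)"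
    and small_variation: "192 * \<eta> * Ke \<le> 1"
    and symmetry_small: "\<And>b. b \<in> B \<Longrightarrow> \<mu> b = 0 \<Longrightarrow> \<exists>A. linear A \<and> (\<forall>x. A x \<bullet> x = 0) \<and>
      (\<forall>x\<in>ball 0 \<rho>0. g x \<bullet> (A x + b) = 0) \<and> (\<forall>x\<in>cball 0 \<rho>. (2 * real (card B) + 1) * norm (A x) \<le> 1)"
begin

definition SV :: "'a set" where "SV = {e \<in> VV. norm e = 1}"

definition sol :: "'a \<Rightarrow> 'a \<times> real" where "sol e = (SOME z. solves e z)"

abbreviation "v e \<equiv> fst (sol e)"
abbreviation "\<tau> e \<equiv> snd (sol e)"
abbreviation "F e \<equiv> p (r *\<^sub>R v e) (\<tau> e)"
abbreviation "y e \<equiv> u (r *\<^sub>R v e) (\<tau> e)"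
abbreviation "W e \<equiv> action p (r *\<^sub>R v e) (\<tau> e)"

lemma sol: "e \<in> SV \<Longrightarrow> solves e (v e, \<tau> e)"
  using someI_ex[OF solves_exists[of e]] by (simp add: SV_def sol_def)

lemma SV_D: "e \<in> SV \<Longrightarrow> e \<in> VV" "e \<in> SV \<Longrightarrow> norm e = 1" "e \<in> SV \<Longrightarrow> e \<bullet> e = 1"
  by (auto simp: SV_def norm_eq_1)

lemma sol_near:
  assumes "e \<in> SV"
  shows "norm (v e) \<le> 2" "r *\<^sub>R v e \<in> cball 0 \<delta>" "\<tau> e \<in> {0..L}" "norm (v e - e) \<le> \<kappa> / 2" "\<bar>\<tau> e - \<tau>0\<bar> \<le> \<kappa> / 2"
  using near_props[OF solves_near[OF sol[OF assms]] SV_D(2)[OF assms]] sol[OF assms] by (auto simp: solves_def)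

lemma sol_equations:
  assumes "e \<in> SV"
  shows "U (r *\<^sub>R v e) = U 0 + r\<^sup>2 * \<beta>\<^sup>2 / 2" "b \<in> BW \<Longrightarrow> F e \<bullet> b = 0" "F e \<bullet> e = 0"
    "b \<in> B \<Longrightarrow> \<mu> b = 0 \<Longrightarrow> v e \<bullet> b = 0" "f \<in> VV \<Longrightarrow> f \<bullet> e = 0 \<Longrightarrow> v e \<bullet> f = 0"
  using solves_equations[OF SV_D(1,2)[OF assms] sol[OF assms]] by auto

text \<open>One Lipschitz constant in \<open>e\<close> for positions, velocities and half-periods:
  \<open>K + \<eta>\<close> belongs to the flow, \<open>r * Ke\<close> to the initial position, and
  the last summand covers the half-period.\<close>

definition "Q = (K + \<eta>) * r * Ke + Ke"

lemma Ke_pos: "Ke > 0" and Q_pos: "Q > 0"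
proof -
  show "Ke > 0" unfolding Ke_def by (simp add: add_pos_nonneg)
  then show "Q > 0" using K1 \<eta>_pos r_pos by (simp add: Q_def add_nonneg_pos)
qed

lemma sol_Lipschitz:
  assumes e: "e \<in> SV" "e' \<in> SV" and d: "norm (e' - e) \<le> \<kappa> / 2"
  shows "norm (v e' - v e) \<le> Ke * norm (e' - e)" "\<bar>\<tau> e' - \<tau> e\<bar> \<le> Ke * norm (e' - e)"
    "\<bar>\<tau> e' - \<tau> e\<bar> \<le> Q * norm (e' - e)"
    "t \<in> {0..L} \<Longrightarrow> norm (u (r *\<^sub>R v e') t - u (r *\<^sub>R v e) t) \<le> Q * norm (e' - e)"
    "t \<in> {0..L} \<Longrightarrow> norm (p (r *\<^sub>R v e') t - p (r *\<^sub>R v e) t) \<le> Q * norm (e' - e)"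
proof -
  have s: "norm ((v e', \<tau> e') - (v e, \<tau> e)) \<le> Ke * norm (e' - e)"
    by (rule solves_Lipschitz[OF SV_D(1,2)[OF e(2)] SV_D(1,2)[OF e(1)] sol[OF e(2)] sol[OF e(1)] d])
  then show 1: "norm (v e' - v e) \<le> Ke * norm (e' - e)" and 2: "\<bar>\<tau> e' - \<tau> e\<bar> \<le> Ke * norm (e' - e)"
    using norm_fst_le[of "v e' - v e" "\<tau> e' - \<tau> e"] norm_snd_le[of "\<tau> e' - \<tau> e" "v e' - v e"]
    unfolding diff_Pair real_norm_def by linarith+
  have "Ke * norm (e' - e) \<le> Q * norm (e' - e)"
    using K1 \<eta>_pos r_pos Ke_pos by (intro mult_right_mono) (auto simp: Q_def)
  with 2 show "\<bar>\<tau> e' - \<tau> e\<bar> \<le> Q * norm (e' - e)" by linarith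
  have \<xi>: "norm (r *\<^sub>R v e' - r *\<^sub>R v e) \<le> r * (Ke * norm (e' - e))"
    using 1 r_pos by (simp flip: scaleR_diff_right)
  have C: "norm (Cf t x) \<le> K * norm x" "norm (Cf' t x) \<le> K * norm x" if "t \<in> {0..L}" for t x
    unfolding Cf_def Cf'_def using K_cos K_sin that by (auto intro!: diag_bound)
  have fin: "norm (a' - a) \<le> Q * norm (e' - e)"
    if "norm ((a' - c') - (a - c)) \<le> \<eta> * norm (r *\<^sub>R v e' - r *\<^sub>R v e)" "norm (c' - c) \<le> K * norm (r *\<^sub>R v e' - r *\<^sub>R v e)"
    for a a' c c' :: 'a
  proof -
    have "norm (a' - a) \<le> (K + \<eta>) * norm (r *\<^sub>R v e' - r *\<^sub>R v e)"
      using norm_triangle_ineq[of "(a' - c') - (a - c)" "c' - c"] that by (simp add: algebra_simps)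
    also have "\<dots> \<le> (K + \<eta>) * (r * (Ke * norm (e' - e)))" using \<xi> K1 \<eta>_pos by (intro mult_left_mono) auto
    also have "\<dots> \<le> Q * norm (e' - e)" using Ke_pos by (simp add: Q_def algebra_simps)
    finally show ?thesis .
  qed
  note nb = sol_near(2)[OF e(2)] sol_near(2)[OF e(1)]
  show "norm (u (r *\<^sub>R v e') t - u (r *\<^sub>R v e) t) \<le> Q * norm (e' - e)" if t: "t \<in> {0..L}"
    by (rule fin[OF flow_dataD(9)[OF flow nb t]]) (use C(1)[OF t] in \<open>simp flip: Cf_diff\<close>)
  show "norm (p (r *\<^sub>R v e') t - p (r *\<^sub>R v e) t) \<le> Q * norm (e' - e)" if t: "t \<in> {0..L}"
    by (rule fin[OF flow_dataD(10)[OF flow nb t]]) (use C(2)[OF t] in \<open>simp flip: Cf'_diff\<close>)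
qed

lemma \<rho>_nonneg: "\<rho> \<ge> 0"
proof -
  have "norm (u 0 0) \<le> \<rho>"
    using flow_dataD(2)[OF flow] L_pos by (intro flow_dataD(5)[OF flow]) auto
  then show ?thesis using norm_ge_zero[of "u 0 0"] by linarith
qed

definition "CW = (L * (1/2 + M) + (M * \<rho> + 1) * (M * \<rho> * L)) * Q\<^sup>2"
definition "Cy = (M * \<rho> * L + 1) * Q"

lemma W_variation:
  assumes e: "e \<in> SV" "e' \<in> SV" and d: "norm (e' - e) \<le> \<kappa> / 2"
  shows "\<bar>W e' - W e - F e \<bullet> (y e' - y e)\<bar> \<le> CW * (norm (e' - e))\<^sup>2"
    "norm (y e' - y e) \<le> Cy * norm (e' - e)"
proof -
  have U: "U (r *\<^sub>R v e) = U (r *\<^sub>R v e')" using sol_equations(1)[OF e(1)] sol_equations(1)[OF e(2)] by simp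
  note av = action_variation[OF flow \<rho>_less \<rho>_nonneg g_Lipschitz M_nonneg sol_near(2)[OF e(1)] sol_near(2)[OF e(2)] U
      sol_near(3)[OF e(1)] sol_near(3)[OF e(2)] sol_Lipschitz(4,5,3)[OF e d]]
  show "\<bar>W e' - W e - F e \<bullet> (y e' - y e)\<bar> \<le> CW * (norm (e' - e))\<^sup>2"
    using av(1) by (simp add: CW_def power_mult_distrib mult.assoc)
  show "norm (y e' - y e) \<le> Cy * norm (e' - e)"
    using av(2) by (simp add: Cy_def mult.assoc)
qed

lemma compact_SV: "compact SV" and SV_nonempty: "SV \<noteq> {}"
proof -
  have "VV = (\<Inter>b\<in>{b\<in>B. \<mu> b \<noteq> \<beta>\<^sup>2}. {e. e \<bullet> b = 0})" by (auto simp: VV_def)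
  moreover have "closed {e. e \<bullet> b = 0}" for b :: 'a
    by (intro closed_Collect_eq continuous_intros)
  ultimately have "closed VV" by (simp add: closed_INT)
  moreover have "SV = sphere 0 1 \<inter> VV" by (auto simp: SV_def)
  ultimately show "compact SV" by (simp add: compact_Int_closed)
  obtain b where "b \<in> B" "\<mu> b = \<beta>\<^sup>2" using resonant by blast
  then have "b \<in> SV" using norm_B by (auto simp: SV_def VV_def inner_B)
  then show "SV \<noteq> {}" by blast
qed

lemma continuous_on_W: "continuous_on SV W"
proof (rule continuous_onI)
  fix e \<epsilon> :: "'a" and \<epsilon>' :: real
  show "\<exists>d>0. \<forall>x'\<in>SV. dist x' e < d \<longrightarrow> dist (W x') (W e) \<le> \<epsilon>'" if e: "e \<in> SV" and \<epsilon>: "\<epsilon>' > 0"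
  proof -
    define A where "A = norm (F e) * Cy + CW + 1"
    have Cs: "Cy \<ge> 0" "CW \<ge> 0"
      using M_nonneg \<rho>_nonneg L_pos Q_pos by (auto simp: Cy_def CW_def)
    have A: "A > 0" using Cs by (simp add: A_def add_nonneg_pos)
    define d where "d = min (\<kappa> / 2) (\<epsilon>' / A)"
    have "dist (W e') (W e) \<le> \<epsilon>'" if e': "e' \<in> SV" and dd: "dist e' e < d" for e'
    proof -
      have n: "norm (e' - e) \<le> \<kappa> / 2" "norm (e' - e) \<le> 1" "norm (e' - e) < \<epsilon>' / A"
        using dd \<kappa>_le by (auto simp: d_def dist_norm)
      have "\<bar>F e \<bullet> (y e' - y e)\<bar> \<le> norm (F e) * (Cy * norm (e' - e))"
        using Cauchy_Schwarz_ineq2[of "F e" "y e' - y e"] mult_left_mono[OF W_variation(2)[OF e e' n(1)] norm_ge_zero[of "F e"]]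
        by linarith
      moreover have "CW * (norm (e' - e))\<^sup>2 \<le> CW * norm (e' - e)"
        using n(2) Cs by (intro mult_left_mono) (auto simp: power2_eq_square mult_left_le)
      ultimately have "\<bar>W e' - W e\<bar> \<le> norm (F e) * (Cy * norm (e' - e)) + CW * norm (e' - e)"
        using W_variation(1)[OF e e' n(1)] by linarith
      also have "\<dots> \<le> A * norm (e' - e)" by (simp add: A_def algebra_simps)
      also have "\<dots> \<le> A * (\<epsilon>' / A)" using n A by (intro mult_left_mono) auto
      finally show ?thesis using A by (simp add: dist_norm)
    qed
    moreover have "d > 0" using \<kappa>_pos \<epsilon> A by (simp add: d_def)
    ultimately show ?thesis by blast
  qed
qed

text \<open>Conservation of the momenta belonging to the infinitesimal symmetries.\<close>

lemma F_kernel_small: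
  assumes e: "e \<in> SV" and b: "b \<in> B" "\<mu> b = 0"
  shows "(2 * real (card B) + 1) * \<bar>F e \<bullet> b\<bar> \<le> norm (F e)"
proof -
  obtain A where A: "linear A" "\<And>x. A x \<bullet> x = 0" "\<And>x. x \<in> ball 0 \<rho>0 \<Longrightarrow> g x \<bullet> (A x + b) = 0"
    "\<And>x. x \<in> cball 0 \<rho> \<Longrightarrow> (2 * real (card B) + 1) * norm (A x) \<le> 1"
    using symmetry_small[OF b] by blast
  let ?u = "u (r *\<^sub>R v e)" and ?p = "p (r *\<^sub>R v e)"
  note nb = sol_near(2,3)[OF e]
  have 0: "0 \<in> {0..L}" using L_pos by simp
  have "((\<lambda>t. ?p t \<bullet> (A (?u t) + b)) has_vector_derivative 0) (at s within {0..L})" if s: "s \<in> {0..L}" for s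
  proof -
    have "((\<lambda>t. A (?u t)) has_vector_derivative A (?p s)) (at s within {0..L})"
      by (rule bounded_linear.has_vector_derivative[OF linear_conv_bounded_linear[THEN iffD1, OF A(1)] flow_dataD(6)[OF flow nb(1) s]])
    from has_vector_derivative_add_const[THEN iffD2, OF this]
    have "((\<lambda>t. A (?u t) + b) has_derivative (\<lambda>h. h *\<^sub>R A (?p s))) (at s within {0..L})"
      unfolding has_vector_derivative_def .
    from has_derivative_inner[OF flow_dataD(7)[OF flow nb(1) s, unfolded has_vector_derivative_def] this]
    have "((\<lambda>t. ?p t \<bullet> (A (?u t) + b)) has_derivative
      (\<lambda>h. ?p s \<bullet> (h *\<^sub>R A (?p s)) + (h *\<^sub>R - g (?u s)) \<bullet> (A (?u s) + b))) (at s within {0..L})" .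
    moreover have "?u s \<in> ball 0 \<rho>0" using flow_dataD(5)[OF flow nb(1) s] \<rho>_less by simp
    ultimately show ?thesis
      using A(2)[of "?p s"] A(3)[of "?u s"] by (simp add: has_vector_derivative_def inner_commute)
  qed
  then have "norm (?p (\<tau> e) \<bullet> (A (?u (\<tau> e)) + b) - ?p 0 \<bullet> (A (?u 0) + b)) \<le> 0 * norm (\<tau> e - 0)"
    by (rule vector_differentiable_bound_real[OF _ _ nb(2) 0]) auto
  \<comment> \<open>The momentum is zero at the start because the motion begins at rest. So the
    component along \<open>b\<close> equals, up to sign, the pairing of \<open>F e\<close> with
    \<open>A (y e)\<close>, which is small because \<open>y e\<close> lies in the ball of radius
    \<rho>.\<close>
  then have "F e \<bullet> b = - (F e \<bullet> A (y e))"
    using flow_dataD(4)[OF flow nb(1)] by (simp add: inner_add_right)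
  then have "\<bar>F e \<bullet> b\<bar> \<le> norm (F e) * norm (A (y e))"
    using Cauchy_Schwarz_ineq2[of "F e" "A (y e)"] by simp
  then have "(2 * real (card B) + 1) * \<bar>F e \<bullet> b\<bar> \<le> (2 * real (card B) + 1) * (norm (F e) * norm (A (y e)))"
    by (intro mult_left_mono) auto
  also have "\<dots> = norm (F e) * ((2 * real (card B) + 1) * norm (A (y e)))" by simp
  also have "\<dots> \<le> norm (F e) * 1"
    using A(4) flow_dataD(5)[OF flow nb] by (intro mult_left_mono) auto
  finally show ?thesis by simp
qed

text \<open>A nonzero \<open>F e\<close> has a dominant component in \<open>V\<close>, orthogonal to
  \<open>e\<close>. Rotating \<open>e\<close> against this component raises the action at first
  order, while all errors are either a fixed fraction of that gain or quadratic in the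
  angle.\<close>

lemma maximizer_stationary:
  assumes e: "e \<in> SV" and max: "\<And>e'. e' \<in> SV \<Longrightarrow> W e' \<le> W e"
  shows "F e = 0"
proof (rule ccontr)
  assume F0: "F e \<noteq> 0"
  define FV where "FV = diag (\<lambda>b. if \<mu> b = \<beta>\<^sup>2 then 1 else 0) (F e)"
  define FT where "FT = diag (\<lambda>b. if \<mu> b = 0 then 1 else 0) (F e)"
  have split: "F e = FV + FT"
    using sol_equations(2)[OF e] \<beta>_pos
    by (intro eqI) (auto simp: FV_def FT_def inner_add_left BW_def)
  have FV: "FV \<in> VV" by (auto simp: VV_def FV_def)
  have "norm FT \<le> (\<Sum>b\<in>B. norm (F e) / (2 * real (card B) + 1))"
    unfolding FT_def diag_def
  proof (rule sum_norm_le)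
    fix b assume b: "b \<in> B"
    show "norm (((if \<mu> b = 0 then 1 else 0) * (F e \<bullet> b)) *\<^sub>R b) \<le> norm (F e) / (2 * real (card B) + 1)"
      using F_kernel_small[OF e b] norm_B[OF b] by (auto simp: pos_le_divide_eq mult.commute)
  qed
  also have "\<dots> \<le> norm (F e) / 2" by (simp add: divide_le_eq le_divide_eq algebra_simps)
  finally have FT: "norm FT \<le> norm (F e) / 2" .
  then have F_le: "norm (F e) \<le> 2 * norm FV"
    using norm_triangle_ineq[of FV FT] split by simp
  then have FV0: "norm FV > 0" using F0 by auto
  \<comment> \<open>The minus sign anticipates that half a period reverses displacements in
    \<open>V\<close>: \<open>cos (\<beta> * \<tau>)\<close> is close to -1, so the end point moves
    in the direction of \<open>FV\<close> when the start moves along \<open>f\<close>.\<close>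
  define f where "f = - (FV /\<^sub>R norm FV)"
  have f: "f \<in> VV" "norm f = 1" "FV = - (norm FV *\<^sub>R f)"
    using FV FV0 by (auto simp: f_def VV_def)
  have "FT \<bullet> e = 0"
    using SV_D(1)[OF e] \<beta>_pos unfolding inner_expand[of FT e]
    by (intro sum.neutral) (auto simp: FT_def VV_def)
  then have "FV \<bullet> e = 0" using sol_equations(3)[OF e] split by (simp add: inner_add_left)
  then have fe: "f \<bullet> e = 0" by (simp add: f_def)
  define es where "es = (\<lambda>s. cos s *\<^sub>R e + sin s *\<^sub>R f)"
  have ee: "e \<bullet> e = 1" "f \<bullet> f = 1" "e \<bullet> f = 0" using SV_D(3)[OF e] f(2) fe by (auto simp: norm_eq_1 inner_commute)
  have es: "es s \<in> SV" for s
  proof -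
    have "es s \<bullet> es s = (cos s)\<^sup>2 + (sin s)\<^sup>2"
      using ee fe by (simp add: es_def inner_add_left inner_add_right power2_eq_square)
    then have "norm (es s) = 1" by (simp add: norm_eq_1)
    then show ?thesis using SV_D(1)[OF e] f(1) by (simp add: SV_def VV_def es_def inner_add_left)
  qed
  have es_d: "norm (es s - e) \<le> 2 * s" if "s \<ge> 0" for s
  proof -
    have "es s - e = (cos s - cos 0) *\<^sub>R e + (sin s - sin 0) *\<^sub>R f" by (simp add: es_def algebra_simps)
    then have "norm (es s - e) \<le> \<bar>cos s - cos 0\<bar> + \<bar>sin s - sin 0\<bar>"
      using norm_triangle_ineq[of "(cos s - cos 0) *\<^sub>R e" "(sin s - sin 0) *\<^sub>R f"] SV_D(2)[OF e] f(2) by simp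
    then show ?thesis using abs_cos_diff_le[of s 0] abs_sin_diff_le[of s 0] that by linarith
  qed
  have K\<kappa>: "K * \<kappa> \<le> 1"
  proof -
    have "K * \<kappa> \<le> K\<^sup>2 * \<kappa>" using K1 \<kappa>_pos by (simp add: power2_eq_square)
    also have "\<dots> \<le> K\<^sup>2 * (3 * \<kappa> + 3 * \<eta>)" using \<kappa>_pos \<eta>_pos by (intro mult_left_mono) auto
    also have "\<dots> \<le> (2 + real (card B)) * (K\<^sup>2 * (3 * \<kappa> + 3 * \<eta>))"
      using mult_right_mono[of 1 "2 + real (card B)" "K\<^sup>2 * (3 * \<kappa> + 3 * \<eta>)"] \<kappa>_pos \<eta>_pos by simp
    finally show ?thesis using small_contraction by linarith
  qed
  \<comment> \<open>The linear part contributes at least \<open>norm FV * r * s / 8\<close>, from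
    the three factors 1/2, \<open>s / 2\<close> and 1/2 bounded below; the nonlinear part costs at
    most half of it.\<close>
  have key: "F e \<bullet> (y (es s) - y e) \<ge> norm FV * r * s / 16"
    if s: "0 < s" "s \<le> 1" "2 * s \<le> \<kappa> / 2" for s
  proof -
    define d where "d = norm (es s - e)"
    have d: "d \<le> 2 * s" "d \<le> \<kappa> / 2" using es_d[of s] s by (auto simp: d_def)
    note lip = sol_Lipschitz[OF e es d(2)[unfolded d_def], folded d_def]
    define Z where "Z = Cf (\<tau> (es s)) (r *\<^sub>R v (es s)) - Cf (\<tau> e) (r *\<^sub>R v e)"
    define R where "R = (y (es s) - Cf (\<tau> (es s)) (r *\<^sub>R v (es s))) - (y e - Cf (\<tau> e) (r *\<^sub>R v e))"
    have yZR: "y (es s) - y e = Z + R" by (simp add: Z_def R_def)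
    have "norm R \<le> \<eta> * norm (r *\<^sub>R v (es s) - r *\<^sub>R v e) + \<eta> * norm (r *\<^sub>R v e) * \<bar>\<tau> (es s) - \<tau> e\<bar>"
      unfolding R_def by (rule flow_joint_Lipschitz(1)[OF flow sol_near(2)[OF es] sol_near(2)[OF e] sol_near(3)[OF es] sol_near(3)[OF e]])
    also have "\<dots> = \<eta> * r * (norm (v (es s) - v e) + norm (v e) * \<bar>\<tau> (es s) - \<tau> e\<bar>)"
      using r_pos by (simp add: algebra_simps flip: scaleR_diff_right)
    also have "\<dots> \<le> \<eta> * r * (Ke * d + 2 * (Ke * d))"
      using \<eta>_pos r_pos lip(1,2) sol_near(1)[OF e] Ke_pos by (intro mult_left_mono add_mono mult_mono) (auto simp: d_def)
    also have "\<dots> \<le> \<eta> * r * (Ke * (2 * s) + 2 * (Ke * (2 * s)))"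
      using \<eta>_pos r_pos d Ke_pos by (intro mult_left_mono add_mono) auto
    also have "\<dots> = (192 * \<eta> * Ke) * (r * s / 32)" by simp
    also have "\<dots> \<le> 1 * (r * s / 32)" using r_pos s by (intro mult_right_mono small_variation) auto
    finally have R: "norm R \<le> r * s / 32" by simp
    have FR: "\<bar>F e \<bullet> R\<bar> \<le> norm FV * r * s / 16"
    proof -
      have "\<bar>F e \<bullet> R\<bar> \<le> norm (F e) * norm R" by (rule Cauchy_Schwarz_ineq2)
      also have "\<dots> \<le> (2 * norm FV) * (r * s / 32)" using F_le R by (intro mult_mono) auto
      finally show ?thesis by (simp add: mult_ac)
    qed
    \<comment> \<open>The linear flow is diagonal and the initial positions have no kernel
      component, so the linear end point has none either.\<close>
    have FTZ: "FT \<bullet> Z = 0"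
      unfolding inner_expand[of FT Z]
    proof (intro sum.neutral ballI)
      fix b assume b: "b \<in> B"
      show "FT \<bullet> b * (Z \<bullet> b) = 0"
        using b sol_equations(4)[OF e b] sol_equations(4)[OF es b] by (simp add: FT_def Z_def Cf_def inner_diff_left)
    qed
    have vf: "v (es s) \<bullet> f = sin s * (v (es s) \<bullet> es s)"
    proof -
      \<comment> \<open>The part of \<open>f\<close> orthogonal to \<open>es s\<close> still lies in
        \<open>V\<close>, where the solution for \<open>es s\<close> has no component besides the
        one along \<open>es s\<close>.\<close>
      define f' where "f' = f - sin s *\<^sub>R es s"
      have "f \<bullet> es s = sin s" using ee fe by (simp add: es_def inner_add_right)
      then have "f' \<bullet> es s = 0" using SV_D(3)[OF es] by (simp add: f'_def inner_diff_left)
      moreover have "f' \<in> VV" using f(1) SV_D(1)[OF es[of s]] by (simp add: f'_def VV_def inner_diff_left)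
      ultimately have "v (es s) \<bullet> f' = 0" using sol_equations(5)[OF es] by blast
      then show ?thesis by (simp add: f'_def inner_diff_right)
    qed
    have vge: "v (es s) \<bullet> es s \<ge> 1/2"
    proof -
      have "\<bar>(v (es s) - es s) \<bullet> es s\<bar> \<le> \<kappa> / 2"
        using Cauchy_Schwarz_ineq2[of "v (es s) - es s" "es s"] sol_near(4)[OF es[of s]] SV_D(2)[OF es[of s]] by simp
      then show ?thesis using SV_D(3)[OF es[of s]] \<kappa>_le unfolding inner_diff_left by linarith
    qed
    have cosle: "cos (\<beta> * \<tau> (es s)) \<le> - 1/2"
    proof -
      have "\<bar>cos (\<beta> * \<tau> (es s)) - cos (\<beta> * \<tau>0)\<bar> \<le> \<bar>\<beta> * \<tau> (es s) - \<beta> * \<tau>0\<bar>" by (rule abs_cos_diff_le)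
      also have "\<dots> = \<beta> * \<bar>\<tau> (es s) - \<tau>0\<bar>" using \<beta>_pos by (simp add: abs_mult flip: right_diff_distrib)
      also have "\<dots> \<le> K * (\<kappa> / 2)" using sol_near(5)[OF es] K_\<beta>(2) K1 by (intro mult_mono) auto
      finally have "\<bar>cos (\<beta> * \<tau> (es s)) - cos (\<beta> * \<tau>0)\<bar> \<le> 1/2" using K\<kappa> by simp
      moreover have "cos (\<beta> * \<tau>0) = -1" using \<beta>_pos by (simp add: \<tau>0_def)
      ultimately show ?thesis by linarith
    qed
    have sin_ge: "sin s \<ge> s / 2"
    proof -
      have "sin 0 - 0 / 2 \<le> sin s - s / 2"
      proof (rule DERIV_nonneg_imp_nondecreasing[of 0 s "\<lambda>x. sin x - x / 2"])
        fix x :: real assume x: "0 \<le> x" "x \<le> s"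
        have "cos (pi / 3) \<le> cos x" using x s pi_gt3 by (intro cos_monotone_0_pi_le) auto
        then show "\<exists>y. ((\<lambda>x. sin x - x / 2) has_real_derivative y) (at x) \<and> 0 \<le> y"
          by (intro exI[of _ "cos x - 1/2"]) (auto intro!: derivative_eq_intros simp: cos_60)
      qed (use s in auto)
      then show ?thesis by simp
    qed
    have "FV \<bullet> Z = - norm FV * (f \<bullet> Z)" by (subst f(3)) simp
    also have "f \<bullet> Z = r * cos (\<beta> * \<tau> (es s)) * (v (es s) \<bullet> f) - r * cos (\<beta> * \<tau> e) * (v e \<bullet> f)"
      using inner_Cf_VV[OF f(1)] by (simp add: Z_def inner_diff_right inner_commute[of f])
    also have "v e \<bullet> f = 0" by (rule sol_equations(5)[OF e f(1) fe])
    also have "- norm FV * (r * cos (\<beta> * \<tau> (es s)) * (v (es s) \<bullet> f) - r * cos (\<beta> * \<tau> e) * 0)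
        = norm FV * r * ((- cos (\<beta> * \<tau> (es s))) * (sin s * (v (es s) \<bullet> es s)))"
      by (simp add: vf)
    finally have FVZ: "FV \<bullet> Z = norm FV * r * ((- cos (\<beta> * \<tau> (es s))) * (sin s * (v (es s) \<bullet> es s)))" .
    have "(1/2) * ((s/2) * (1/2)) \<le> (- cos (\<beta> * \<tau> (es s))) * (sin s * (v (es s) \<bullet> es s))"
      using cosle sin_ge vge s by (intro mult_mono) auto
    then have "norm FV * r * (s / 8) \<le> FV \<bullet> Z"
      unfolding FVZ using r_pos by (intro mult_left_mono) auto
    moreover have "F e \<bullet> (y (es s) - y e) = FV \<bullet> Z + F e \<bullet> R"
      unfolding yZR inner_add_right using FTZ by (subst (1) split) (simp add: inner_add_left)
    ultimately show ?thesis using FR by simp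
  qed
  define c where "c = norm FV * r / 16"
  have c: "c > 0" using FV0 r_pos by (simp add: c_def)
  have CW0: "CW \<ge> 0" using M_nonneg \<rho>_nonneg L_pos by (auto simp: CW_def)
  \<comment> \<open>The entry \<open>\<kappa> / 4\<close> keeps \<open>es s\<close> within the
    Lipschitz range. The last entry lets the gain \<open>c * s\<close> exceed the quadratic error
    \<open>4 * CW * s^2\<close> strictly, the added 1 covering \<open>CW = 0\<close>.\<close>
  define s where "s = Min {1, \<kappa> / 4, c / (8 * CW + 1)}"
  have s: "0 < s" "s \<le> 1" "2 * s \<le> \<kappa> / 2" "s \<le> c / (8 * CW + 1)"
    using \<kappa>_pos c CW0 by (auto simp: s_def)
  have d: "norm (es s - e) \<le> 2 * s" "norm (es s - e) \<le> \<kappa> / 2" using es_d[of s] s by auto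
  have "W (es s) - W e \<ge> F e \<bullet> (y (es s) - y e) - CW * (norm (es s - e))\<^sup>2"
    using W_variation(1)[OF e es d(2)] by linarith
  moreover have "CW * (norm (es s - e))\<^sup>2 \<le> CW * (2 * s)\<^sup>2"
    using d CW0 by (intro mult_left_mono power_mono) auto
  moreover have "CW * (2 * s)\<^sup>2 < c * s"
  proof -
    have "(8 * CW + 1) * s \<le> c" using s(4) CW0 by (simp add: pos_le_divide_eq mult.commute)
    then have "s + 8 * (CW * s) \<le> c" by (simp add: algebra_simps)
    moreover have "0 \<le> CW * s" using CW0 s(1) by simp
    ultimately have "4 * (CW * s) < c" using s(1) by linarith
    then have "4 * CW * s < c" by simp
    then have "4 * CW * s * s < c * s" using s(1) by (rule mult_strict_right_mono)
    then show ?thesis by (simp add: power2_eq_square mult_ac)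
  qed
  moreover have "F e \<bullet> (y (es s) - y e) \<ge> c * s" using key[OF s(1-3)] by (simp add: c_def)
  ultimately have "W (es s) > W e" by linarith
  then show False using max[OF es, of s] by simp
qed

lemma stationary_exists: "\<exists>e\<in>SV. F e = 0"
proof -
  obtain e where "e \<in> SV" "\<And>e'. e' \<in> SV \<Longrightarrow> W e' \<le> W e"
    using continuous_attains_sup[OF compact_SV SV_nonempty continuous_on_W] by blast
  then show ?thesis using maximizer_stationary by blast
qed

end

section \<open>Reflection\<close>

text \<open>The fundamental theorem of calculus tolerates finitely many exceptional points, so
  \<open>F\<close> is locally a constant plus the integral of the continuous \<open>G\<close>, and
  hence differentiable at those points too.\<close>

lemma has_vector_derivative_off_finite:
  fixes F G :: "real \<Rightarrow> 'a::banach"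
  assumes F: "continuous_on UNIV F" and G: "continuous_on UNIV G"
    and fin: "\<And>a b. finite (Z \<inter> {a..b})"
    and d: "\<And>t. t \<notin> Z \<Longrightarrow> (F has_vector_derivative G t) (at t)"
  shows "(F has_vector_derivative G t) (at t)"
proof -
  define a b where "a = t - 1" and "b = t + 1"
  have eq: "F x = F a + integral {a..x} G" if x: "x \<in> {a..b}" for x
  proof -
    have "(G has_integral (F x - F a)) {a..x}"
    proof (rule fundamental_theorem_of_calculus_strong[OF fin[of a x]])
      show "(F has_vector_derivative G s) (at s)" if "s \<in> {a..x} - Z \<inter> {a..x}" for s
        using that by (intro d) auto
    qed (use x in \<open>auto intro: continuous_on_subset[OF F]\<close>)
    then show ?thesis by (simp add: integral_unique)
  qed
  have t: "t \<in> {a<..<b}" by (simp add: a_def b_def)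
  have "((\<lambda>x. integral {a..x} G) has_vector_derivative G t) (at t within {a..b})"
    using t by (intro integral_has_vector_derivative continuous_on_subset[OF G]) auto
  then have "((\<lambda>x. F a + integral {a..x} G) has_vector_derivative G t) (at t within {a..b})"
    by (auto intro!: derivative_eq_intros)
  then have "((\<lambda>x. F a + integral {a..x} G) has_vector_derivative G t) (at t)"
    using t at_within_Icc_at[of a t b] by auto
  then show ?thesis
    by (rule has_vector_derivative_transform_within_open[OF _ open_greaterThanLessThan t])
      (rule eq[symmetric], simp)
qed

text \<open>The even zigzag of period \<open>2 * \<tau>\<close> that is the identity on
  \<open>{0..\<tau>}\<close>. The formula through \<open>arccos\<close> gives range, continuity and
  periodicity without case distinctions.\<close>

definition triangle_wave :: "real \<Rightarrow> real \<Rightarrow> real" where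
  "triangle_wave \<tau> t = \<tau> / pi * arccos (cos (pi * t / \<tau>))"

lemma triangle_wave_range: "\<tau> > 0 \<Longrightarrow> triangle_wave \<tau> t \<in> {0..\<tau>}"
  using arccos_bounded[of "cos (pi * t / \<tau>)"]
  by (auto simp: triangle_wave_def field_simps)

lemma triangle_wave_id: "\<tau> > 0 \<Longrightarrow> t \<in> {0..\<tau>} \<Longrightarrow> triangle_wave \<tau> t = t"
  by (simp add: triangle_wave_def arccos_cos field_simps)

lemma triangle_wave_periodic: "\<tau> > 0 \<Longrightarrow> triangle_wave \<tau> (t + 2 * \<tau>) = triangle_wave \<tau> t"
proof -
  assume "\<tau> > 0"
  then have "pi * (t + 2 * \<tau>) / \<tau> = pi * t / \<tau> + 2 * pi" by (simp add: field_simps)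
  then show ?thesis by (simp add: triangle_wave_def)
qed

lemma continuous_on_triangle_wave: "\<tau> > 0 \<Longrightarrow> continuous_on S (triangle_wave \<tau>)"
  unfolding triangle_wave_def[abs_def]
  by (intro continuous_on_mult continuous_on_const continuous_on_arccos') (auto intro!: continuous_intros)

lemma triangle_wave_corner:
  assumes "\<tau> > 0" "sin (pi * t / \<tau>) = 0"
  shows "triangle_wave \<tau> t = 0 \<or> triangle_wave \<tau> t = \<tau>"
proof -
  have "(cos (pi * t / \<tau>))\<^sup>2 = 1" using sin_cos_squared_add[of "pi * t / \<tau>"] assms(2) by simp
  then have "cos (pi * t / \<tau>) = 1 \<or> cos (pi * t / \<tau>) = -1" by (simp add: power2_eq_1_iff)
  then show ?thesis using assms(1) by (auto simp: triangle_wave_def)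
qed

lemma triangle_wave_interior:
  assumes "\<tau> > 0" "sin (pi * t / \<tau>) \<noteq> 0"
  shows "triangle_wave \<tau> t \<in> {0<..<\<tau>}"
    and "(triangle_wave \<tau> has_real_derivative sgn (sin (pi * t / \<tau>))) (at t)"
proof -
  let ?\<theta> = "pi * t / \<tau>"
  have s: "(sin ?\<theta>)\<^sup>2 > 0" using assms(2) by simp
  then have c2: "(cos ?\<theta>)\<^sup>2 < 1" using sin_cos_squared_add[of ?\<theta>] by linarith
  then have c: "-1 < cos ?\<theta>" "cos ?\<theta> < 1" by (auto simp: abs_square_less_1 abs_less_iff)
  then show "triangle_wave \<tau> t \<in> {0<..<\<tau>}"
    using arccos_lt_bounded[of "cos ?\<theta>"] assms(1) by (auto simp: triangle_wave_def field_simps)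
  have sq: "sqrt (1 - (cos ?\<theta>)\<^sup>2) = \<bar>sin ?\<theta>\<bar>"
    by (simp add: sin_squared_eq[symmetric])
  have "((\<lambda>t. \<tau> / pi * arccos (cos (pi * t / \<tau>))) has_real_derivative
      \<tau> / pi * (inverse (- sqrt (1 - (cos ?\<theta>)\<^sup>2)) * (- sin ?\<theta> * (pi / \<tau>)))) (at t)"
    by (intro DERIV_cmult DERIV_chain2[where f=arccos and g="\<lambda>t. cos (pi * t / \<tau>)", OF DERIV_arccos[OF c]])
      (use assms(1) in \<open>auto intro!: derivative_eq_intros\<close>)
  moreover have "\<tau> / pi * (inverse (- sqrt (1 - (cos ?\<theta>)\<^sup>2)) * (- sin ?\<theta> * (pi / \<tau>))) = sgn (sin ?\<theta>)"
    unfolding sq using assms by (auto simp: sgn_if field_simps)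
  ultimately show "(triangle_wave \<tau> has_real_derivative sgn (sin ?\<theta>)) (at t)"
    unfolding triangle_wave_def[abs_def] by simp
qed

text \<open>Folding time by the zigzag multiplies the velocity by its slope, plus or minus 1; in the
  second derivative the sign occurs twice and disappears. The vanishing end velocities make the
  velocity continuous at the folds.\<close>

lemma reflected_solution:
  fixes u p :: "real \<Rightarrow> 'a::banach"
  assumes \<tau>: "\<tau> > 0"
    and u: "\<And>t. t \<in> {0..\<tau>} \<Longrightarrow> (u has_vector_derivative p t) (at t within {0..\<tau>})"
    and p: "\<And>t. t \<in> {0..\<tau>} \<Longrightarrow> (p has_vector_derivative f t) (at t within {0..\<tau>})"
    and f: "continuous_on {0..\<tau>} f" and p0: "p 0 = 0" "p \<tau> = 0"
  defines "\<phi> \<equiv> triangle_wave \<tau>"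
  shows "\<exists>Q'. \<forall>t. ((\<lambda>t. u (\<phi> t)) has_vector_derivative Q' t) (at t) \<and> (Q' has_vector_derivative f (\<phi> t)) (at t)"
proof -
  define \<sigma> where "\<sigma> = (\<lambda>t. sgn (sin (pi * t / \<tau>)))"
  define Q' where "Q' = (\<lambda>t. \<sigma> t *\<^sub>R p (\<phi> t))"
  define Z where "Z = {t. sin (pi * t / \<tau>) = 0}"
  have \<phi>: "\<phi> t \<in> {0..\<tau>}" for t using triangle_wave_range[OF \<tau>] by (simp add: \<phi>_def)
  have \<phi>_cont: "continuous_on UNIV \<phi>" unfolding \<phi>_def by (rule continuous_on_triangle_wave[OF \<tau>])
  have fin: "finite (Z \<inter> {a..b})" for a b
  proof (rule finite_subset)
    show "Z \<inter> {a..b} \<subseteq> (\<lambda>i. of_int i * \<tau>) ` {\<lfloor>a / \<tau>\<rfloor>..\<lceil>b / \<tau>\<rceil>}"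
    proof
      fix t assume t: "t \<in> Z \<inter> {a..b}"
      then obtain i :: int where "pi * t / \<tau> = of_int i * pi" by (auto simp: Z_def sin_zero_iff_int2)
      then have i: "t = of_int i * \<tau>" "of_int i = t / \<tau>" using \<tau> by (auto simp: field_simps)
      have "a / \<tau> \<le> of_int i" "of_int i \<le> b / \<tau>" using t \<tau> i(2) by (auto intro: divide_right_mono)
      then have "i \<in> {\<lfloor>a / \<tau>\<rfloor>..\<lceil>b / \<tau>\<rceil>}" by (auto intro: floor_mono[of "a/\<tau>" "of_int i", simplified] ceiling_mono[of "of_int i" "b/\<tau>", simplified])
      then show "t \<in> (\<lambda>i. of_int i * \<tau>) ` {\<lfloor>a / \<tau>\<rfloor>..\<lceil>b / \<tau>\<rceil>}" using i(1) by blast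
    qed
  qed simp
  have interior: "(h has_vector_derivative h' ) (at (\<phi> t))"
    if "t \<notin> Z" "(h has_vector_derivative h') (at (\<phi> t) within {0..\<tau>})" for h :: "real \<Rightarrow> 'a" and h' t
    using that at_within_Icc_at[of 0 "\<phi> t" \<tau>] triangle_wave_interior(1)[OF \<tau>, of t] by (auto simp: Z_def \<phi>_def)
  have chain: "((\<lambda>t. h (\<phi> t)) has_vector_derivative \<sigma> t *\<^sub>R h') (at t)"
    if t: "t \<notin> Z" and h: "(h has_vector_derivative h') (at (\<phi> t) within {0..\<tau>})" for h :: "real \<Rightarrow> 'a" and h' t
  proof -
    have "(\<phi> has_vector_derivative \<sigma> t) (at t)"
      using triangle_wave_interior(2)[OF \<tau>, of t] t
      by (simp add: \<phi>_def \<sigma>_def Z_def has_real_derivative_iff_has_vector_derivative)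
    from vector_diff_chain_at[OF this interior[OF t h]] show ?thesis by (simp add: o_def)
  qed
  have cont_comp: "continuous_on UNIV (\<lambda>t. h (\<phi> t))" if "continuous_on {0..\<tau>} h" for h :: "real \<Rightarrow> 'a"
    using continuous_on_compose2[OF that \<phi>_cont] \<phi> by blast
  have uc: "continuous_on {0..\<tau>} u" and pc: "continuous_on {0..\<tau>} p"
    by (rule continuous_on_vector_derivative[OF u], assumption) (rule continuous_on_vector_derivative[OF p])
  have dQ: "((\<lambda>t. u (\<phi> t)) has_vector_derivative Q' t) (at t)" if "t \<notin> Z" for t
    unfolding Q'_def using chain[OF that u[OF \<phi>]] .
  have dQ': "(Q' has_vector_derivative f (\<phi> t)) (at t)" if t: "t \<notin> Z" for t
  proof -
    have "((\<lambda>s. \<sigma> t *\<^sub>R p (\<phi> s)) has_vector_derivative \<sigma> t *\<^sub>R (\<sigma> t *\<^sub>R f (\<phi> t))) (at t)"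
      by (rule bounded_linear.has_vector_derivative[OF bounded_linear_scaleR_right chain[OF t p[OF \<phi>]]])
    moreover have "\<sigma> t *\<^sub>R (\<sigma> t *\<^sub>R f (\<phi> t)) = f (\<phi> t)"
      using t by (auto simp: \<sigma>_def Z_def sgn_if)
    ultimately have "((\<lambda>s. \<sigma> t *\<^sub>R p (\<phi> s)) has_vector_derivative f (\<phi> t)) (at t)" by simp
    \<comment> \<open>On this neighbourhood of \<open>t\<close> the sign is constant, so
      \<open>\<sigma> t\<close> may replace \<open>\<sigma> s\<close> before
      differentiating.\<close>
    moreover have "open {s. sin (pi * s / \<tau>) * \<sigma> t > 0}"
      using \<tau> by (intro open_Collect_less continuous_intros) auto
    moreover have "t \<in> {s. sin (pi * s / \<tau>) * \<sigma> t > 0}" using t by (auto simp: \<sigma>_def Z_def sgn_if)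
    ultimately show ?thesis
    proof (rule has_vector_derivative_transform_within_open)
      fix s assume "s \<in> {s. sin (pi * s / \<tau>) * \<sigma> t > 0}"
      then have "\<sigma> s = \<sigma> t" by (auto simp: \<sigma>_def sgn_if zero_less_mult_iff split: if_splits)
      then show "\<sigma> t *\<^sub>R p (\<phi> s) = Q' s" by (simp add: Q'_def)
    qed
  qed
  have Q'_cont: "continuous_on UNIV Q'"
  proof (rule continuous_at_imp_continuous_on, rule ballI)
    fix t :: real
    show "isCont Q' t"
    proof (cases "t \<in> Z")
      case True
      then have z: "p (\<phi> t) = 0" using triangle_wave_corner[OF \<tau>, of t] p0 by (auto simp: Z_def \<phi>_def)
      \<comment> \<open>At a fold the sign jumps but the velocity tends to 0, so the product is
        still continuous there.\<close>
      have "isCont (\<lambda>t. p (\<phi> t)) t"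
        using cont_comp[OF pc] by (simp add: continuous_on_eq_continuous_at)
      then have "((\<lambda>s. norm (p (\<phi> s))) \<longlongrightarrow> 0) (at t)"
        using z by (metis isCont_def tendsto_norm_zero)
      then have "(Q' \<longlongrightarrow> 0) (at t)"
        by (rule Lim_null_comparison[rotated])
          (auto simp: Q'_def \<sigma>_def sgn_if intro!: always_eventually)
      then show ?thesis using z by (simp add: isCont_def Q'_def)
    next
      case False
      then show ?thesis using dQ' has_vector_derivative_continuous by blast
    qed
  qed
  show ?thesis
  proof (intro exI[of _ Q'] allI conjI)
    fix t
    show "((\<lambda>t. u (\<phi> t)) has_vector_derivative Q' t) (at t)"
      by (rule has_vector_derivative_off_finite[OF cont_comp[OF uc] Q'_cont fin dQ])
    show "(Q' has_vector_derivative f (\<phi> t)) (at t)"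
      by (rule has_vector_derivative_off_finite[OF Q'_cont cont_comp[OF f] fin dQ'])
  qed
qed

text \<open>Every period \<open>S \<le> \<tau>\<close> has a multiple in \<open>{\<tau>/2<..\<tau>}\<close>.\<close>

lemma no_smaller_period:
  fixes Q :: "real \<Rightarrow> 'a"
  assumes \<tau>: "\<tau> > 0" and per: "\<And>t. Q (t + 2 * \<tau>) = Q t"
    and ne: "\<And>t. \<tau> / 2 < t \<Longrightarrow> t \<le> \<tau> \<Longrightarrow> Q t \<noteq> Q 0"
    and S: "0 < S" "S < 2 * \<tau>"
  shows "\<not> (\<forall>t. Q (t + S) = Q t)"
proof -
  have half: False if S: "0 < S" "S \<le> \<tau>" and QS: "\<And>t. Q (t + S) = Q t" for S
  proof -
    define k where "k = nat \<lfloor>\<tau> / S\<rfloor>"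
    have "1 \<le> \<tau> / S" using S by (simp add: field_simps)
    then have fl: "1 \<le> \<lfloor>\<tau> / S\<rfloor>" by (simp add: le_floor_iff)
    then have k: "real k = of_int \<lfloor>\<tau> / S\<rfloor>" "1 \<le> real k" by (simp_all add: k_def)
    have "real k \<le> \<tau> / S" "\<tau> / S < real k + 1" unfolding k(1) by linarith+
    then have "real k * S \<le> \<tau>" "\<tau> < real k * S + S" using S by (simp_all add: field_simps)
    moreover have "S \<le> real k * S" using mult_right_mono[OF k(2), of S] S by simp
    ultimately have "\<tau> / 2 < real k * S" "real k * S \<le> \<tau>" by linarith+
    moreover have "Q (real n * S) = Q 0" for n
    proof (induction n)
      case (Suc n)
      have "Q (real n * S + S) = Q (real n * S)" by (rule QS)
      then show ?case using Suc by (simp add: algebra_simps)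
    qed simp
    ultimately show False using ne by blast
  qed
  show ?thesis
  proof
    assume QS: "\<forall>t. Q (t + S) = Q t"
    show False
    proof (cases "S \<le> \<tau>")
      case True
      then show False using half[of S] S QS by blast
    next
      case False
      \<comment> \<open>A period above \<open>\<tau>\<close> is replaced by its complement in
        \<open>2 * \<tau>\<close>, which is below \<open>\<tau>\<close>.\<close>
      have "Q (t + (2 * \<tau> - S)) = Q t" for t
        using per[of "t - S"] QS[rule_format, of "t - S"] by (simp add: algebra_simps)
      then show False using half[of "2 * \<tau> - S"] S False by force
    qed
  qed
qed

section \<open>The periodic solution and the minimality of its period\<close>

context scaled_center_symmetric begin

lemma periodic_solution:
  obtains Q :: "real \<Rightarrow> 'a" and P where "P > 0" "\<bar>P - 2 * \<tau>0\<bar> \<le> \<kappa>" "\<And>t. norm (Q t) \<le> \<rho>"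
    "\<exists>Q'. \<forall>t. (Q has_vector_derivative Q' t) (at t) \<and> (Q' has_vector_derivative - g (Q t)) (at t)"
    "\<And>t. Q (t + P) = Q t" "\<And>S. 0 < S \<Longrightarrow> S < P \<Longrightarrow> \<not> (\<forall>t. Q (t + S) = Q t)"
proof -
  obtain e where e: "e \<in> SV" and F0: "F e = 0" using stationary_exists by blast
  define \<xi> where "\<xi> = r *\<^sub>R v e"
  define T where "T = \<tau> e"
  note nb = sol_near[OF e, folded \<xi>_def T_def]
  have T: "T > 0" "T \<ge> \<tau>0 / 2" using nb(5) \<kappa>_le \<tau>0_pos by linarith+
  have sub: "{0..T} \<subseteq> {0..L}" using nb(3) by auto
  have sub': "t \<in> {0..L}" if "t \<in> {0..T}" for t using that sub by blast
  define Q where "Q = (\<lambda>t. u \<xi> (triangle_wave T t))"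
  have tw: "triangle_wave T t \<in> {0..T}" for t by (rule triangle_wave_range[OF T(1)])
  have Q_id: "Q t = u \<xi> t" if "t \<in> {0..T}" for t using triangle_wave_id[OF T(1) that] by (simp add: Q_def)
  have g_cont: "continuous_on (cball 0 \<rho>) g"
    using g_Lipschitz M_nonneg by (intro lipschitz_on_continuous_on[of M] lipschitz_onI) (auto simp: dist_norm)
  have u_cont: "continuous_on {0..T} (u \<xi>)"
    using continuous_on_vector_derivative[OF flow_dataD(6)[OF flow nb(2)]] by (rule continuous_on_subset[OF _ sub])
  have "continuous_on {0..T} (\<lambda>t. - g (u \<xi> t))"
    using flow_dataD(5)[OF flow nb(2) sub']
    by (intro continuous_on_minus continuous_on_compose2[OF g_cont u_cont]) auto
  from reflected_solution[OF T(1) has_vector_derivative_within_subset[OF flow_dataD(6)[OF flow nb(2) sub'] sub]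
      has_vector_derivative_within_subset[OF flow_dataD(7)[OF flow nb(2) sub'] sub] this]
  have sol: "\<exists>Q'. \<forall>t. (Q has_vector_derivative Q' t) (at t) \<and> (Q' has_vector_derivative - g (Q t)) (at t)"
    using flow_dataD(4)[OF flow nb(2)] F0 by (simp add: Q_def \<xi>_def T_def)
  have per: "Q (t + 2 * T) = Q t" for t by (simp add: Q_def triangle_wave_periodic[OF T(1)])
  have ve: "v e \<bullet> e \<ge> 1/2"
  proof -
    have "\<bar>(v e - e) \<bullet> e\<bar> \<le> \<kappa> / 2"
      using Cauchy_Schwarz_ineq2[of "v e - e" e] nb(4) SV_D(2)[OF e] by simp
    then show ?thesis using SV_D(3)[OF e] \<kappa>_le unfolding inner_diff_left by linarith
  qed
  \<comment> \<open>The bound 3/16 is half of 3/8, the product of the lower bounds 3/4 for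
    \<open>1 - cos (\<beta> * t)\<close> and 1/2 for \<open>v e \<bullet> e\<close>. It is set
    against an error \<open>2 * \<eta>\<close> below.\<close>
  have small: "\<beta> * \<kappa> \<le> 1" "\<eta> < 3/16"
  proof -
    have "\<beta> * \<kappa> \<le> K * \<kappa>" using K_\<beta> \<kappa>_pos by (intro mult_right_mono) auto
    also have "K * \<kappa> \<le> K\<^sup>2 * \<kappa>" using K1 \<kappa>_pos by (simp add: power2_eq_square)
    also have "\<dots> \<le> K\<^sup>2 * (3 * \<kappa> + 3 * \<eta>)" using \<kappa>_pos \<eta>_pos by (intro mult_left_mono) auto
    also have "\<dots> \<le> (2 + real (card B)) * (K\<^sup>2 * (3 * \<kappa> + 3 * \<eta>))"
      using mult_right_mono[of 1 "2 + real (card B)" "K\<^sup>2 * (3 * \<kappa> + 3 * \<eta>)"] \<kappa>_pos \<eta>_pos by simp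
    finally show "\<beta> * \<kappa> \<le> 1" using small_contraction by linarith
    have "192 * \<eta> * 16 \<le> 192 * \<eta> * Ke" using \<eta>_pos by (intro mult_left_mono) (auto simp: Ke_def)
    then show "\<eta> < 3/16" using small_variation by linarith
  qed
  \<comment> \<open>In the second half of the half-period the component along \<open>e\<close> has
    moved away from its initial value by a fixed fraction of \<open>r\<close>, more than the
    nonlinear error can compensate.\<close>
  have ne: "Q t \<noteq> Q 0" if t: "T / 2 < t" "t \<le> T" for t
  proof
    assume eq: "Q t = Q 0"
    have tT: "t \<in> {0..T}" using t T by auto
    have "u \<xi> t = \<xi>" using eq Q_id[OF tT] Q_id[of 0] T flow_dataD(3)[OF flow nb(2)] by simp
    then have "norm (\<xi> - Cf t \<xi>) \<le> \<eta> * norm \<xi>" using flow_error(1)[OF flow nb(2) sub'[OF tT]] by simp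
    then have "\<bar>(\<xi> - Cf t \<xi>) \<bullet> e\<bar> \<le> \<eta> * norm \<xi>"
      using Cauchy_Schwarz_ineq2[of "\<xi> - Cf t \<xi>" e] SV_D(2)[OF e] by simp
    moreover have "(\<xi> - Cf t \<xi>) \<bullet> e = r * ((1 - cos (\<beta> * t)) * (v e \<bullet> e))"
      by (simp add: inner_diff_left inner_Cf_VV[OF SV_D(1)[OF e]] \<xi>_def algebra_simps)
    moreover have "\<eta> * norm \<xi> \<le> r * (\<eta> * 2)"
      using nb(1) r_pos \<eta>_pos by (simp add: \<xi>_def)
    ultimately have "r * ((1 - cos (\<beta> * t)) * (v e \<bullet> e)) \<le> r * (\<eta> * 2)" by linarith
    then have up: "(1 - cos (\<beta> * t)) * (v e \<bullet> e) \<le> \<eta> * 2" using r_pos by simp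
    \<comment> \<open>The phase runs from about \<open>pi / 2\<close> to about \<open>pi\<close>. At
      the lower end the uncertainty of the half-period shifts it by at most
      \<open>\<beta> * \<kappa> / 4\<close>, hence by at most 1/4.\<close>
    have "cos (\<beta> * t) \<le> 1/4"
    proof (cases "\<beta> * t \<le> pi / 2")
      case True
      have "\<beta> * (T / 2) \<le> \<beta> * t" using t \<beta>_pos by (intro mult_left_mono) auto
      moreover have "\<beta> * (\<tau>0 - \<kappa> / 2) \<le> \<beta> * T"
      proof (rule mult_left_mono)
        show "\<tau>0 - \<kappa> / 2 \<le> T" using nb(5) by linarith
      qed (use \<beta>_pos in simp)
      moreover have "\<beta> * \<tau>0 = pi" using \<beta>_pos by (simp add: \<tau>0_def)
      ultimately have "\<bar>\<beta> * t - pi / 2\<bar> \<le> 1/4" using True small by (simp add: right_diff_distrib)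
      moreover have "\<bar>cos (\<beta> * t)\<bar> \<le> \<bar>\<beta> * t - pi / 2\<bar>"
        using abs_cos_diff_le[of "\<beta> * t" "pi / 2"] by simp
      ultimately show ?thesis by linarith
    next
      case False
      have "\<beta> * t \<le> \<beta> * (\<tau>0 + \<kappa> / 2)"
      proof (rule mult_left_mono)
        show "t \<le> \<tau>0 + \<kappa> / 2" using t nb(5) by linarith
      qed (use \<beta>_pos in simp)
      also have "\<dots> = pi + \<beta> * \<kappa> / 2" using \<beta>_pos by (simp add: \<tau>0_def algebra_simps)
      also have "\<dots> \<le> 3 * pi / 2" using small pi_gt3 by linarith
      finally have "cos (\<beta> * t - pi) \<ge> 0" using False by (intro cos_ge_zero) auto
      then show ?thesis by (simp add: cos_diff)
    qed
    then have "(3/4) * (1/2) \<le> (1 - cos (\<beta> * t)) * (v e \<bullet> e)" using ve by (intro mult_mono) auto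
    with up small(2) show False by simp
  qed
  show ?thesis
  proof (rule that[of "2 * T" Q])
    show "2 * T > 0" using T by simp
    show "\<bar>2 * T - 2 * \<tau>0\<bar> \<le> \<kappa>" using nb(5) by linarith
    show "norm (Q t) \<le> \<rho>" for t using flow_dataD(5)[OF flow nb(2) sub'[OF tw]] by (simp add: Q_def)
    show "\<not> (\<forall>t. Q (t + S) = Q t)" if "0 < S" "S < 2 * T" for S
      by (rule no_smaller_period[OF T(1) per ne that])
  qed (use sol per in auto)
qed

end

section \<open>Choice of the constants\<close>

context center begin

lemma flow_data_mono: "flow_data \<eta> \<rho> \<delta> u p \<Longrightarrow> 0 < \<delta>' \<Longrightarrow> \<delta>' \<le> \<delta> \<Longrightarrow> flow_data \<eta> \<rho> \<delta>' u p"
proof -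
  assume a: "flow_data \<eta> \<rho> \<delta> u p" "0 < \<delta>'" "\<delta>' \<le> \<delta>"
  have "cball (0::'a) \<delta>' \<subseteq> cball 0 \<delta>" using a by auto
  with a show ?thesis unfolding flow_data_def by blast
qed

lemma energy_data_mono: "energy_data \<eta> \<delta> \<Longrightarrow> \<delta>' \<le> \<delta> \<Longrightarrow> energy_data \<eta> \<delta>'"
  unfolding energy_data_def by (meson cball_subset_cball_iff mem_cball order_trans)

text \<open>The choices are not circular: \<open>K\<close> depends only on the linear flow, \<rho>
  on the field and on \<epsilon>, \<kappa> on \<open>K\<close> and \<epsilon>, and \<eta> on
  \<open>K\<close> and \<kappa>. The flow and energy estimates for this \<eta> then provide
  \<delta>, and the scale \<open>r\<close> is half of it.\<close>

theorem periodic_solution_near: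
  assumes \<epsilon>: "\<epsilon> > 0"
  obtains Q :: "real \<Rightarrow> 'a" and P where "P > 0" "\<bar>P - 2 * pi / \<beta>\<bar> < \<epsilon>" "\<And>t. norm (Q t) < \<epsilon>" "\<And>t. norm (Q t) < \<rho>0"
    "\<exists>Q'. \<forall>t. (Q has_vector_derivative Q' t) (at t) \<and> (Q' has_vector_derivative - g (Q t)) (at t)"
    "\<And>t. Q (t + P) = Q t" "\<And>S. 0 < S \<Longrightarrow> S < P \<Longrightarrow> \<not> (\<forall>t. Q (t + S) = Q t)"
proof -
  obtain K where K: "K \<ge> 1"
    "\<And>b t. b \<in> B \<Longrightarrow> t \<in> {0..L} \<Longrightarrow> \<bar>lin_cos (\<mu> b) t\<bar> \<le> K"
    "\<And>b t. b \<in> B \<Longrightarrow> t \<in> {0..L} \<Longrightarrow> \<bar>\<mu> b * lin_sin (\<mu> b) t\<bar> \<le> K"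
    "\<And>b. b \<in> B \<Longrightarrow> \<bar>\<mu> b\<bar> \<le> K"
    "\<And>b. b \<in> BW \<Longrightarrow> 1 / \<bar>\<mu> b * lin_sin (\<mu> b) \<tau>0\<bar> \<le> K"
    "\<And>b. b \<in> BW \<Longrightarrow> 1 / \<bar>lin_sin (\<mu> b) \<tau>0\<bar> \<le> K" "1 / \<beta>\<^sup>2 \<le> K" "\<beta> \<le> K"
    by (rule newton_constants) blast
  define N where "N = 2 + real (card B)"
  define k0 where "k0 = 16 + 8 * K\<^sup>2"
  have N: "N \<ge> 2" by (simp add: N_def)
  have Ke: "k0 > 0" by (simp add: k0_def add_pos_nonneg)
  obtain \<delta>1 where \<delta>1: "\<delta>1 > 0" "\<forall>x\<in>cball 0 \<delta>1. \<forall>y\<in>cball 0 \<delta>1. norm ((g x - diag \<mu> x) - (g y - diag \<mu> y)) \<le> 1 * norm (x - y)"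
    using small_Lipschitz[of 1] by auto
  have g_lip: "norm (g x - g y) \<le> (1 + K) * norm (x - y)" if "x \<in> cball 0 \<delta>1" "y \<in> cball 0 \<delta>1" for x y
  proof -
    have "g x - g y = ((g x - diag \<mu> x) - (g y - diag \<mu> y)) + diag \<mu> (x - y)" by (simp add: diag_diff)
    then have "norm (g x - g y) \<le> norm ((g x - diag \<mu> x) - (g y - diag \<mu> y)) + norm (diag \<mu> (x - y))"
      by (metis norm_triangle_ineq)
    also have "\<dots> \<le> 1 * norm (x - y) + K * norm (x - y)"
      using \<delta>1(2) that K(4) by (intro add_mono diag_bound) auto
    finally show ?thesis by (simp add: algebra_simps)
  qed
  have "\<exists>\<rho>b>0. b \<in> B \<longrightarrow> \<mu> b = 0 \<longrightarrow> (\<exists>A. linear A \<and> (\<forall>x. A x \<bullet> x = 0) \<and>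
      (\<forall>x\<in>ball 0 \<rho>0. g x \<bullet> (A x + b) = 0) \<and> (\<forall>x\<in>cball 0 \<rho>b. (2 * real (card B) + 1) * norm (A x) \<le> 1))" for b
  proof (cases "b \<in> B \<and> \<mu> b = 0")
    case True
    then obtain A where A: "linear A" "\<forall>x. A x \<bullet> x = 0" "\<forall>x\<in>ball 0 \<rho>0. g x \<bullet> (A x + b) = 0"
      using symmetry by blast
    obtain C where C: "C > 0" "\<And>x. norm (A x) \<le> C * norm x"
      using linear_bounded_pos[OF A(1)] by blast
    define c where "c = 2 * real (card B) + 1"
    have c: "c > 0" by (simp add: c_def)
    have "c * norm (A x) \<le> 1" if "x \<in> cball 0 (1 / (c * C))" for x
    proof -
      have "c * norm (A x) \<le> c * (C * norm x)" using C(2) c by (intro mult_left_mono) auto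
      also have "\<dots> \<le> c * (C * (1 / (c * C)))" using that c C(1) by (intro mult_left_mono) auto
      finally show ?thesis using c C(1) by simp
    qed
    then show ?thesis using A c C(1) unfolding c_def[symmetric] by (intro exI[of _ "1 / (c * C)"]) auto
  qed (auto intro: exI[of _ 1])
  then obtain \<rho>b where \<rho>b: "\<And>b. \<rho>b b > 0" "\<And>b. b \<in> B \<Longrightarrow> \<mu> b = 0 \<Longrightarrow> (\<exists>A. linear A \<and> (\<forall>x. A x \<bullet> x = 0) \<and>
      (\<forall>x\<in>ball 0 \<rho>0. g x \<bullet> (A x + b) = 0) \<and> (\<forall>x\<in>cball 0 (\<rho>b b). (2 * real (card B) + 1) * norm (A x) \<le> 1))"
    by metis
  define \<rho> where "\<rho> = Min (insert (\<rho>0 / 2) (insert (\<epsilon> / 2) (insert \<delta>1 (\<rho>b ` B))))"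
  have \<rho>: "\<rho> > 0" "\<rho> < \<rho>0" "\<rho> < \<epsilon>" "\<rho> \<le> \<delta>1" "\<And>b. b \<in> B \<Longrightarrow> \<rho> \<le> \<rho>b b"
  proof -
    have le: "\<rho> \<le> x" if "x \<in> insert (\<rho>0 / 2) (insert (\<epsilon> / 2) (insert \<delta>1 (\<rho>b ` B)))" for x
      unfolding \<rho>_def using that finite_B by (intro Min_le) auto
    show "\<rho> > 0" unfolding \<rho>_def using finite_B \<rho>0_pos \<epsilon> \<delta>1 \<rho>b(1) by (subst Min_gr_iff) auto
    show "\<rho> < \<rho>0" "\<rho> < \<epsilon>" using le[of "\<rho>0 / 2"] le[of "\<epsilon> / 2"] \<rho>0_pos \<epsilon> by auto
    show "\<rho> \<le> \<delta>1" "\<And>b. b \<in> B \<Longrightarrow> \<rho> \<le> \<rho>b b" using le by auto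
  qed
  \<comment> \<open>Since 48 is 3 times 16, \<kappa> contributes at most 1/16 to the contraction
    bound 1/8; the first entry of \<eta> below supplies the other half.\<close>
  define \<kappa> where "\<kappa> = Min {1, \<tau>0, \<epsilon> / 2, 1 / (48 * N * K\<^sup>2)}"
  have NK: "N * K\<^sup>2 > 0" "N * K > 0" using N K(1) by auto
  have \<kappa>: "\<kappa> > 0" "\<kappa> \<le> 1" "\<kappa> \<le> \<tau>0" "\<kappa> < \<epsilon>" "\<kappa> \<le> 1 / (48 * N * K\<^sup>2)"
    using \<tau>0_pos \<epsilon> NK by (auto simp: \<kappa>_def mult.assoc min_less_iff_disj)
  \<comment> \<open>The second entry serves \<open>small_center\<close>, the third
    \<open>small_variation\<close>; \<open>k0\<close> is the value that \<open>Ke\<close> takes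
    after interpretation.\<close>
  define \<eta> where "\<eta> = Min {1 / (48 * N * K\<^sup>2), \<kappa> / (4 * N * K), 1 / (192 * k0)}"
  have \<eta>: "\<eta> > 0" "\<eta> \<le> 1 / (48 * N * K\<^sup>2)" "\<eta> \<le> \<kappa> / (4 * N * K)" "\<eta> \<le> 1 / (192 * k0)"
    using \<kappa>(1) NK Ke by (auto simp: \<eta>_def mult.assoc)
  obtain \<delta>f u p where fd: "flow_data \<eta> \<rho> \<delta>f u p" using flow_data_exists[OF \<eta>(1) \<rho>(1)] .
  obtain \<delta>e where \<delta>e: "\<delta>e > 0" "energy_data \<eta> \<delta>e" using energy_data_exists[OF \<eta>(1)] .
  define \<delta> where "\<delta> = min \<delta>f \<delta>e"
  have \<delta>: "\<delta> > 0" "\<delta> \<le> \<delta>f" "\<delta> \<le> \<delta>e" using flow_dataD(2)[OF fd] \<delta>e by (auto simp: \<delta>_def)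
  have "N * K\<^sup>2 * (48 * \<kappa>) \<le> 1" "N * K\<^sup>2 * (48 * \<eta>) \<le> 1"
    using \<kappa>(5) \<eta>(2) NK by (simp_all add: pos_le_divide_eq mult_ac)
  then have s1: "N * (K\<^sup>2 * (3 * \<kappa> + 3 * \<eta>)) \<le> 1 / 8" by (simp add: algebra_simps)
  have s2: "N * (\<eta> * K) \<le> \<kappa> / 4" using \<eta>(3) N K(1) by (simp add: pos_le_divide_eq mult_ac)
  have s3: "192 * \<eta> * k0 \<le> 1" using \<eta>(4) Ke by (simp add: pos_le_divide_eq mult_ac)
  interpret scaled_center B \<mu> g U \<beta> \<rho>0 K \<eta> \<rho> \<delta> "\<delta> / 2" \<kappa> u p
    by unfold_locales
      (fact K | use \<delta> \<rho>(2) \<kappa>(1-3) s1[unfolded N_def] s2[unfolded N_def] flow_data_mono[OF fd] energy_data_mono[OF \<delta>e(2)] in auto)+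
  interpret scaled_center_symmetric B \<mu> g U \<beta> \<rho>0 K \<eta> \<rho> \<delta> "\<delta> / 2" \<kappa> u p "1 + K"
  proof unfold_locales
    show "1 + K \<ge> 0" using K(1) by simp
    show "norm (g x - g y) \<le> (1 + K) * norm (x - y)" if "x \<in> cball 0 \<rho>" "y \<in> cball 0 \<rho>" for x y
      using that \<rho>(4) by (intro g_lip) auto
    show "192 * \<eta> * Ke \<le> 1" using s3 by (simp add: Ke_def k0_def)
    show "\<exists>A. linear A \<and> (\<forall>x. A x \<bullet> x = 0) \<and> (\<forall>x\<in>ball 0 \<rho>0. g x \<bullet> (A x + b) = 0) \<and>
        (\<forall>x\<in>cball 0 \<rho>. (2 * real (card B) + 1) * norm (A x) \<le> 1)" if b: "b \<in> B" "\<mu> b = 0" for b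
    proof -
      have "cball (0::'a) \<rho> \<subseteq> cball 0 (\<rho>b b)" using \<rho>(5)[OF b(1)] by auto
      with \<rho>b(2)[OF b] show ?thesis by blast
    qed
  qed
  obtain Q P where "P > 0" "\<bar>P - 2 * \<tau>0\<bar> \<le> \<kappa>" "\<And>t. norm (Q t) \<le> \<rho>"
    "\<exists>Q'. \<forall>t. (Q has_vector_derivative Q' t) (at t) \<and> (Q' has_vector_derivative - g (Q t)) (at t)"
    "\<And>t. Q (t + P) = Q t" "\<And>S. 0 < S \<Longrightarrow> S < P \<Longrightarrow> \<not> (\<forall>t. Q (t + S) = Q t)"
    using periodic_solution by metis
  then show ?thesis using \<rho> \<kappa>(4) by (intro that[of P Q]) (auto simp: \<tau>0_def intro: le_less_trans)
qed

end

section \<open>Infinitesimal generators of a compact matrix group\<close>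

lemma norm_orthogonal_vec:
  fixes h :: "real^'n^'n"
  assumes "orthogonal_matrix h"
  shows "norm (h *v x) = norm x"
  using orthogonal_transformation_norm[of "(*v) h"] assms
  by (simp add: orthogonal_transformation_matrix matrix_of_matrix_vector_mul)

lemma matrix_diff_ldistrib: "(A :: real^'n^'n) ** (B - C) = A ** B - A ** C"
  and matrix_diff_rdistrib: "(B - C) ** (A :: real^'n^'n) = B ** A - C ** A"
  by (simp_all add: vec_eq_iff matrix_matrix_mult_def algebra_simps sum_subtractf)

text \<open>The norm of a matrix in this type is the Frobenius norm, and right multiplication acts
  on each row by the transposed orthogonal matrix.\<close>

lemma norm_mult_orthogonal:
  fixes A h :: "real^'n^'n"
  assumes "orthogonal_matrix h"
  shows "norm (A ** h) = norm A"
proof -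
  have "norm ((A ** h) $ i) = norm (A $ i)" for i
  proof -
    have "(A ** h) $ i = transpose h *v (A $ i)"
      by (simp add: vec_eq_iff matrix_matrix_mult_def matrix_vector_mult_def transpose_def mult.commute)
    then show ?thesis using norm_orthogonal_vec[of "transpose h"] assms by (simp add: orthogonal_matrix_transpose)
  qed
  then show ?thesis by (simp add: norm_vec_def)
qed

lemma matrix_mult_bound:
  obtains C where "C > 0" "\<And>(A :: real^'n^'n) (B :: real^'n^'n). norm (A ** B) \<le> C * norm A * norm B"
proof -
  have "bounded_bilinear ((**) :: real^'n^'n \<Rightarrow> real^'n^'n \<Rightarrow> real^'n^'n)"
    by (intro bilinear_conv_bounded_bilinear[THEN iffD1])
      (auto simp: bilinear_def vec_eq_iff matrix_matrix_mult_def algebra_simps sum.distrib sum_distrib_left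
        intro!: linearI)
  from bounded_bilinear.pos_bounded[OF this] obtain C
    where C: "C > 0" "\<forall>(A :: real^'n^'n) (B :: real^'n^'n). norm (A ** B) \<le> norm A * norm B * C" by auto
  show ?thesis
  proof (rule that[OF C(1)])
    show "norm (A ** B) \<le> C * norm A * norm B" for A B :: "real^'n^'n"
      using C(2)[rule_format, of A B] by (simp only: mult_ac)
  qed
qed

lemma bounded_linear_matrix_vector_left: "bounded_linear (\<lambda>A :: real^'n^'n. A *v x)"
  by (intro linear_conv_bounded_linear[THEN iffD1] linearI)
    (simp_all add: matrix_vector_mult_add_rdistrib scaleR_matrix_vector_assoc)

lemma compact_convergent_subsequence:
  fixes f :: "nat \<Rightarrow> 'a::metric_space"
  assumes "compact S" "\<And>k. f k \<in> S"
  obtains l r where "l \<in> S" "strict_mono (r :: nat \<Rightarrow> nat)" "(f \<circ> r) \<longlonglongrightarrow> l"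
proof -
  have "seq_compact S" "\<forall>n. f n \<in> S" using assms by (simp_all add: compact_eq_seq_compact_metric)
  then obtain l r where "l \<in> S" "strict_mono (r :: nat \<Rightarrow> nat)" "(f \<circ> r) \<longlonglongrightarrow> l"
    by (rule seq_compactE)
  then show ?thesis by (rule that)
qed

locale matrix_group =
  fixes H :: "(real^'n^'n) set"
  assumes one_H: "mat 1 \<in> H"
    and mult_H: "A \<in> H \<Longrightarrow> B \<in> H \<Longrightarrow> A ** B \<in> H"
    and transpose_H: "A \<in> H \<Longrightarrow> transpose A \<in> H"
    and orthogonal_H: "A \<in> H \<Longrightarrow> orthogonal_matrix A"
    and compact_H: "compact H"
begin

primrec mpow :: "real^'n^'n \<Rightarrow> nat \<Rightarrow> real^'n^'n" where
  "mpow h 0 = mat 1"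
| "mpow h (Suc n) = mpow h n ** h"

lemma mpow_H: "h \<in> H \<Longrightarrow> mpow h n \<in> H"
  by (induction n) (auto intro: one_H mult_H)

lemma norm_mpow_diff:
  assumes "h \<in> H"
  shows "norm (mpow h n - mat 1) \<le> real n * norm (h - mat 1)"
proof (induction n)
  case (Suc n)
  have "mpow h (Suc n) - mat 1 = (mpow h n - mat 1) ** h + (h - mat 1)"
    by (simp add: matrix_diff_rdistrib)
  then have "norm (mpow h (Suc n) - mat 1) \<le> norm ((mpow h n - mat 1) ** h) + norm (h - mat 1)"
    by (metis norm_triangle_ineq)
  also have "norm ((mpow h n - mat 1) ** h) = norm (mpow h n - mat 1)"
    by (rule norm_mult_orthogonal[OF orthogonal_H[OF assms]])
  finally show ?case using Suc by (simp add: algebra_simps)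
qed simp

text \<open>Second-order bound for powers near the identity. The increment is the product of
  \<open>mpow h n - mat 1\<close> with \<open>h - mat 1\<close>, and \<open>n^2 + n\<close> is at
  most \<open>(n + 1)^2\<close>. Orthogonality prevents exponential growth in
  \<open>n\<close>.\<close>

lemma norm_mpow_linear:
  assumes h: "h \<in> H" and C: "C > 0" "\<And>(A :: real^'n^'n) (B :: real^'n^'n). norm (A ** B) \<le> C * norm A * norm B"
  shows "norm (mpow h n - mat 1 - real n *\<^sub>R (h - mat 1)) \<le> C * (real n * norm (h - mat 1))\<^sup>2"
proof (induction n)
  case (Suc n)
  let ?t = "norm (h - mat 1)"
  have eq: "mpow h (Suc n) - mat 1 - real (Suc n) *\<^sub>R (h - mat 1)
      = (mpow h n - mat 1 - real n *\<^sub>R (h - mat 1)) + (mpow h n - mat 1) ** (h - mat 1)"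
    by (simp add: matrix_diff_rdistrib matrix_diff_ldistrib algebra_simps)
  have "norm (mpow h (Suc n) - mat 1 - real (Suc n) *\<^sub>R (h - mat 1))
      \<le> C * (real n * ?t)\<^sup>2 + norm ((mpow h n - mat 1) ** (h - mat 1))"
    unfolding eq by (rule order.trans[OF norm_triangle_ineq add_right_mono[OF Suc]])
  also have "norm ((mpow h n - mat 1) ** (h - mat 1)) \<le> C * (real n * ?t) * ?t"
    using norm_mpow_diff[OF h, of n] C(1) by (intro order.trans[OF C(2)] mult_right_mono mult_left_mono) auto
  also have "C * (real n * ?t)\<^sup>2 + C * (real n * ?t) * ?t = (C * ?t\<^sup>2) * (real n * real n + real n)"
    by (simp add: power2_eq_square algebra_simps)
  also have "\<dots> \<le> (C * ?t\<^sup>2) * ((real n + 1) * (real n + 1))"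
    using C(1) by (intro mult_left_mono) (auto simp: algebra_simps)
  also have "\<dots> = C * (real (Suc n) * ?t)\<^sup>2" by (simp add: power2_eq_square algebra_simps)
  finally show ?case by simp
qed simp

lemma norm_mpow_vec:
  assumes "h \<in> H"
  shows "norm (mpow h n *v q - q) \<le> real n * norm (h *v q - q)"
proof (induction n)
  case (Suc n)
  have "mpow h (Suc n) *v q - q = mpow h n *v (h *v q - q) + (mpow h n *v q - q)"
    by (simp add: matrix_vector_mul_assoc[symmetric] matrix_vector_mult_diff_distrib)
  then have "norm (mpow h (Suc n) *v q - q) \<le> norm (mpow h n *v (h *v q - q)) + norm (mpow h n *v q - q)"
    by (metis norm_triangle_ineq)
  also have "norm (mpow h n *v (h *v q - q)) = norm (h *v q - q)"
    by (rule norm_orthogonal_vec[OF orthogonal_H[OF mpow_H[OF assms]]])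
  finally show ?case using Suc by (simp add: algebra_simps)
qed simp

text \<open>A substitute for \<open>exp (t A) \<in> H\<close>: limits of the powers \<open>h k ^ \<lfloor>t / norm (h k - 1)\<rfloor>\<close>.\<close>

lemma approximate_one_parameter_subgroup:
  assumes C: "C > 0" "\<And>(A :: real^'n^'n) (B :: real^'n^'n). norm (A ** B) \<le> C * norm A * norm B"
    and h: "\<And>k. h k \<in> H" and t0: "\<And>k. norm (h k - mat 1) > 0" "(\<lambda>k. norm (h k - mat 1)) \<longlonglongrightarrow> 0"
    and A: "(\<lambda>k. (1 / norm (h k - mat 1)) *\<^sub>R (h k - mat 1)) \<longlonglongrightarrow> A"
    and q: "(\<lambda>k. (1 / norm (h k - mat 1)) *\<^sub>R (h k *v q - q)) \<longlonglongrightarrow> 0"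
    and t: "t \<ge> 0"
  shows "\<exists>X\<in>H. X *v q = q \<and> norm (X - mat 1 - t *\<^sub>R A) \<le> C * t\<^sup>2"
proof -
  define d where "d = (\<lambda>k. norm (h k - mat 1))"
  \<comment> \<open>So many factors that the accumulated displacement \<open>n k * d k\<close> falls
    short of \<open>t\<close> by at most \<open>d k\<close>, and therefore tends to
    \<open>t\<close>.\<close>
  define n where "n = (\<lambda>k. nat \<lfloor>t / d k\<rfloor>)"
  have d: "d k > 0" for k using t0 by (simp add: d_def)
  have n: "real (n k) \<le> t / d k" "t / d k < real (n k) + 1" for k
    using t d[of k] unfolding n_def by (auto simp: of_nat_nat)
  have nd: "real (n k) * d k \<le> t" "t - d k \<le> real (n k) * d k" for k
    using n[of k] d[of k] by (simp_all add: field_simps)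
  have nd_lim: "(\<lambda>k. real (n k) * d k) \<longlonglongrightarrow> t"
  proof (rule tendsto_sandwich[where h="\<lambda>_. t"])
    show "(\<lambda>k. t - d k) \<longlonglongrightarrow> t" using tendsto_diff[OF tendsto_const t0(2), of t] by (simp add: d_def)
  qed (use nd in \<open>auto intro!: always_eventually\<close>)
  obtain X r where X: "X \<in> H" "strict_mono r" "((\<lambda>k. mpow (h k) (n k)) \<circ> r) \<longlonglongrightarrow> X"
    by (rule compact_convergent_subsequence[OF compact_H, of "\<lambda>k. mpow (h k) (n k)"]) (rule mpow_H[OF h])
  have sub: "(f \<longlonglongrightarrow> l) \<Longrightarrow> (f \<circ> r) \<longlonglongrightarrow> l" for f :: "nat \<Rightarrow> 'b::topological_space" and l
    using X(2) by (rule LIMSEQ_subseq_LIMSEQ[rotated])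
  have "(\<lambda>k. mpow (h (r k)) (n (r k)) *v q) \<longlonglongrightarrow> X *v q"
    using bounded_linear.tendsto[OF bounded_linear_matrix_vector_left X(3)] by (simp add: o_def)
  moreover have "(\<lambda>k. mpow (h (r k)) (n (r k)) *v q - q) \<longlonglongrightarrow> 0"
  proof -
    have "(\<lambda>k. (real (n k) * d k) * norm ((1 / d k) *\<^sub>R (h k *v q - q))) \<longlonglongrightarrow> t * 0"
      using nd_lim tendsto_norm_zero[OF q] unfolding d_def by (rule tendsto_mult)
    moreover have "(real (n k) * d k) * norm ((1 / d k) *\<^sub>R (h k *v q - q)) = real (n k) * norm (h k *v q - q)" for k
      using d[of k] by simp
    ultimately have "(\<lambda>k. real (n k) * norm (h k *v q - q)) \<longlonglongrightarrow> 0" by simp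
    then have "(\<lambda>k. mpow (h k) (n k) *v q - q) \<longlonglongrightarrow> 0"
      by (rule Lim_null_comparison[rotated]) (auto intro!: always_eventually norm_mpow_vec h)
    from sub[OF this] show ?thesis by (simp add: o_def)
  qed
  ultimately have "X *v q - q = 0"
    using LIMSEQ_unique tendsto_diff[OF _ tendsto_const] by blast
  then have Xq: "X *v q = q" by simp
  have "(\<lambda>k. (real (n k) * d k) *\<^sub>R ((1 / d k) *\<^sub>R (h k - mat 1))) \<longlonglongrightarrow> t *\<^sub>R A"
    using nd_lim A unfolding d_def by (rule tendsto_scaleR)
  moreover have "(real (n k) * d k) *\<^sub>R ((1 / d k) *\<^sub>R (h k - mat 1)) = real (n k) *\<^sub>R (h k - mat 1)" for k
    using d[of k] by simp
  ultimately have "(\<lambda>k. real (n k) *\<^sub>R (h k - mat 1)) \<longlonglongrightarrow> t *\<^sub>R A" by (simp only:)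
  from sub[OF this]
  have lim: "(\<lambda>k. mpow (h (r k)) (n (r k)) - mat 1 - real (n (r k)) *\<^sub>R (h (r k) - mat 1)) \<longlonglongrightarrow> X - mat 1 - t *\<^sub>R A"
    using X(3) by (intro tendsto_diff tendsto_const) (simp_all add: o_def)
  have "norm (X - mat 1 - t *\<^sub>R A) \<le> C * t\<^sup>2"
  proof (rule LIMSEQ_le_const2[OF tendsto_norm[OF lim]], intro exI allI impI)
    fix k
    have "norm (mpow (h (r k)) (n (r k)) - mat 1 - real (n (r k)) *\<^sub>R (h (r k) - mat 1)) \<le> C * (real (n (r k)) * d (r k))\<^sup>2"
      unfolding d_def by (rule norm_mpow_linear[OF h C])
    also have "\<dots> \<le> C * t\<^sup>2" using nd[of "r k"] d[of "r k"] C(1) by (intro mult_left_mono power_mono) auto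
    finally show "norm (mpow (h (r k)) (n (r k)) - mat 1 - real (n (r k)) *\<^sub>R (h (r k) - mat 1)) \<le> C * t\<^sup>2" .
  qed
  with X(1) Xq show ?thesis by blast
qed

text \<open>Tangent vectors of \<open>H\<close> at the identity, as limits of rescaled secants: the
  elements of the Lie algebra without an exponential map.\<close>

definition generator :: "real^'n^'n \<Rightarrow> bool" where
  "generator A \<longleftrightarrow> (\<exists>h s. (\<forall>k. h k \<in> H \<and> s k > 0) \<and> s \<longlonglongrightarrow> 0 \<and>
     (\<lambda>k::nat. (1 / s k) *\<^sub>R (h k - mat 1)) \<longlonglongrightarrow> A)"

lemma minimal_representative:
  assumes "h \<in> H"
  obtains h' where "h' \<in> H" "h' *v q = h *v q"
    "\<And>X. X \<in> H \<Longrightarrow> X *v q = h *v q \<Longrightarrow> norm (h' - mat 1) \<le> norm (X - mat 1)"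
proof -
  let ?S = "H \<inter> {X. X *v q = h *v q}"
  have "closed {X :: real^'n^'n. X *v q = h *v q}"
    using linear_continuous_on[OF bounded_linear_matrix_vector_left]
    by (intro closed_Collect_eq continuous_on_const) auto
  then have "compact ?S" using compact_H by (rule compact_Int_closed[rotated])
  moreover have "?S \<noteq> {}" using assms by blast
  ultimately obtain h' where "h' \<in> ?S" "\<forall>X\<in>?S. norm (h' - mat 1) \<le> norm (X - mat 1)"
    using continuous_attains_inf[of ?S "\<lambda>X. norm (X - mat 1)"] by (force intro: continuous_intros)
  then show ?thesis by (intro that[of h']) auto
qed

text \<open>\<open>h ** transpose X\<close> acts on \<open>q\<close> as \<open>h\<close> does, and
  right multiplication by an orthogonal matrix preserves the norm. So an element closest to the
  identity in its coset is at least as far from every other element of the stabiliser.\<close>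

lemma minimal_representative_le:
  assumes min: "\<And>X. X \<in> H \<Longrightarrow> X *v q = h *v q \<Longrightarrow> norm (h - mat 1) \<le> norm (X - mat 1)"
    and "h \<in> H" "X \<in> H" "X *v q = q"
  shows "norm (h - mat 1) \<le> norm (h - X)"
proof -
  have XX: "X ** transpose X = mat 1" "transpose X ** X = mat 1"
    using orthogonal_H[OF assms(3)] by (auto simp: orthogonal_matrix_def)
  have "transpose X *v q = transpose X *v (X *v q)" by (simp add: assms(4))
  also have "\<dots> = q" by (simp only: matrix_vector_mul_assoc XX matrix_vector_mul_lid)
  finally have "(h ** transpose X) *v q = h *v q" by (simp flip: matrix_vector_mul_assoc)
  then have "norm (h - mat 1) \<le> norm (h ** transpose X - mat 1)"
    using assms by (intro min mult_H transpose_H) auto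
  also have "h ** transpose X - mat 1 = (h - X) ** transpose X"
    by (simp add: matrix_diff_rdistrib XX)
  also have "norm \<dots> = norm (h - X)"
    by (rule norm_mult_orthogonal[OF orthogonal_H[OF transpose_H[OF assms(3)]]])
  finally show ?thesis .
qed

text \<open>Points of the orbit are lifted to group elements closest to the identity. The difficulty
  is to bound the distance of these lifts from the identity by a multiple of \<open>s k\<close>;
  after that a subsequence of their rescaled secants converges to the generator.\<close>

theorem tangent_vector_generator:
  assumes m: "\<And>k. \<exists>h\<in>H. m k = h *v q" and s: "\<And>k. s k > 0" "s \<longlonglongrightarrow> 0"
    and c: "(\<lambda>k::nat. (1 / s k) *\<^sub>R (m k - q)) \<longlonglongrightarrow> c"
  obtains A where "generator A" "A *v q = c"
proof -
  obtain C where C: "C > 0" "\<And>(A :: real^'n^'n) (B :: real^'n^'n). norm (A ** B) \<le> C * norm A * norm B"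
    using matrix_mult_bound by blast
  have "\<exists>h\<in>H. m k = h *v q \<and> (\<forall>X\<in>H. X *v q = h *v q \<longrightarrow> norm (h - mat 1) \<le> norm (X - mat 1))" for k
    using m[of k] minimal_representative[of _ q] by (metis (no_types, lifting))
  then obtain h0 where h0: "\<And>k. h0 k \<in> H" "\<And>k. m k = h0 k *v q"
    "\<And>k X. X \<in> H \<Longrightarrow> X *v q = h0 k *v q \<Longrightarrow> norm (h0 k - mat 1) \<le> norm (X - mat 1)" by metis
  obtain hl r where hl: "hl \<in> H" "strict_mono r" "(h0 \<circ> r) \<longlonglongrightarrow> hl"
    by (rule compact_convergent_subsequence[OF compact_H h0(1)])
  have sub: "(f \<longlonglongrightarrow> l) \<Longrightarrow> (\<lambda>k. f (r k)) \<longlonglongrightarrow> l" for f :: "nat \<Rightarrow> 'b::topological_space" and l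
    using LIMSEQ_subseq_LIMSEQ[OF _ hl(2), of f l] by (simp add: o_def)
  define h where "h = (\<lambda>k. h0 (r k))"
  define s' where "s' = (\<lambda>k. s (r k))"
  have h: "h k \<in> H" for k using h0(1) by (simp add: h_def)
  have s': "s' k > 0" for k using s by (simp add: s'_def)
  have s'0: "s' \<longlonglongrightarrow> 0" unfolding s'_def by (rule sub[OF s(2)])
  have hc: "(\<lambda>k. (1 / s' k) *\<^sub>R (h k *v q - q)) \<longlonglongrightarrow> c"
    using sub[OF c] by (simp add: s'_def h_def h0(2))
  have hmin: "norm (h k - mat 1) \<le> norm (h k - X)" if "X \<in> H" "X *v q = q" for k X
    by (rule minimal_representative_le[OF _ h that]) (use h0(3) in \<open>simp add: h_def\<close>)
  have hlq: "hl *v q = q"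
  proof -
    have "(\<lambda>k. s' k *\<^sub>R ((1 / s' k) *\<^sub>R (h k *v q - q))) \<longlonglongrightarrow> 0 *\<^sub>R c"
      by (rule tendsto_scaleR[OF s'0 hc])
    moreover have "s' k *\<^sub>R ((1 / s' k) *\<^sub>R (h k *v q - q)) = h k *v q - q" for k using s'[of k] by simp
    ultimately have "(\<lambda>k. h k *v q - q) \<longlonglongrightarrow> 0" by simp
    moreover have "(\<lambda>k. h k *v q - q) \<longlonglongrightarrow> hl *v q - q"
      using bounded_linear.tendsto[OF bounded_linear_matrix_vector_left hl(3)]
      by (intro tendsto_diff tendsto_const) (simp add: h_def o_def)
    ultimately show ?thesis using LIMSEQ_unique by fastforce
  qed
  have h1: "(\<lambda>k. norm (h k - mat 1)) \<longlonglongrightarrow> 0"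
  proof (rule tendsto_sandwich[where f="\<lambda>_. 0"])
    have "(\<lambda>k. h k - hl) \<longlonglongrightarrow> hl - hl" using hl(3) by (intro tendsto_diff tendsto_const) (simp add: h_def o_def)
    then show "(\<lambda>k. norm (h k - hl)) \<longlonglongrightarrow> 0" using tendsto_norm_zero by force
  qed (use hmin[OF hl(1) hlq] in \<open>auto intro!: always_eventually\<close>)
  \<comment> \<open>Otherwise the lifts move much faster than the orbit points. Their normalised
    direction \<open>A\<close> is then tangent to the stabiliser, and dividing out a stabiliser
    element near \<open>t *\<^sub>R A\<close> would bring a lift closer to the identity, against
    minimality.\<close>
  have "\<exists>K. \<exists>\<^sub>F k in sequentially. norm (h k - mat 1) \<le> K * s' k"
  proof (rule ccontr)
    assume "\<not> ?thesis"
    then have big: "\<forall>\<^sub>F k in sequentially. norm (h k - mat 1) > K * s' k" for K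
      by (simp add: frequently_def not_le)
    define d where "d = (\<lambda>k. norm (h k - mat 1))"
    obtain N where N: "\<And>k. k \<ge> N \<Longrightarrow> d k > 0"
      using big[of 0] by (auto simp: eventually_sequentially d_def)
    define hN where "hN = (\<lambda>k. h (k + N))"
    define dN where "dN = (\<lambda>k. d (k + N))"
    have dN: "dN k > 0" for k using N by (simp add: dN_def)
    have "(\<lambda>k. s' k / d k) \<longlonglongrightarrow> 0"
    proof (rule LIMSEQ_I)
      fix \<epsilon> :: real assume \<epsilon>: "\<epsilon> > 0"
      obtain N' where N': "\<And>k. k \<ge> N' \<Longrightarrow> d k > (1 / \<epsilon>) * s' k"
        using big[of "1 / \<epsilon>"] by (auto simp: eventually_sequentially d_def)
      have "norm (s' k / d k - 0) < \<epsilon>" if "k \<ge> max N N'" for k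
        using N[of k] N'[of k] that \<epsilon> s'[of k] by (simp add: field_simps)
      then show "\<exists>no. \<forall>n\<ge>no. norm (s' n / d n - 0) < \<epsilon>" by blast
    qed
    from tendsto_scaleR[OF this hc] have "(\<lambda>k. (s' k / d k) *\<^sub>R ((1 / s' k) *\<^sub>R (h k *v q - q))) \<longlonglongrightarrow> 0" by simp
    moreover have "(s' k / d k) *\<^sub>R ((1 / s' k) *\<^sub>R (h k *v q - q)) = (1 / d k) *\<^sub>R (h k *v q - q)" for k
      using s'[of k] by simp
    ultimately have q0: "(\<lambda>k. (1 / d k) *\<^sub>R (h k *v q - q)) \<longlonglongrightarrow> 0" by (simp only:)
    have "(1 / dN k) *\<^sub>R (hN k - mat 1) \<in> sphere 0 1" for k
      using dN[of k] by (simp add: dN_def hN_def d_def)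
    from compact_convergent_subsequence[OF compact_sphere this]
    obtain A r' where A: "A \<in> sphere 0 1" "strict_mono r'" "((\<lambda>k. (1 / dN k) *\<^sub>R (hN k - mat 1)) \<circ> r') \<longlonglongrightarrow> A" .
    define f where "f = (\<lambda>k. r' k + N)"
    have f: "strict_mono f" using A(2) by (auto simp: f_def strict_mono_def)
    have subf: "(x \<longlonglongrightarrow> l) \<Longrightarrow> (\<lambda>k. x (f k)) \<longlonglongrightarrow> l" for x :: "nat \<Rightarrow> 'b::topological_space" and l
      using LIMSEQ_subseq_LIMSEQ[OF _ f, of x l] by (simp add: o_def)
    have df: "d (f k) > 0" for k using N by (simp add: f_def)
    have Af: "(\<lambda>k. (1 / d (f k)) *\<^sub>R (h (f k) - mat 1)) \<longlonglongrightarrow> A"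
      using A(3) by (simp add: o_def dN_def hN_def f_def)
    have d0: "(\<lambda>k. d (f k)) \<longlonglongrightarrow> 0" using subf[OF h1] by (simp add: d_def)
    have X: "\<exists>X\<in>H. X *v q = q \<and> norm (X - mat 1 - t *\<^sub>R A) \<le> C * t\<^sup>2" if "t \<ge> 0" for t
      by (rule approximate_one_parameter_subgroup[of C "\<lambda>k. h (f k)", OF C h df[unfolded d_def]
            d0[unfolded d_def] Af[unfolded d_def] subf[OF q0, unfolded d_def] that])
    have "(\<lambda>k. norm ((1 / d (f k)) *\<^sub>R (h (f k) - mat 1) - A) + C * d (f k)) \<longlonglongrightarrow> 0 + C * 0"
      using Af LIM_zero_iff[THEN iffD2, OF Af] by (intro tendsto_add tendsto_norm_zero tendsto_mult tendsto_const d0)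
    then have "\<forall>\<^sub>F k in sequentially. norm ((1 / d (f k)) *\<^sub>R (h (f k) - mat 1) - A) + C * d (f k) < 1"
      by (rule order_tendstoD) simp
    then obtain k where k: "norm ((1 / d (f k)) *\<^sub>R (h (f k) - mat 1) - A) + C * d (f k) < 1"
      by (auto simp: eventually_sequentially)
    \<comment> \<open>At this \<open>t\<close> the stabiliser element \<open>X\<close> differs from
      the lift by strictly less than \<open>t\<close>: the direction error and the quadratic error
      together are below 1 after division by \<open>t\<close>.\<close>
    define t where "t = d (f k)"
    have t: "t > 0" using df by (simp add: t_def)
    obtain X where X: "X \<in> H" "X *v q = q" "norm (X - mat 1 - t *\<^sub>R A) \<le> C * t\<^sup>2" using X t by (meson less_imp_le)
    have "t \<le> norm (h (f k) - X)" using hmin[OF X(1,2), of "f k"] by (simp add: t_def d_def)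
    also have "h (f k) - X = t *\<^sub>R ((1 / t) *\<^sub>R (h (f k) - mat 1) - A) - (X - mat 1 - t *\<^sub>R A)"
      using t by (simp add: scaleR_diff_right)
    also have "norm \<dots> \<le> t * norm ((1 / t) *\<^sub>R (h (f k) - mat 1) - A) + C * t\<^sup>2"
      using norm_triangle_ineq4[of "t *\<^sub>R ((1 / t) *\<^sub>R (h (f k) - mat 1) - A)" "X - mat 1 - t *\<^sub>R A"] X(3) t
      by (simp del: scaleR_scaleR add: abs_of_pos)
    also have "\<dots> = t * (norm ((1 / t) *\<^sub>R (h (f k) - mat 1) - A) + C * t)" by (simp add: power2_eq_square algebra_simps)
    also have "\<dots> < t * 1" using k t by (intro mult_strict_left_mono) (auto simp: t_def)
    finally show False by simp
  qed
  then obtain K where inf: "infinite {k. norm (h k - mat 1) \<le> K * s' k}"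
    by (auto simp: INFM_iff_infinite simp flip: cofinite_eq_sequentially)
  obtain r1 :: "nat \<Rightarrow> nat" where r1: "strict_mono r1" "\<And>k. norm (h (r1 k) - mat 1) \<le> K * s' (r1 k)"
    using infinite_enumerate[OF inf] by auto
  have "(1 / s' (r1 k)) *\<^sub>R (h (r1 k) - mat 1) \<in> cball 0 K" for k
    using r1(2)[of k] s'[of "r1 k"] by (simp add: pos_divide_le_eq)
  from compact_convergent_subsequence[OF compact_cball this]
  obtain A r2 where A: "strict_mono r2" "((\<lambda>k. (1 / s' (r1 k)) *\<^sub>R (h (r1 k) - mat 1)) \<circ> r2) \<longlonglongrightarrow> A" .
  define f where "f = r1 \<circ> r2"
  have f: "strict_mono f" unfolding f_def by (rule strict_mono_o[OF r1(1) A(1)])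
  have Af: "(\<lambda>k. (1 / s' (f k)) *\<^sub>R (h (f k) - mat 1)) \<longlonglongrightarrow> A" using A(2) by (simp add: f_def o_def)
  have "generator A"
    unfolding generator_def
    using h s' Af LIMSEQ_subseq_LIMSEQ[OF s'0 f] by (intro exI[of _ "h \<circ> f"] exI[of _ "s' \<circ> f"]) (simp add: o_def)
  moreover have "A *v q = c"
  proof -
    have "((1 / s' (f k)) *\<^sub>R (h (f k) - mat 1)) *v q = (1 / s' (f k)) *\<^sub>R (h (f k) *v q - q)" for k
      by (simp add: scaleR_matrix_vector_assoc[symmetric] matrix_vector_mult_diff_rdistrib)
    with bounded_linear.tendsto[OF bounded_linear_matrix_vector_left Af, of q]
    have "(\<lambda>k. (1 / s' (f k)) *\<^sub>R (h (f k) *v q - q)) \<longlonglongrightarrow> A *v q" by simp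
    moreover have "(\<lambda>k. (1 / s' (f k)) *\<^sub>R (h (f k) *v q - q)) \<longlonglongrightarrow> c"
      using LIMSEQ_subseq_LIMSEQ[OF hc f] by (simp add: o_def)
    ultimately show ?thesis by (rule LIMSEQ_unique)
  qed
  ultimately show ?thesis by (rule that)
qed

lemma generator_vec:
  assumes "generator A"
  obtains h s where "\<And>k. h k \<in> H" "\<And>k. s k > 0" "s \<longlonglongrightarrow> 0"
    "\<And>x. (\<lambda>k::nat. (1 / s k) *\<^sub>R (h k *v x - x)) \<longlonglongrightarrow> A *v x" "\<And>x. (\<lambda>k. h k *v x - x) \<longlonglongrightarrow> 0"
proof -
  obtain h s where h: "\<And>k. h k \<in> H" "\<And>k. s k > 0" "s \<longlonglongrightarrow> 0"
    and A: "(\<lambda>k::nat. (1 / s k) *\<^sub>R (h k - mat 1)) \<longlonglongrightarrow> A"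
    using assms unfolding generator_def by blast
  have lim: "(\<lambda>k. (1 / s k) *\<^sub>R (h k *v x - x)) \<longlonglongrightarrow> A *v x" for x
  proof -
    have "((1 / s k) *\<^sub>R (h k - mat 1)) *v x = (1 / s k) *\<^sub>R (h k *v x - x)" for k
      by (simp add: scaleR_matrix_vector_assoc[symmetric] matrix_vector_mult_diff_rdistrib)
    with bounded_linear.tendsto[OF bounded_linear_matrix_vector_left A, of x] show ?thesis by simp
  qed
  have "(\<lambda>k. h k *v x - x) \<longlonglongrightarrow> 0" for x
  proof -
    have "s k *\<^sub>R ((1 / s k) *\<^sub>R (h k *v x - x)) = h k *v x - x" for k using h(2)[of k] by simp
    with tendsto_scaleR[OF h(3) lim, of x] show ?thesis by simp
  qed
  with h lim show ?thesis by (rule that)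
qed

text \<open>Orthogonal matrices preserve \<open>norm x\<close>, so the increment
  \<open>h k *v x - x\<close> paired with \<open>x\<close> is of second order and vanishes in the
  limit after rescaling.\<close>

lemma generator_skew:
  assumes "generator A"
  shows "(A *v x) \<bullet> x = 0"
proof -
  obtain h s where h: "\<And>k. h k \<in> H" "\<And>k. s k > 0" "s \<longlonglongrightarrow> 0"
    and lim: "\<And>x. (\<lambda>k::nat. (1 / s k) *\<^sub>R (h k *v x - x)) \<longlonglongrightarrow> A *v x" "\<And>x. (\<lambda>k. h k *v x - x) \<longlonglongrightarrow> 0"
    using generator_vec[OF assms] by blast
  have "((1 / s k) *\<^sub>R (h k *v x - x)) \<bullet> x = - (1/2) * (((1 / s k) *\<^sub>R (h k *v x - x)) \<bullet> (h k *v x - x))" for k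
  proof -
    have "(h k *v x) \<bullet> (h k *v x) = x \<bullet> x"
      using norm_orthogonal_vec[OF orthogonal_H[OF h(1)]] by (simp add: norm_eq_sqrt_inner)
    then have "(h k *v x - x) \<bullet> x = - (1/2) * ((h k *v x - x) \<bullet> (h k *v x - x))"
      by (simp add: inner_diff_left inner_diff_right inner_commute diff_divide_distrib)
    then show ?thesis by simp
  qed
  moreover have "(\<lambda>k. - (1/2) * (((1 / s k) *\<^sub>R (h k *v x - x)) \<bullet> (h k *v x - x))) \<longlonglongrightarrow> - (1/2) * ((A *v x) \<bullet> 0)"
    by (intro tendsto_mult tendsto_const tendsto_inner lim)
  ultimately have "(\<lambda>k. ((1 / s k) *\<^sub>R (h k *v x - x)) \<bullet> x) \<longlonglongrightarrow> 0" by simp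
  moreover have "(\<lambda>k. ((1 / s k) *\<^sub>R (h k *v x - x)) \<bullet> x) \<longlonglongrightarrow> (A *v x) \<bullet> x"
    by (intro tendsto_inner tendsto_const lim)
  ultimately show ?thesis using LIMSEQ_unique by blast
qed

text \<open>\<open>U\<close> is constant along the points \<open>h k *v x\<close>, whose rescaled
  secants tend to \<open>A *v x\<close>; the derivative of \<open>U\<close> must vanish in this
  direction.\<close>

lemma generator_invariant:
  assumes A: "generator A" and U: "(U has_derivative (\<lambda>v. d \<bullet> v)) (at x)"
    and inv: "\<And>h. h \<in> H \<Longrightarrow> U (h *v x) = U x"
  shows "d \<bullet> (A *v x) = 0"
proof -
  obtain h s where h: "\<And>k. h k \<in> H" "\<And>k. s k > 0" "s \<longlonglongrightarrow> 0"
    and lim: "\<And>x. (\<lambda>k::nat. (1 / s k) *\<^sub>R (h k *v x - x)) \<longlonglongrightarrow> A *v x" "\<And>x. (\<lambda>k. h k *v x - x) \<longlonglongrightarrow> 0"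
    using generator_vec[OF A] by blast
  have "\<bar>d \<bullet> (A *v x)\<bar> \<le> e * norm (A *v x)" if e: "e > 0" for e
  proof -
    obtain \<delta> where \<delta>: "\<delta> > 0" "\<And>y. norm (y - x) < \<delta> \<Longrightarrow> norm (U y - U x - d \<bullet> (y - x)) \<le> e * norm (y - x)"
      using U e unfolding has_derivative_at_alt by blast
    have "\<forall>\<^sub>F k in sequentially. norm (h k *v x - x) < \<delta>"
      using lim(2)[of x] \<delta>(1) by (intro order_tendstoD[OF tendsto_norm_zero]) auto
    then have ev: "\<forall>\<^sub>F k in sequentially. \<bar>d \<bullet> ((1 / s k) *\<^sub>R (h k *v x - x))\<bar> \<le> e * norm ((1 / s k) *\<^sub>R (h k *v x - x))"
    proof (rule eventually_mono)
      fix k assume "norm (h k *v x - x) < \<delta>"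
      from \<delta>(2)[OF this] have "\<bar>d \<bullet> (h k *v x - x)\<bar> \<le> e * norm (h k *v x - x)" by (simp add: inv[OF h(1)])
      then have "(1 / s k) * \<bar>d \<bullet> (h k *v x - x)\<bar> \<le> (1 / s k) * (e * norm (h k *v x - x))"
        using h(2)[of k] by (intro mult_left_mono) auto
      then show "\<bar>d \<bullet> ((1 / s k) *\<^sub>R (h k *v x - x))\<bar> \<le> e * norm ((1 / s k) *\<^sub>R (h k *v x - x))"
        using h(2)[of k] by (simp add: abs_mult)
    qed
    show ?thesis
    proof (rule tendsto_le[OF trivial_limit_sequentially _ _ ev])
      show "(\<lambda>k. e * norm ((1 / s k) *\<^sub>R (h k *v x - x))) \<longlonglongrightarrow> e * norm (A *v x)"
        by (intro tendsto_intros lim(1))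
      show "(\<lambda>k. \<bar>d \<bullet> ((1 / s k) *\<^sub>R (h k *v x - x))\<bar>) \<longlonglongrightarrow> \<bar>d \<bullet> (A *v x)\<bar>"
        by (intro tendsto_intros lim(1))
    qed
  qed
  then have *: "\<bar>d \<bullet> (A *v x)\<bar> \<le> e * norm (A *v x)" if "e > 0" for e using that by blast
  have "\<bar>d \<bullet> (A *v x)\<bar> \<le> 0"
  proof (rule field_le_epsilon)
    fix e :: real assume e: "e > 0"
    have "\<bar>d \<bullet> (A *v x)\<bar> \<le> e / (norm (A *v x) + 1) * norm (A *v x)"
      using e by (intro *) (simp add: add_nonneg_pos)
    also have "\<dots> \<le> e / (norm (A *v x) + 1) * (norm (A *v x) + 1)"
      using e by (intro mult_left_mono) auto
    also have "\<dots> = e"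
    proof -
      have "norm (A *v x) + 1 \<noteq> 0" using norm_ge_zero[of "A *v x"] by linarith
      then show ?thesis by simp
    qed
    finally show "\<bar>d \<bullet> (A *v x)\<bar> \<le> 0 + e" by simp
  qed
  then show ?thesis by simp
qed

end

section \<open>Potentials of class \<open>C\<^sup>2\<close>\<close>

lemma has_derivative_gradient:
  fixes U :: "'a::euclidean_space \<Rightarrow> real"
  assumes "U differentiable (at x)"
  shows "(U has_derivative (\<lambda>v. gradient U x \<bullet> v)) (at x)"
proof -
  obtain f where f: "(U has_derivative f) (at x)" using assms by (auto simp: differentiable_def)
  have lin: "linear f" using f by (rule has_derivative_linear)
  have "f = (\<lambda>v. v \<bullet> adjoint f 1)" using adjoint_works[OF lin] by (auto simp: fun_eq_iff)
  then have G: "GDERIV U x :> adjoint f 1" using f by (simp add: gderiv_def)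
  have "D = adjoint f 1" if "GDERIV U x :> D" for D
  proof -
    have "(\<lambda>v. v \<bullet> D) = (\<lambda>v. v \<bullet> adjoint f 1)"
      using has_derivative_unique that G unfolding gderiv_def by blast
    then show ?thesis by (metis vector_eq_ldot)
  qed
  with G have "\<exists>!D. GDERIV U x :> D" by blast
  from theI'[OF this] show ?thesis unfolding gradient_def[symmetric] by (simp add: gderiv_def inner_commute)
qed

locale C2_potential =
  fixes \<Omega> :: "(real^'n) set" and U :: "real^'n \<Rightarrow> real"
  assumes open_\<Omega>: "open \<Omega>" and C2: "C_k_on 2 \<Omega> U"
begin

lemma gradient: "x \<in> \<Omega> \<Longrightarrow> (U has_derivative (\<lambda>v. gradient U x \<bullet> v)) (at x)"
  using C2 by (intro has_derivative_gradient) (simp add: numeral_2_eq_2)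

lemma frechet_gradient: "x \<in> \<Omega> \<Longrightarrow> frechet_derivative U (at x) v = gradient U x \<bullet> v"
  using frechet_derivative_at[OF gradient] by metis

text \<open>The derivative of the gradient, assembled from the coordinates because
  \<open>C_k_on\<close> speaks of the derivatives of \<open>U\<close> in fixed directions.\<close>

definition D2 :: "real^'n \<Rightarrow> real^'n \<Rightarrow> real^'n" where
  "D2 x w = (\<Sum>b\<in>Basis. frechet_derivative (\<lambda>y. frechet_derivative U (at y) b) (at x) w *\<^sub>R b)"

lemma gradient_has_derivative:
  assumes x: "x \<in> \<Omega>"
  shows "(gradient U has_derivative D2 x) (at x)"
proof -
  have "((\<lambda>y. frechet_derivative U (at y) b) has_derivative frechet_derivative (\<lambda>y. frechet_derivative U (at y) b) (at x)) (at x)" for b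
    using C2 x by (simp add: numeral_2_eq_2 frechet_derivative_works)
  then have "((\<lambda>y. \<Sum>b\<in>Basis. frechet_derivative U (at y) b *\<^sub>R b) has_derivative D2 x) (at x)"
    unfolding D2_def by (intro has_derivative_sum has_derivative_scaleR_left)
  then show ?thesis
    by (rule has_derivative_transform_within_open[OF _ open_\<Omega> x])
      (simp add: frechet_gradient euclidean_representation)
qed

lemma continuous_on_D2: "continuous_on \<Omega> (\<lambda>x. D2 x w)"
  unfolding D2_def using C2 by (intro continuous_intros) (simp add: numeral_2_eq_2)

lemma linear_D2: "x \<in> \<Omega> \<Longrightarrow> linear (D2 x)"
  using gradient_has_derivative has_derivative_linear by blast

text \<open>Continuity of the second derivatives makes the derivative of
  \<open>gradient U y - D2 x0 y\<close> small on a ball, and the mean value inequality turns this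
  into a Lipschitz bound for pairs of points.\<close>

lemma gradient_strictly_differentiable:
  assumes x0: "x0 \<in> \<Omega>" and \<epsilon>: "\<epsilon> > 0"
  obtains \<delta> where "\<delta> > 0" "cball x0 \<delta> \<subseteq> \<Omega>" "\<And>y z. y \<in> cball x0 \<delta> \<Longrightarrow> z \<in> cball x0 \<delta> \<Longrightarrow>
    norm ((gradient U y - D2 x0 y) - (gradient U z - D2 x0 z)) \<le> \<epsilon> * norm (y - z)"
proof -
  define N where "N = (\<lambda>y. \<Sum>b\<in>Basis. norm (D2 y b - D2 x0 b))"
  have "continuous_on \<Omega> N" unfolding N_def by (intro continuous_intros continuous_on_D2)
  then have "isCont N x0" using open_\<Omega> x0 by (simp add: continuous_on_eq_continuous_at)
  moreover have "N x0 = 0" by (simp add: N_def)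
  ultimately obtain d where d: "d > 0" "\<And>y. dist y x0 < d \<Longrightarrow> \<bar>N y\<bar> < \<epsilon>"
    unfolding continuous_at_eps_delta using \<epsilon> by (auto simp: dist_norm)
  obtain d' where d': "d' > 0" "cball x0 d' \<subseteq> \<Omega>" using open_\<Omega> x0 open_contains_cball by blast
  define \<delta> where "\<delta> = min (d / 2) d'"
  have \<delta>: "\<delta> > 0" "cball x0 \<delta> \<subseteq> \<Omega>"
    using d(1) d' by (auto simp: \<delta>_def subset_iff)
  have N: "N y \<le> \<epsilon>" if "y \<in> cball x0 \<delta>" for y
    using d(2)[of y] d(1) that by (auto simp: \<delta>_def dist_commute)
  have "norm ((gradient U y - D2 x0 y) - (gradient U z - D2 x0 z)) \<le> \<epsilon> * norm (y - z)"
    if yz: "y \<in> cball x0 \<delta>" "z \<in> cball x0 \<delta>" for y z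
  proof (rule differentiable_bound[OF convex_cball _ _ yz])
    fix x assume x: "x \<in> cball x0 \<delta>"
    then have x\<Omega>: "x \<in> \<Omega>" using \<delta> by blast
    show "((\<lambda>y. gradient U y - D2 x0 y) has_derivative (\<lambda>w. D2 x w - D2 x0 w)) (at x within cball x0 \<delta>)"
      using linear_D2[OF x0]
      by (intro has_derivative_diff has_derivative_at_withinI[OF gradient_has_derivative[OF x\<Omega>]]
          bounded_linear_imp_has_derivative) (simp add: linear_conv_bounded_linear)
    show "onorm (\<lambda>w. D2 x w - D2 x0 w) \<le> \<epsilon>"
    proof (rule onorm_le)
      fix w :: "real^'n"
      have lin: "linear (\<lambda>w. D2 x w - D2 x0 w)" using linear_D2[OF x\<Omega>] linear_D2[OF x0] by (rule linear_compose_sub)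
      have "D2 x w - D2 x0 w = (\<lambda>w. D2 x w - D2 x0 w) (\<Sum>b\<in>Basis. (w \<bullet> b) *\<^sub>R b)"
        by (simp add: euclidean_representation)
      also have "\<dots> = (\<Sum>b\<in>Basis. (w \<bullet> b) *\<^sub>R (D2 x b - D2 x0 b))"
        by (simp only: linear_sum[OF lin] linear_scale[OF lin])
      also have "norm \<dots> \<le> (\<Sum>b\<in>Basis. norm w * norm (D2 x b - D2 x0 b))"
        by (intro sum_norm_le) (auto intro!: mult_right_mono simp: Basis_le_norm)
      also have "\<dots> = norm w * N x" by (simp add: N_def sum_distrib_left)
      also have "\<dots> \<le> norm w * \<epsilon>" using N[OF x] by (intro mult_left_mono) auto
      finally show "norm (D2 x w - D2 x0 w) \<le> \<epsilon> * norm w" by (simp add: mult.commute)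
    qed
  qed
  with \<delta> show ?thesis by (intro that)
qed

text \<open>The second difference of \<open>U\<close> along \<open>v\<close> and \<open>w\<close> is symmetric in \<open>v\<close> and \<open>w\<close>.\<close>

lemma second_difference:
  assumes x0: "x0 \<in> \<Omega>" and \<epsilon>: "\<epsilon> > 0"
  obtains s0 where "s0 > 0" "\<And>s. 0 < s \<Longrightarrow> s \<le> s0 \<Longrightarrow>
    \<bar>(U (x0 + s *\<^sub>R v + s *\<^sub>R w) - U (x0 + s *\<^sub>R v)) - (U (x0 + s *\<^sub>R w) - U x0) - s\<^sup>2 * (D2 x0 w \<bullet> v)\<bar>
      \<le> \<epsilon> * s\<^sup>2 * norm w * norm v"
proof -
  obtain \<delta> where \<delta>: "\<delta> > 0" "cball x0 \<delta> \<subseteq> \<Omega>" "\<And>y z. y \<in> cball x0 \<delta> \<Longrightarrow> z \<in> cball x0 \<delta> \<Longrightarrow>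
    norm ((gradient U y - D2 x0 y) - (gradient U z - D2 x0 z)) \<le> \<epsilon> * norm (y - z)"
    by (rule gradient_strictly_differentiable[OF x0 \<epsilon>]) blast
  define s0 where "s0 = \<delta> / (norm v + norm w + 1)"
  have nn: "norm v + norm w + 1 > 0" by (simp add: add_nonneg_pos)
  have "\<bar>(U (x0 + s *\<^sub>R v + s *\<^sub>R w) - U (x0 + s *\<^sub>R v)) - (U (x0 + s *\<^sub>R w) - U x0) - s\<^sup>2 * (D2 x0 w \<bullet> v)\<bar>
      \<le> \<epsilon> * s\<^sup>2 * norm w * norm v" if s: "0 < s" "s \<le> s0" for s
  proof -
    have sd: "s * (norm v + norm w + 1) \<le> \<delta>" using s nn by (simp add: s0_def pos_le_divide_eq)
    have mem: "x0 + t *\<^sub>R v + s' *\<^sub>R w \<in> cball x0 \<delta>" if "t \<in> {0..s}" "s' \<in> {0..s}" for t s'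
    proof -
      have "norm (t *\<^sub>R v + s' *\<^sub>R w) \<le> t * norm v + s' * norm w"
        using norm_triangle_ineq[of "t *\<^sub>R v" "s' *\<^sub>R w"] that by simp
      also have "\<dots> \<le> s * norm v + s * norm w" using that by (intro add_mono mult_right_mono) auto
      also have "\<dots> \<le> \<delta>" using sd s by (simp add: algebra_simps)
      finally show ?thesis by (simp add: dist_norm norm_minus_commute algebra_simps)
    qed
    define f where "f = (\<lambda>t. U (x0 + t *\<^sub>R v + s *\<^sub>R w) - U (x0 + t *\<^sub>R v) - t * (s * (D2 x0 w \<bullet> v)))"
    define f' where "f' = (\<lambda>t. (gradient U (x0 + t *\<^sub>R v + s *\<^sub>R w) - gradient U (x0 + t *\<^sub>R v)) \<bullet> v - s * (D2 x0 w \<bullet> v))"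
    have "norm (f s - f 0) \<le> (\<epsilon> * (s * norm w) * norm v) * norm (s - 0)"
    proof (rule vector_differentiable_bound_real)
      fix t assume t: "t \<in> {0..s}"
      have m: "x0 + t *\<^sub>R v + s *\<^sub>R w \<in> cball x0 \<delta>" "x0 + t *\<^sub>R v \<in> cball x0 \<delta>"
        using mem[OF t, of s] mem[OF t, of 0] s by auto
      have ch: "((\<lambda>t. U (c + t *\<^sub>R v)) has_vector_derivative gradient U (c + t *\<^sub>R v) \<bullet> v) (at t within {0..s})"
        if "c + t *\<^sub>R v \<in> \<Omega>" for c
      proof -
        have "((\<lambda>t. c + t *\<^sub>R v) has_derivative (\<lambda>h. h *\<^sub>R v)) (at t within {0..s})"
          by (auto intro!: derivative_eq_intros)
        from has_derivative_compose[OF this gradient[OF that]] show ?thesis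
          by (simp add: has_vector_derivative_def)
      qed
      have "((\<lambda>t. U (x0 + t *\<^sub>R v + s *\<^sub>R w)) has_vector_derivative gradient U (x0 + t *\<^sub>R v + s *\<^sub>R w) \<bullet> v) (at t within {0..s})"
        using ch[of "x0 + s *\<^sub>R w"] m \<delta>(2) by (auto simp: algebra_simps)
      moreover have "((\<lambda>t. U (x0 + t *\<^sub>R v)) has_vector_derivative gradient U (x0 + t *\<^sub>R v) \<bullet> v) (at t within {0..s})"
        using ch[of x0] m \<delta>(2) by auto
      moreover have "((\<lambda>t. t * (s * (D2 x0 w \<bullet> v))) has_vector_derivative s * (D2 x0 w \<bullet> v)) (at t within {0..s})"
        by (auto intro!: derivative_eq_intros simp: has_vector_derivative_def)
      ultimately show "(f has_vector_derivative f' t) (at t within {0..s})"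
        unfolding f_def f'_def inner_diff_left by (intro has_vector_derivative_diff)
      have "f' t = ((gradient U (x0 + t *\<^sub>R v + s *\<^sub>R w) - D2 x0 (x0 + t *\<^sub>R v + s *\<^sub>R w)) - (gradient U (x0 + t *\<^sub>R v) - D2 x0 (x0 + t *\<^sub>R v))) \<bullet> v"
        using linear_D2[OF x0] by (simp add: f'_def linear_add linear_scale inner_simps)
      also have "norm \<dots> \<le> norm ((gradient U (x0 + t *\<^sub>R v + s *\<^sub>R w) - D2 x0 (x0 + t *\<^sub>R v + s *\<^sub>R w)) - (gradient U (x0 + t *\<^sub>R v) - D2 x0 (x0 + t *\<^sub>R v))) * norm v"
        using Cauchy_Schwarz_ineq2 by (metis real_norm_def)
      also have "\<dots> \<le> (\<epsilon> * (s * norm w)) * norm v"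
        using \<delta>(3)[OF m] s by (intro mult_right_mono) auto
      finally show "norm (f' t) \<le> \<epsilon> * (s * norm w) * norm v" .
    qed (use s in auto)
    then show ?thesis using s by (simp add: f_def power2_eq_square algebra_simps)
  qed
  moreover have "s0 > 0" using \<delta>(1) nn by (simp add: s0_def)
  ultimately show ?thesis by (intro that)
qed

text \<open>The second difference approximates \<open>s^2\<close> times the bilinear form in either
  order of \<open>v\<close> and \<open>w\<close>. Comparing the two bounds and dividing by
  \<open>s^2\<close> leaves an arbitrarily small discrepancy.\<close>

lemma D2_symmetric:
  assumes x0: "x0 \<in> \<Omega>"
  shows "D2 x0 v \<bullet> w = v \<bullet> D2 x0 w"
proof -
  have le: "\<bar>D2 x0 w \<bullet> v - D2 x0 v \<bullet> w\<bar> \<le> 2 * \<epsilon> * (norm w * norm v)" if \<epsilon>: "\<epsilon> > 0" for \<epsilon>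
  proof -
    obtain s1 where s1: "s1 > 0" "\<And>s. 0 < s \<Longrightarrow> s \<le> s1 \<Longrightarrow>
      \<bar>(U (x0 + s *\<^sub>R v + s *\<^sub>R w) - U (x0 + s *\<^sub>R v)) - (U (x0 + s *\<^sub>R w) - U x0) - s\<^sup>2 * (D2 x0 w \<bullet> v)\<bar>
        \<le> \<epsilon> * s\<^sup>2 * norm w * norm v" by (rule second_difference[OF x0 \<epsilon>, of v w]) blast
    obtain s2 where s2: "s2 > 0" "\<And>s. 0 < s \<Longrightarrow> s \<le> s2 \<Longrightarrow>
      \<bar>(U (x0 + s *\<^sub>R w + s *\<^sub>R v) - U (x0 + s *\<^sub>R w)) - (U (x0 + s *\<^sub>R v) - U x0) - s\<^sup>2 * (D2 x0 v \<bullet> w)\<bar>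
        \<le> \<epsilon> * s\<^sup>2 * norm v * norm w" by (rule second_difference[OF x0 \<epsilon>, of w v]) blast
    define s where "s = min s1 s2"
    have s: "0 < s" "s \<le> s1" "s \<le> s2" using s1 s2 by (auto simp: s_def)
    have sw: "x0 + s *\<^sub>R w + s *\<^sub>R v = x0 + s *\<^sub>R v + s *\<^sub>R w" by simp
    have "\<bar>s\<^sup>2 * (D2 x0 w \<bullet> v) - s\<^sup>2 * (D2 x0 v \<bullet> w)\<bar> \<le> \<epsilon> * s\<^sup>2 * norm w * norm v + \<epsilon> * s\<^sup>2 * norm v * norm w"
      using s1(2)[OF s(1,2)] s2(2)[OF s(1,3)] unfolding sw by linarith
    also have "\<dots> = s\<^sup>2 * (2 * \<epsilon> * (norm w * norm v))" by (simp add: algebra_simps)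
    also have "\<bar>s\<^sup>2 * (D2 x0 w \<bullet> v) - s\<^sup>2 * (D2 x0 v \<bullet> w)\<bar> = s\<^sup>2 * \<bar>D2 x0 w \<bullet> v - D2 x0 v \<bullet> w\<bar>"
      by (simp add: abs_mult flip: right_diff_distrib)
    finally have "s\<^sup>2 * \<bar>D2 x0 w \<bullet> v - D2 x0 v \<bullet> w\<bar> \<le> s\<^sup>2 * (2 * \<epsilon> * (norm w * norm v))" .
    then show ?thesis using s by simp
  qed
  have "\<bar>D2 x0 w \<bullet> v - D2 x0 v \<bullet> w\<bar> \<le> 0"
  proof (rule field_le_epsilon)
    fix e :: real assume e: "e > 0"
    define n where "n = norm w * norm v"
    have n: "n \<ge> 0" by (simp add: n_def)
    have "\<bar>D2 x0 w \<bullet> v - D2 x0 v \<bullet> w\<bar> \<le> 2 * (e / (2 * (n + 1))) * n"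
      unfolding n_def by (rule le) (use e n in \<open>simp add: n_def[symmetric]\<close>)
    also have "\<dots> = (e / (n + 1)) * n" using n by (simp add: field_simps)
    also have "\<dots> \<le> (e / (n + 1)) * (n + 1)" using e n by (intro mult_left_mono) auto
    also have "\<dots> = e" using n by simp
    finally show "\<bar>D2 x0 w \<bullet> v - D2 x0 v \<bullet> w\<bar> \<le> 0 + e" by simp
  qed
  then show ?thesis by (simp add: inner_commute)
qed

lemma hessian_D2: "x \<in> \<Omega> \<Longrightarrow> hessian U x *v w = D2 x w"
proof -
  assume x: "x \<in> \<Omega>"
  have "gradient U differentiable (at x)" using gradient_has_derivative[OF x] by (auto simp: differentiable_def)
  then have "(gradient U has_derivative (\<lambda>h. hessian U x *v h)) (at x)"
    unfolding hessian_def by (simp add: jacobian_works)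
  then have "(\<lambda>h. hessian U x *v h) = D2 x" using gradient_has_derivative[OF x] by (rule has_derivative_unique)
  then show ?thesis by metis
qed

end

section \<open>The orbit of a critical point\<close>

lemma has_derivative_frechet_transform:
  assumes "g differentiable (at x)" "open V" "x \<in> V" "\<And>y. y \<in> V \<Longrightarrow> g y = f y"
  shows "f differentiable (at x)"
  using assms has_derivative_transform_within_open unfolding differentiable_def by metis

lemma smooth_map_on_differentiable:
  assumes "smooth_map_on S f" "open S" "x \<in> S"
  shows "f differentiable (at x)"
proof -
  obtain V g where V: "open V" "x \<in> V" "\<forall>k. C_k_on k V g" "\<forall>y\<in>V \<inter> S. g y = f y"
    using assms unfolding smooth_map_on_def by blast
  have "g differentiable (at x)" using V(3)[rule_format, of "Suc 0"] V(2) by simp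
  then show ?thesis
    by (rule has_derivative_frechet_transform[of _ _ "V \<inter> S"]) (use V assms in auto)
qed

text \<open>\<open>E\<close> is the image of the flat model \<open>F\<close> under the derivative of
  the inverse chart. This derivative has a left inverse, so the dimension is kept, and straight
  segments in \<open>F\<close> are mapped to curves in \<open>M\<close> with the prescribed
  velocity.\<close>

lemma submanifold_tangent_space:
  fixes M :: "'a::euclidean_space set"
  assumes "submanifold_of_dim M d" "p \<in> M"
  obtains E where "subspace E" "dim E = d"
    "\<And>c. c \<in> E \<Longrightarrow> \<exists>m s. (\<forall>k. m k \<in> M \<and> s k > 0) \<and> s \<longlonglongrightarrow> 0 \<and> (\<lambda>k::nat. (1 / s k) *\<^sub>R (m k - p)) \<longlonglongrightarrow> c"
proof -
  obtain V and \<Phi> :: "'a \<Rightarrow> 'a" and F where V: "open V" "p \<in> V" "open (\<Phi> ` V)" "inj_on \<Phi> V"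
    and sm: "smooth_map_on V \<Phi>" "smooth_map_on (\<Phi> ` V) (inv_into V \<Phi>)"
    and F: "subspace F" "dim F = d" "\<Phi> ` (V \<inter> M) = \<Phi> ` V \<inter> F"
    using assms unfolding submanifold_of_dim_def by metis
  define \<Psi> where "\<Psi> = inv_into V \<Phi>"
  obtain D where D: "(\<Phi> has_derivative D) (at p)"
    using smooth_map_on_differentiable[OF sm(1) V(1,2)] by (auto simp: differentiable_def)
  have pV: "\<Phi> p \<in> \<Phi> ` V" using V(2) by simp
  obtain D' where D': "(\<Psi> has_derivative D') (at (\<Phi> p))"
    using smooth_map_on_differentiable[OF sm(2) V(3) pV] by (auto simp: differentiable_def \<Psi>_def)
  have lin: "linear D'" using D' by (rule has_derivative_linear)
  have \<Psi>p: "\<Psi> (\<Phi> p) = p" using V by (simp add: \<Psi>_def)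
  have "((\<lambda>x. \<Phi> (\<Psi> x)) has_derivative (\<lambda>x. D (D' x))) (at (\<Phi> p))"
    using has_derivative_compose[OF D', of \<Phi> D] D \<Psi>p by simp
  then have "((\<lambda>x. x) has_derivative (\<lambda>x. D (D' x))) (at (\<Phi> p))"
    by (rule has_derivative_transform_within_open[OF _ V(3) pV]) (simp add: \<Psi>_def f_inv_into_f)
  then have DD': "(\<lambda>x. D (D' x)) = (\<lambda>x. x)" using has_derivative_unique has_derivative_ident by blast
  then have inj: "inj D'" by (metis injI)
  show ?thesis
  proof (rule that[of "D' ` F"])
    show "subspace (D' ` F)" by (rule linear_subspace_image[OF lin F(1)])
    show "dim (D' ` F) = d" using dim_image_eq[OF lin] inj F(2) by (metis inj_on_subset subset_UNIV)
    fix c assume "c \<in> D' ` F"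
    then obtain f where f: "f \<in> F" "c = D' f" by blast
    have pF: "\<Phi> p \<in> F" using F(3) V(2) assms(2) by blast
    obtain r where r: "r > 0" "ball (\<Phi> p) r \<subseteq> \<Phi> ` V" using V(3) pV open_contains_ball by blast
    \<comment> \<open>Scaled so that \<open>\<Phi> p + s k *\<^sub>R f\<close> stays in the ball of
      radius \<open>r\<close> already for \<open>k = 0\<close>.\<close>
    define s where "s = (\<lambda>k::nat. r / (norm f + 1) * inverse (real (Suc k)))"
    have nf: "norm f + 1 > 0" by (simp add: add_nonneg_pos)
    have s: "s k > 0" for k using r nf by (simp add: s_def)
    have s0: "s \<longlonglongrightarrow> 0" unfolding s_def
      using tendsto_mult[OF tendsto_const LIMSEQ_inverse_real_of_nat, of "r / (norm f + 1)"] by simp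
    have mem: "\<Psi> (\<Phi> p + s k *\<^sub>R f) \<in> M" for k
    proof -
      have "s k \<le> r / (norm f + 1) * 1"
        unfolding s_def using r nf by (intro mult_left_mono) (auto simp: inverse_le_1_iff)
      then have "s k * norm f \<le> r / (norm f + 1) * norm f"
        using mult_right_mono[of "s k" "r / (norm f + 1)" "norm f"] by simp
      also have "\<dots> < r" using r nf by (simp add: pos_divide_less_eq)
      finally have "\<Phi> p + s k *\<^sub>R f \<in> ball (\<Phi> p) r" using s[of k] by (simp add: dist_norm)
      then have "\<Phi> p + s k *\<^sub>R f \<in> \<Phi> ` V \<inter> F"
        using r(2) pF f(1) F(1) by (auto intro: subspace_add subspace_scale)
      then obtain y where y: "y \<in> V \<inter> M" "\<Phi> p + s k *\<^sub>R f = \<Phi> y" using F(3) by (metis imageE)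
      then show ?thesis using V(4) by (simp add: \<Psi>_def)
    qed
    have "(\<lambda>k. (1 / s k) *\<^sub>R (\<Psi> (\<Phi> p + s k *\<^sub>R f) - p)) \<longlonglongrightarrow> c"
    proof -
      define \<phi> where "\<phi> = (\<lambda>t. \<Psi> (\<Phi> p + t *\<^sub>R f))"
      have "((\<lambda>t. \<Phi> p + t *\<^sub>R f) has_derivative (\<lambda>t. t *\<^sub>R f)) (at 0)"
        by (auto intro!: derivative_eq_intros)
      from has_derivative_compose[OF this, of \<Psi> D'] D'
      have "(\<phi> has_derivative (\<lambda>t. t *\<^sub>R c)) (at 0)"
        by (simp add: \<phi>_def f(2) linear_scale[OF lin])
      then have lim: "((\<lambda>h. norm (\<phi> (0 + h) - \<phi> 0 - h *\<^sub>R c) / norm h) \<longlongrightarrow> 0) (at 0)"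
        unfolding has_derivative_at by blast
      have "filterlim s (at 0) sequentially"
        unfolding filterlim_at using s0 s by (auto intro!: always_eventually simp: less_imp_neq[symmetric])
      from filterlim_compose[OF lim this]
      have "(\<lambda>k. norm (\<phi> (0 + s k) - \<phi> 0 - s k *\<^sub>R c) / norm (s k)) \<longlonglongrightarrow> 0" .
      moreover have "norm (\<phi> (0 + s k) - \<phi> 0 - s k *\<^sub>R c) / norm (s k) = norm ((1 / s k) *\<^sub>R (\<phi> (s k) - p) - c)" for k
      proof -
        have "(1 / s k) *\<^sub>R (\<phi> (s k) - p) - c = (1 / s k) *\<^sub>R (\<phi> (0 + s k) - \<phi> 0 - s k *\<^sub>R c)"
          using s[of k] by (simp add: \<phi>_def \<Psi>p scaleR_diff_right)
        then show ?thesis using s[of k] by simp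
      qed
      ultimately have "(\<lambda>k. norm ((1 / s k) *\<^sub>R (\<phi> (s k) - p) - c)) \<longlonglongrightarrow> 0" by (simp only:)
      then show ?thesis unfolding \<phi>_def by (rule LIM_zero_cancel[OF tendsto_norm_zero_cancel])
    qed
    with mem s s0 show "\<exists>m s. (\<forall>k. m k \<in> M \<and> s k > 0) \<and> s \<longlonglongrightarrow> 0 \<and> (\<lambda>k::nat. (1 / s k) *\<^sub>R (m k - p)) \<longlonglongrightarrow> c"
      by (intro exI[of _ "\<lambda>k. \<Psi> (\<Phi> p + s k *\<^sub>R f)"] exI[of _ s]) blast
  qed
qed

lemma matrix_group_representation:
  assumes "compact_lie_group G T E \<A>" and rep: "orthogonal_representation G T \<rho>"
  shows "matrix_group (\<rho> ` carrier G)"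
proof -
  interpret compact_lie_group G T E \<A> by fact
  have hom: "\<And>x y. x \<in> carrier G \<Longrightarrow> y \<in> carrier G \<Longrightarrow> \<rho> (x \<otimes>\<^bsub>G\<^esub> y) = \<rho> x ** \<rho> y"
    and orth: "\<And>x. x \<in> carrier G \<Longrightarrow> orthogonal_matrix (\<rho> x)" and cont: "continuous_map T euclidean \<rho>"
    using rep by (auto simp: orthogonal_representation_def orthogonal_group_def hom_def)
  have one: "\<rho> \<one>\<^bsub>G\<^esub> = mat 1"
  proof -
    have "transpose (\<rho> \<one>\<^bsub>G\<^esub>) ** (\<rho> \<one>\<^bsub>G\<^esub> ** \<rho> \<one>\<^bsub>G\<^esub>) = transpose (\<rho> \<one>\<^bsub>G\<^esub>) ** \<rho> \<one>\<^bsub>G\<^esub>" using hom[of "\<one>\<^bsub>G\<^esub>" "\<one>\<^bsub>G\<^esub>"] by simp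
    then show ?thesis using orth[of "\<one>\<^bsub>G\<^esub>"] by (simp add: matrix_mul_assoc orthogonal_matrix_def)
  qed
  have tr: "transpose (\<rho> x) = \<rho> (inv\<^bsub>G\<^esub> x)" if "x \<in> carrier G" for x
  proof -
    have "\<rho> (inv\<^bsub>G\<^esub> x) ** \<rho> x = mat 1" using hom[of "inv\<^bsub>G\<^esub> x" x] that one by simp
    then have "(\<rho> (inv\<^bsub>G\<^esub> x) ** \<rho> x) ** transpose (\<rho> x) = transpose (\<rho> x)" by simp
    then show ?thesis using orth[OF that] by (simp add: matrix_mul_assoc[symmetric] orthogonal_matrix_def)
  qed
  show ?thesis
  proof
    show "mat 1 \<in> \<rho> ` carrier G" using one by (metis imageI one_closed)
    show "A ** B \<in> \<rho> ` carrier G" if "A \<in> \<rho> ` carrier G" "B \<in> \<rho> ` carrier G" for A B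
      using that hom by (auto simp flip: hom)
    show "transpose A \<in> \<rho> ` carrier G" if "A \<in> \<rho> ` carrier G" for A using that tr by auto
    show "orthogonal_matrix A" if "A \<in> \<rho> ` carrier G" for A using that orth by auto
    have "compactin euclidean (\<rho> ` topspace T)"
      using compact cont by (intro image_compactin) (auto simp: compact_space_def)
    then show "compact (\<rho> ` carrier G)" by (simp add: topspace_eq)
  qed
qed

context C2_potential begin

text \<open>Differentiating \<open>gradient U x \<bullet> A x = 0\<close> at the critical point.\<close>

lemma hessian_generator_zero:
  fixes A :: "real^'n^'n"
  assumes q: "q \<in> \<Omega>" "gradient U q = 0" and inv: "\<And>x. x \<in> \<Omega> \<Longrightarrow> gradient U x \<bullet> (A *v x) = 0"
  shows "hessian U q *v (A *v q) = 0"
proof -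
  have "((*v) A has_derivative (*v) A) (at q)"
    by (intro bounded_linear_imp_has_derivative linear_conv_bounded_linear[THEN iffD1]) simp
  from has_derivative_inner[OF gradient_has_derivative[OF q(1)] this]
  have d: "((\<lambda>x. gradient U x \<bullet> (A *v x)) has_derivative (\<lambda>h. gradient U q \<bullet> (A *v h) + D2 q h \<bullet> (A *v q))) (at q)" .
  have "((\<lambda>x. 0) has_derivative (\<lambda>h. gradient U q \<bullet> (A *v h) + D2 q h \<bullet> (A *v q))) (at q)"
    by (rule has_derivative_transform_within_open[OF d open_\<Omega> q(1)]) (rule inv)
  then have "(\<lambda>h. gradient U q \<bullet> (A *v h) + D2 q h \<bullet> (A *v q)) = (\<lambda>h. 0)"
    using has_derivative_unique has_derivative_const by blast
  then have "D2 q h \<bullet> (A *v q) = 0" for h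
    using fun_cong[of "\<lambda>h. gradient U q \<bullet> (A *v h) + D2 q h \<bullet> (A *v q)" "\<lambda>h. 0" h] q(2) by simp
  then have "D2 q (A *v q) \<bullet> D2 q (A *v q) = 0"
    using D2_symmetric[OF q(1), of "D2 q (A *v q)" "A *v q"] by simp
  then have "D2 q (A *v q) = 0" by simp
  then show ?thesis by (simp add: hessian_D2[OF q(1)])
qed

end

text \<open>Generators map \<open>q\<close> into the kernel of the Hessian, and every tangent vector
  of the orbit arises from a generator. So the tangent space lies in the kernel, and equality of
  dimensions makes the two coincide.\<close>

lemma kernel_generated_by_symmetries:
  assumes "C2_potential \<Omega> U" "matrix_group (\<rho> ` carrier G)"
    and inv: "invariant_on G \<rho> \<Omega> U" and q: "q \<in> \<Omega>" "gradient U q = 0"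
    and sub: "submanifold_of_dim (group_orbit G \<rho> q) (dim (matrix_kernel (hessian U q)))"
    and c: "hessian U q *v c = 0"
  shows "\<exists>A. (\<forall>x. (A *v x) \<bullet> x = 0) \<and> (\<forall>x\<in>\<Omega>. gradient U x \<bullet> (A *v x) = 0) \<and> A *v q = c"
proof -
  interpret C2_potential \<Omega> U by fact
  interpret matrix_group "\<rho> ` carrier G" by fact
  have gen_inv: "gradient U x \<bullet> (A *v x) = 0" if "generator A" "x \<in> \<Omega>" for A x
    using generator_invariant[OF that(1) gradient[OF that(2)]] inv that(2) by (auto simp: invariant_on_def)
  have orbit: "y \<in> group_orbit G \<rho> q \<longleftrightarrow> (\<exists>h\<in>\<rho> ` carrier G. y = h *v q)" for y
    by (auto simp: group_orbit_def)
  have "q \<in> group_orbit G \<rho> q" using one_H orbit by (metis matrix_vector_mul_lid)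
  from submanifold_tangent_space[OF sub this] obtain E where E: "subspace E" "dim E = dim (matrix_kernel (hessian U q))"
    "\<And>c. c \<in> E \<Longrightarrow> \<exists>m s. (\<forall>k. m k \<in> group_orbit G \<rho> q \<and> s k > 0) \<and> s \<longlonglongrightarrow> 0 \<and> (\<lambda>k::nat. (1 / s k) *\<^sub>R (m k - q)) \<longlonglongrightarrow> c"
    by blast
  have gen: "\<exists>A. generator A \<and> A *v q = c" if cE: "c \<in> E" for c
  proof -
    obtain m s where ms: "\<And>k. m k \<in> group_orbit G \<rho> q" "\<And>k. s k > 0" "s \<longlonglongrightarrow> 0"
      "(\<lambda>k::nat. (1 / s k) *\<^sub>R (m k - q)) \<longlonglongrightarrow> c" using E(3)[OF cE] by blast
    have "\<exists>h\<in>\<rho> ` carrier G. m k = h *v q" for k using ms(1)[of k] by (simp only: orbit)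
    then show ?thesis by (rule tangent_vector_generator[OF _ ms(2,3,4)]) blast
  qed
  have "E \<subseteq> matrix_kernel (hessian U q)"
    using gen hessian_generator_zero[OF q gen_inv] by (force simp: matrix_kernel_def)
  moreover have "subspace (matrix_kernel (hessian U q))"
    by (auto simp: matrix_kernel_def subspace_def matrix_vector_right_distrib matrix_vector_mult_scaleR)
  ultimately have "E = matrix_kernel (hessian U q)"
    using E(1,2) by (intro subspace_dim_equal) auto
  then have "c \<in> E" using c by (simp add: matrix_kernel_def)
  from gen[OF this] show ?thesis using generator_skew gen_inv by blast
qed

section \<open>The theorem\<close>

text \<open>For positive \<open>\<mu>\<close> a zero of the sine would make
  \<open>sqrt \<mu> / \<beta>\<close> an integer, and a nonnegative one. For negative
  \<open>\<mu>\<close> the hyperbolic sine vanishes only at 0.\<close>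

lemma lin_sin_nonzero:
  assumes \<beta>: "\<beta> > 0" and \<mu>: "\<mu> \<noteq> 0" and nn: "\<mu> > 0 \<Longrightarrow> sqrt \<mu> / \<beta> \<notin> \<nat>"
  shows "lin_sin \<mu> (pi / \<beta>) \<noteq> 0"
proof (cases "\<mu> > 0")
  case True
  show ?thesis
  proof
    assume "lin_sin \<mu> (pi / \<beta>) = 0"
    then have "sin (sqrt \<mu> * (pi / \<beta>)) = 0" using True by (simp add: lin_sin_def)
    then obtain i :: int where "sqrt \<mu> * (pi / \<beta>) = of_int i * pi" by (auto simp: sin_zero_iff_int2)
    then have i: "sqrt \<mu> / \<beta> = of_int i" using \<beta> by (simp add: field_simps)
    have "sqrt \<mu> / \<beta> \<ge> 0" using True \<beta> by simp
    then have "i \<ge> 0" using i by simp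
    then have "sqrt \<mu> / \<beta> \<in> \<nat>" using i by (metis of_nat_in_Nats of_int_of_nat_eq zero_le_imp_eq_int)
    with nn True show False by blast
  qed
next
  case False
  then show ?thesis using \<mu> \<beta> by (simp add: lin_sin_def)
qed

lemma eigenvalue_in_spectrum:
  fixes A :: "real^'n^'n"
  shows "\<mu> \<in> spectrum A \<longleftrightarrow> (\<exists>v. v \<noteq> 0 \<and> A *v v = \<mu> *\<^sub>R v)"
proof -
  have mat: "(mat \<mu> :: real^'n^'n) *v v = \<mu> *\<^sub>R v" for v
    by (simp add: vec_eq_iff matrix_vector_mult_def mat_def if_distrib[where f="\<lambda>z. z * _"] cong: if_cong)
  have "\<mu> \<in> spectrum A \<longleftrightarrow> \<not> (\<forall>v. (A - mat \<mu>) *v v = 0 \<longrightarrow> v = 0)"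
    unfolding spectrum_def mem_Collect_eq invertible_left_inverse matrix_left_invertible_ker ..
  then show ?thesis by (auto simp: matrix_vector_mult_diff_rdistrib mat)
qed

lemma periodic_solutions_near_critical_orbit:
  fixes U :: "real^'n \<Rightarrow> real" and \<beta> :: real
  assumes pot: "C2_potential \<Omega> U" and q0: "q0 \<in> \<Omega>" "gradient U q0 = 0"
    and kernel: "\<And>c. hessian U q0 *v c = 0 \<Longrightarrow>
      \<exists>A. (\<forall>x. (A *v x) \<bullet> x = 0) \<and> (\<forall>x\<in>\<Omega>. gradient U x \<bullet> (A *v x) = 0) \<and> A *v q0 = c"
    and \<beta>: "\<beta> > 0" "\<beta>\<^sup>2 \<in> spectrum (hessian U q0)"
    and nonres: "\<And>\<mu>. \<mu> \<in> spectrum (hessian U q0) \<Longrightarrow> \<mu> > 0 \<Longrightarrow> \<mu> \<noteq> \<beta>\<^sup>2 \<Longrightarrow> sqrt \<mu> / \<beta> \<notin> \<nat>"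
    and \<epsilon>: "\<epsilon> > 0"
  shows "\<exists>q P. newton_solution \<Omega> U q \<and> minimal_period q P \<and> \<bar>P - 2 * pi / \<beta>\<bar> < \<epsilon> \<and> (\<forall>t. q t \<in> ball q0 \<epsilon>)"
proof -
  interpret C2_potential \<Omega> U by fact
  let ?A = "hessian U q0"
  have lin: "linear ((*v) ?A)" by simp
  have selfadj: "(?A *v x) \<bullet> y = x \<bullet> (?A *v y)" for x y
    using D2_symmetric[OF q0(1)] by (simp add: hessian_D2[OF q0(1)])
  obtain B \<mu> where B: "finite B" "pairwise orthogonal B" "\<And>b. b \<in> B \<Longrightarrow> norm b = 1"
    "span B = (UNIV :: (real^'n) set)" "\<And>b. b \<in> B \<Longrightarrow> ?A *v b = \<mu> b *\<^sub>R b"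
    by (rule selfadjoint_eigenbasis[OF lin selfadj]) blast
  interpret orthonormal_basis B by unfold_locales (use B in auto)
  have diag: "diag \<mu> x = ?A *v x" for x
  proof (rule eqI)
    fix b assume b: "b \<in> B"
    have "(?A *v x) \<bullet> b = x \<bullet> (?A *v b)" by (rule selfadj)
    then show "diag \<mu> x \<bullet> b = (?A *v x) \<bullet> b" using b by (simp add: B(5))
  qed
  have spec: "\<mu> b \<in> spectrum ?A" if "b \<in> B" for b
    using B(3,5)[OF that] by (auto simp: eigenvalue_in_spectrum intro!: exI[of _ b])
  obtain \<rho>0 where \<rho>0: "\<rho>0 > 0" "ball q0 \<rho>0 \<subseteq> \<Omega>" using open_\<Omega> q0(1) open_contains_ball by blast
  have in\<Omega>: "q0 + u \<in> \<Omega>" if "u \<in> ball 0 \<rho>0" for u using that \<rho>0(2) by (auto simp: dist_norm subset_iff)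
  interpret center B \<mu> "\<lambda>u. gradient U (q0 + u)" "\<lambda>u. U (q0 + u)" \<beta> \<rho>0
  proof unfold_locales
    show "gradient U (q0 + 0) = 0" using q0 by simp
    show "\<exists>\<delta>>0. \<forall>u\<in>cball 0 \<delta>. \<forall>v\<in>cball 0 \<delta>.
      norm ((gradient U (q0 + u) - diag \<mu> u) - (gradient U (q0 + v) - diag \<mu> v)) \<le> \<epsilon> * norm (u - v)"
      if \<epsilon>: "\<epsilon> > 0" for \<epsilon>
    proof -
      obtain \<delta> where \<delta>: "\<delta> > 0" "\<And>y z. y \<in> cball q0 \<delta> \<Longrightarrow> z \<in> cball q0 \<delta> \<Longrightarrow>
        norm ((gradient U y - D2 q0 y) - (gradient U z - D2 q0 z)) \<le> \<epsilon> * norm (y - z)"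
        by (rule gradient_strictly_differentiable[OF q0(1) \<epsilon>]) blast
      have "norm ((gradient U (q0 + u) - diag \<mu> u) - (gradient U (q0 + v) - diag \<mu> v)) \<le> \<epsilon> * norm (u - v)"
        if "u \<in> cball 0 \<delta>" "v \<in> cball 0 \<delta>" for u v
      proof -
        have "D2 q0 (q0 + u) - D2 q0 (q0 + v) = diag \<mu> u - diag \<mu> v"
          by (simp add: diag matrix_vector_right_distrib flip: hessian_D2[OF q0(1)])
        then have eq: "(gradient U (q0 + u) - diag \<mu> u) - (gradient U (q0 + v) - diag \<mu> v) =
            (gradient U (q0 + u) - D2 q0 (q0 + u)) - (gradient U (q0 + v) - D2 q0 (q0 + v))"
          by (simp add: algebra_simps)
        show ?thesis unfolding eq using \<delta>(2)[of "q0 + u" "q0 + v"] that by (simp add: dist_norm)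
      qed
      with \<delta>(1) show ?thesis by blast
    qed
    show "((\<lambda>u. U (q0 + u)) has_derivative (\<lambda>h. gradient U (q0 + u) \<bullet> h)) (at u)" if "u \<in> ball 0 \<rho>0" for u
    proof -
      have "((\<lambda>u. q0 + u) has_derivative (\<lambda>h. h)) (at u)" by (auto intro!: derivative_eq_intros)
      from has_derivative_compose[OF this gradient[OF in\<Omega>[OF that]]] show ?thesis .
    qed
    show "\<exists>b\<in>B. \<mu> b = \<beta>\<^sup>2"
    proof (rule ccontr)
      \<comment> \<open>Expanding an eigenvector for \<open>\<beta>\<^sup>2\<close> in the
        eigenbasis \<open>B\<close> would leave only zero coordinates.\<close>
      assume no: "\<not> ?thesis"
      obtain v where v: "v \<noteq> 0" "?A *v v = \<beta>\<^sup>2 *\<^sub>R v" using \<beta>(2) by (auto simp: eigenvalue_in_spectrum)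
      have "v = 0"
      proof (rule eqI)
        fix b assume b: "b \<in> B"
        have "\<mu> b * (v \<bullet> b) = \<beta>\<^sup>2 * (v \<bullet> b)"
          using diag_inner[OF b, of \<mu> v] unfolding diag v(2) inner_scaleR_left by (rule sym)
        moreover have "\<mu> b \<noteq> \<beta>\<^sup>2" using no b by blast
        ultimately show "v \<bullet> b = 0 \<bullet> b" by (metis inner_zero_left mult_right_cancel)
      qed
      with v(1) show False ..
    qed
    show "lin_sin (\<mu> b) (pi / \<beta>) \<noteq> 0" if "b \<in> B" "\<mu> b \<noteq> 0" "\<mu> b \<noteq> \<beta>\<^sup>2" for b
      using lin_sin_nonzero[OF \<beta>(1) that(2)] nonres[OF spec[OF that(1)]] that(3) by blast
    show "\<exists>A. linear A \<and> (\<forall>x. A x \<bullet> x = 0) \<and> (\<forall>u\<in>ball 0 \<rho>0. gradient U (q0 + u) \<bullet> (A u + b) = 0)"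
      if "b \<in> B" "\<mu> b = 0" for b
    proof -
      have "?A *v b = 0" using B(5)[OF that(1)] that(2) by simp
      then obtain A where A: "\<forall>x. (A *v x) \<bullet> x = 0" "\<forall>x\<in>\<Omega>. gradient U x \<bullet> (A *v x) = 0" "A *v q0 = b"
        using kernel by blast
      \<comment> \<open>Because \<open>A *v q0 = b\<close>, the affine field in the translated
        variable is the linear symmetry \<open>A\<close> at the point \<open>q0 + u\<close>.\<close>
      have "gradient U (q0 + u) \<bullet> (A *v u + b) = 0" if "u \<in> ball 0 \<rho>0" for u
      proof -
        have "A *v u + b = A *v (q0 + u)" by (simp add: matrix_vector_right_distrib A(3))
        then show ?thesis using A(2) in\<Omega>[OF that] by simp
      qed
      then show ?thesis using A(1) by (intro exI[of _ "(*v) A"]) auto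
    qed
  qed (use \<beta>(1) \<rho>0(1) in auto)
  obtain Q and P :: real where Q: "P > 0" "\<bar>P - 2 * pi / \<beta>\<bar> < \<epsilon>" "\<And>t. norm (Q t) < \<epsilon>" "\<And>t. norm (Q t) < \<rho>0"
    "\<exists>Q'. \<forall>t. (Q has_vector_derivative Q' t) (at t) \<and> (Q' has_vector_derivative - gradient U (q0 + Q t)) (at t)"
    "\<And>t. Q (t + P) = Q t" "\<And>S. 0 < S \<Longrightarrow> S < P \<Longrightarrow> \<not> (\<forall>t. Q (t + S) = Q t)"
    by (rule periodic_solution_near[OF \<epsilon>]) blast
  obtain Q' where Q': "\<And>t. (Q has_vector_derivative Q' t) (at t)"
    "\<And>t. (Q' has_vector_derivative - gradient U (q0 + Q t)) (at t)" using Q(5) by blast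
  have "((\<lambda>t. q0 + Q t) has_vector_derivative Q' t) (at t)" for t
    using Q'(1)[of t] by (auto intro!: derivative_eq_intros)
  then have "newton_solution \<Omega> U (\<lambda>t. q0 + Q t)"
    unfolding newton_solution_def using Q'(2) Q(4) in\<Omega> by auto
  moreover have "minimal_period (\<lambda>t. q0 + Q t) P"
    unfolding minimal_period_def using Q(1,6,7) by simp
  moreover have "q0 + Q t \<in> ball q0 \<epsilon>" for t using Q(3) by (simp add: dist_norm)
  ultimately show ?thesis using Q(2) by blast
qed

theorem theorem1p1:
  fixes G :: "('g, 'b) monoid_scheme"
    and T :: "'g topology"
    and E :: "'e::euclidean_space set"
    and \<A> :: "('g, 'e) chart set"
    and \<rho> :: "'g \<Rightarrow> real^'n^'n"
    and \<Omega> :: "(real^'n) set"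
    and U :: "real^'n \<Rightarrow> real"
    and q0 :: "real^'n"
    and \<beta> :: "nat \<Rightarrow> real"
    and m j0 :: nat
  assumes "compact_lie_group G T E \<A>"
    and "orthogonal_representation G T \<rho>"
    and "open \<Omega>" and "invariant_set G \<rho> \<Omega>"
    and "C_k_on 2 \<Omega> U" and "invariant_on G \<rho> \<Omega> U"
    and "q0 \<in> \<Omega>" and "gradient U q0 = 0"
    and "comm_group G \<or> (\<exists>l0. isomorphic_to_torus G T (isotropy_group G \<rho> q0) l0)"
    and "submanifold_of_dim (group_orbit G \<rho> q0) (dim (matrix_kernel (hessian U q0)))"
    and "m \<ge> 1"
    and "\<forall>i\<in>{1..m}. \<beta> i > 0"
    and "\<forall>i\<in>{1..m}. \<forall>j\<in>{1..m}. i < j \<longrightarrow> \<beta> i > \<beta> j"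
    and "spectrum (hessian U q0) \<inter> {0<..} = (\<lambda>j. (\<beta> j)\<^sup>2) ` {1..m}"
    and "j0 \<in> {1..m}"
    and "\<forall>j\<in>{1..m}. j \<noteq> j0 \<longrightarrow> \<beta> j / \<beta> j0 \<notin> \<nat>"
  shows "\<exists>(q :: nat \<Rightarrow> real \<Rightarrow> real^'n) (P :: nat \<Rightarrow> real).
    (\<forall>k. newton_solution \<Omega> U (q k) \<and> minimal_period (q k) (P k)) \<and>
    P \<longlonglongrightarrow> 2 * pi / \<beta> j0 \<and>
    (\<forall>\<epsilon>>0. \<exists>k0. \<forall>k\<ge>k0. q k ` {0..P k} \<subseteq> neighbourhood_of (group_orbit G \<rho> q0) \<epsilon>)"
proof -
  have pot: "C2_potential \<Omega> U" using assms(3,5) by unfold_locales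
  have grp: "matrix_group (\<rho> ` carrier G)" by (rule matrix_group_representation[OF assms(1,2)])
  have \<beta>0: "\<beta> j0 > 0" using assms(12,15) by blast
  have sq: "(\<beta> j0)\<^sup>2 \<in> spectrum (hessian U q0)" using assms(14,15) by blast
  have nonres: "sqrt \<mu> / \<beta> j0 \<notin> \<nat>" if \<mu>: "\<mu> \<in> spectrum (hessian U q0)" "\<mu> > 0" "\<mu> \<noteq> (\<beta> j0)\<^sup>2" for \<mu>
  proof -
    have "\<mu> \<in> (\<lambda>j. (\<beta> j)\<^sup>2) ` {1..m}" using \<mu> assms(14) by blast
    then obtain j where j: "j \<in> {1..m}" "\<mu> = (\<beta> j)\<^sup>2" by blast
    have "\<beta> j > 0" using assms(12) j(1) by blast
    then have "sqrt \<mu> = \<beta> j" "j \<noteq> j0" using j(2) \<mu>(3) by auto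
    then show ?thesis using assms(16) j(1) by simp
  qed
  \<comment> \<open>The local result with tolerance \<open>1 / (k + 1)\<close> yields the sequence.
    The solutions stay near \<open>q0\<close> itself, hence near the orbit.\<close>
  have "\<exists>q P. newton_solution \<Omega> U q \<and> minimal_period q P \<and> \<bar>P - 2 * pi / \<beta> j0\<bar> < inverse (real (Suc k)) \<and>
      (\<forall>t. q t \<in> ball q0 (inverse (real (Suc k))))" for k
    by (rule periodic_solutions_near_critical_orbit[OF pot assms(7,8)
          kernel_generated_by_symmetries[OF pot grp assms(6,7,8,10)] \<beta>0 sq nonres]) auto
  then obtain q P where qP: "\<And>k. newton_solution \<Omega> U (q k)" "\<And>k. minimal_period (q k) (P k)"
    "\<And>k. \<bar>P k - 2 * pi / \<beta> j0\<bar> < inverse (real (Suc k))"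
    "\<And>k t. q k t \<in> ball q0 (inverse (real (Suc k)))" by metis
  have "(\<lambda>k. P k - 2 * pi / \<beta> j0) \<longlonglongrightarrow> 0"
    by (rule Lim_null_comparison[OF _ LIMSEQ_inverse_real_of_nat])
      (use qP(3) in \<open>auto intro!: always_eventually less_imp_le\<close>)
  then have "P \<longlonglongrightarrow> 2 * pi / \<beta> j0" by (rule LIM_zero_cancel)
  moreover have "\<exists>k0. \<forall>k\<ge>k0. q k ` {0..P k} \<subseteq> neighbourhood_of (group_orbit G \<rho> q0) \<epsilon>" if \<epsilon>: "\<epsilon> > 0" for \<epsilon>
  proof -
    obtain k0 where k0: "inverse (real (Suc k0)) < \<epsilon>" using reals_Archimedean[OF \<epsilon>] by blast
    have "q0 \<in> group_orbit G \<rho> q0"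
    proof -
      obtain g where "g \<in> carrier G" "mat 1 = \<rho> g" using matrix_group.one_H[OF grp] by blast
      then show ?thesis unfolding group_orbit_def by (metis (mono_tags, lifting) matrix_vector_mul_lid mem_Collect_eq)
    qed
    moreover have "q k t \<in> ball q0 \<epsilon>" if "k \<ge> k0" for k t
    proof -
      have "inverse (real (Suc k)) \<le> inverse (real (Suc k0))" using that by (intro le_imp_inverse_le) auto
      then show ?thesis using qP(4)[of k t] k0 unfolding mem_ball by linarith
    qed
    ultimately show ?thesis unfolding neighbourhood_of_def by blast
  qed
  ultimately show ?thesis using qP(1,2) by blast
qed

end
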